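(* Let $(\mathfrak g,\delta_{\mathfrak g})$ be a Lie bialgebra with double Lie bialgebra $(\mathfrak d,\delta_{\mathfrak d})$, let $n\ge2$, and let $(Y_j,\pi_j,\sigma_j)$, $1\le j\le n$, be left $(\mathfrak d,\delta_{\mathfrak d})$-Poisson spaces. Set $\rho_j=-\sigma_j|_{\mathfrak g^*}$ and $\lambda_j=\sigma_j|_{\mathfrak g}$. Let $\{x_i\}_{i=1}^m$ be a basis of $\mathfrak g$ with dual basis $\{\xi_i\}_{i=1}^m$ of $\mathfrak g^*$. On $Y=Y_1\times\cdots\times Y_n$ define $$\pi_Y=(\pi_1,\ldots,\pi_n)-\sum_{1\le j<k\le n}\sum_{i=1}^m(0,\ldots,\underset{j\text{-th}}{\rho_j(\xi_i)},\ldots,0)\wedge(0,\ldots,\underset{k\text{-th}}{\lambda_k(x_i)},\ldots,0),$$ and let $\sigma(a_1,\ldots,a_n)=(\sigma_1(a_1),\ldots,\sigma_n(a_n))$ be the direct product action of $\mathfrak d^n$ on $Y$. Then the triple $(Y,\pi_Y,\sigma)$ is a left $(\mathfrak d^n,\delta_{\mathfrak d^n})$-Poisson space. Moreover, for $1\le j<k\le n$, one has $p_{jk}(\pi_Y)=\pi_j\times_{(\rho_j,\lambda_k)}\pi_k$, where $p_{jk}:Y\to Y_j\times Y_k$ is the projection to the $j$-th and $k$-th factors.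
   Context: Everything is over $\mathbf k=\mathbb R$ (smooth) or $\mathbb C$ (holomorphic), finite dimensional; $u\wedge v=u\otimes v-v\otimes u$. A left (right) action of a Lie algebra is a Lie algebra anti-homomorphism (homomorphism) $\sigma$ into vector fields. A left (right) Poisson space of a Lie bialgebra $(\mathfrak a,\delta_{\mathfrak a})$ is $(Y,\pi_Y,\sigma)$ with $(Y,\pi_Y)$ Poisson, $\sigma$ a left (right) action of $\mathfrak a$, and $[\sigma(a),\pi_Y]=\sigma(\delta_{\mathfrak a}(a))$, where $\sigma(u\wedge v)=\sigma(u)\wedge\sigma(v)$. On a product, $(A_1,\ldots,A_n)$ is the sum of the tensor fields $A_j$ regarded as tensor fields on the product. Double. $\mathfrak g^*$ has the Lie bracket dual to $\delta_{\mathfrak g}$ and co-bracket $\delta_{\mathfrak g^*}$ dual to the bracket of $\mathfrak g$. $\mathfrak d=\mathfrak g\oplus\mathfrak g^*$ has the form $\langle x+\xi,y+\eta\rangle_{\mathfrak d}=\langle x,\eta\rangle+\langle\xi,y\rangle$ and the unique Lie bracket extending those of $\mathfrak g$, $\mathfrak g^*$ and making the form ad-invariant. The double Lie bialgebra co-bracket is $\delta_{\mathfrak d}(a)=\mathrm{ad}_ar_{\mathfrak d}$, $r_{\mathfrak d}=\sum_ix_i\otimes\xi_i$; it restricts to $\delta_{\mathfrak g}$ on $\mathfrak g$ and $-\delta_{\mathfrak g^*}$ on $\mathfrak g^*$. Hence $\rho_j$, $\lambda_j$ are right, left Poisson actions of $(\mathfrak g^*,\delta_{\mathfrak g^*})$,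 $(\mathfrak g,\delta_{\mathfrak g})$ on $(Y_j,\pi_j)$. Co-bracket on $\mathfrak d^n$. Equip the direct product Lie algebra $\mathfrak d^n$ with $\langle(a_j),(a'_j)\rangle_{\mathfrak d^n}=\sum_{j=1}^n(-1)^{j+1}\langle a_j,a_j'\rangle_{\mathfrak d}$. With $\mathfrak d_{\rm diag}=\{(a,a):a\in\mathfrak d\}\subset\mathfrak d^2$, set for $q\ge1$: $\mathfrak g_{(2q-1)}=\mathfrak d_{\rm diag}^{\oplus(q-1)}\oplus\mathfrak g$, $\mathfrak g^*_{(2q-1)}=\mathfrak g^*\oplus\mathfrak d_{\rm diag}^{\oplus(q-1)}$ in $\mathfrak d^{2q-1}$, and $\mathfrak g_{(2q)}=\mathfrak d_{\rm diag}^{\oplus q}$, $\mathfrak g^*_{(2q)}=\mathfrak g^*\oplus\mathfrak d_{\rm diag}^{\oplus(q-1)}\oplus\mathfrak g$ in $\mathfrak d^{2q}$. Then $\mathfrak d^n=\mathfrak g_{(n)}+\mathfrak g_{(n)}^*$ is a decomposition into complementary Lagrangian subalgebras. Let $r_{\mathfrak d^n}=\sum_ku_k\otimes u^k$ with $\{u_k\}$ a basis of $\mathfrak g_{(n)}$ and $\{u^k\}$ the dual basis of $\mathfrak g^*_{(n)}$ with respect to $\langle\,,\,\rangle_{\mathfrak d^n}$; then $\delta_{\mathfrak d^n}(a)=\mathrm{ad}_ar_{\mathfrak d^n}$. Two-fold mixed product. For a right $(\mathfrak g^*,\delta_{\mathfrak g^*})$-Poisson space $(X,\pi_X,\rho)$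 and a left $(\mathfrak g,\delta_{\mathfrak g})$-Poisson space $(W,\pi_W,\lambda)$, $\pi_X\times_{(\rho,\lambda)}\pi_W=(\pi_X,\pi_W)-\sum_{i=1}^m(\rho(\xi_i),0)\wedge(0,\lambda(x_i))$ on $X\times W$. *)

theory Defs
  imports "HOL-Analysis.Analysis" "HOL-Library.Function_Algebras"
begin

text \<open>
  The ground field is a type of class \<^class>\<open>real_normed_field\<close>. Such a field is a commutative
  normed division algebra over the reals, hence by Gelfand-Mazur it is isomorphic to the real or
  the complex numbers. Derivatives are taken over the ground field, so that below ``smooth'' means
  infinitely differentiable over the reals and holomorphic over the complex numbers.

  Addition, subtraction and finite sums of functions (functionals, elements of a power of a Lie
  algebra, components of tensor fields) are pointwise.
\<close>


section \<open>Lie algebras, tensors and Lie bialgebras\<close>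

text \<open>
  A Lie algebra lives on a finite dimensional subspace \<open>lcarrier\<close> of a vector space whose vectors
  are all elements of the type \<open>'v\<close>.
\<close>

record ('k, 'v) lie_alg =
  lcarrier :: "'v set"
  lscale :: "'k \<Rightarrow> 'v \<Rightarrow> 'v"
  lbracket :: "'v \<Rightarrow> 'v \<Rightarrow> 'v"

definition lie_algebra :: "('k::field, 'v::ab_group_add) lie_alg \<Rightarrow> bool" where
  "lie_algebra L \<longleftrightarrow>
     vector_space (lscale L) \<and>
     module.subspace (lscale L) (lcarrier L) \<and>
     (\<exists>B. finite B \<and> module.span (lscale L) B = lcarrier L) \<and>
     (\<forall>a\<in>lcarrier L. \<forall>b\<in>lcarrier L. lbracket L a b \<in> lcarrier L) \<and>
     (\<forall>a\<in>lcarrier L. \<forall>b\<in>lcarrier L. \<forall>c\<in>lcarrier L. \<forall>s.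
        lbracket L (a + b) c = lbracket L a c + lbracket L b c \<and>
        lbracket L c (a + b) = lbracket L c a + lbracket L c b \<and>
        lbracket L (lscale L s a) b = lscale L s (lbracket L a b) \<and>
        lbracket L a (lscale L s b) = lscale L s (lbracket L a b)) \<and>
     (\<forall>a\<in>lcarrier L. lbracket L a a = 0) \<and>
     (\<forall>a\<in>lcarrier L. \<forall>b\<in>lcarrier L. \<forall>c\<in>lcarrier L.
        lbracket L a (lbracket L b c) + lbracket L b (lbracket L c a)
          + lbracket L c (lbracket L a b) = 0)"

text \<open>
  Linear functionals on the carrier are extended by \<open>0\<close> to the rest of the type, which makes
  their representation unique.
\<close>

definition restrict0 :: "'v set \<Rightarrow> ('v \<Rightarrow> 'k::zero) \<Rightarrow> 'v \<Rightarrow> 'k" where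
  "restrict0 A f = (\<lambda>a. if a \<in> A then f a else 0)"

definition dual_space :: "('k::field, 'v::ab_group_add) lie_alg \<Rightarrow> ('v \<Rightarrow> 'k) set" where
  "dual_space L = {f.
     (\<forall>a\<in>lcarrier L. \<forall>b\<in>lcarrier L. f (a + b) = f a + f b) \<and>
     (\<forall>s. \<forall>a\<in>lcarrier L. f (lscale L s a) = s * f a) \<and>
     (\<forall>a. a \<notin> lcarrier L \<longrightarrow> f a = 0)}"

definition fscale :: "'k::times \<Rightarrow> ('v \<Rightarrow> 'k) \<Rightarrow> 'v \<Rightarrow> 'k" where
  "fscale s f = (\<lambda>a. s * f a)"

text \<open>
  An element of \<open>L \<otimes> L\<close> is represented by the bilinear form on the dual space that it induces:
  \<open>u \<otimes> v\<close> is the form sending \<open>\<alpha>, \<beta>\<close> to \<open>\<alpha>(u) \<beta>(v)\<close>. Only its values on the dual space matter.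
\<close>

type_synonym ('k, 'v) tensor2 = "('v \<Rightarrow> 'k) \<Rightarrow> ('v \<Rightarrow> 'k) \<Rightarrow> 'k"

definition tensor_sum :: "'b set \<Rightarrow> ('b \<Rightarrow> 'v) \<Rightarrow> ('b \<Rightarrow> 'v) \<Rightarrow> ('k::field, 'v) tensor2" where
  "tensor_sum K u v = (\<lambda>\<alpha> \<beta>. \<Sum>k\<in>K. \<alpha> (u k) * \<beta> (v k))"

definition skew_tensor :: "('k::field, 'v::ab_group_add) lie_alg \<Rightarrow> ('k, 'v) tensor2 \<Rightarrow> bool" where
  "skew_tensor L t \<longleftrightarrow>
     (\<forall>\<alpha>\<in>dual_space L. \<forall>\<beta>\<in>dual_space L. \<forall>\<gamma>\<in>dual_space L. \<forall>s.
        t (\<alpha> + \<beta>) \<gamma> = t \<alpha> \<gamma> + t \<beta> \<gamma> \<and> t (fscale s \<alpha>) \<beta> = s * t \<alpha> \<beta> \<and> t \<beta> \<alpha> = - t \<alpha> \<beta>)"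

text \<open>\<open>ad_a\<close> acting on \<open>L \<otimes> L\<close>, i.e. \<open>ad_a (u \<otimes> v) = [a, u] \<otimes> v + u \<otimes> [a, v]\<close>.\<close>

definition ad_tensor ::
  "('k::field, 'v::ab_group_add) lie_alg \<Rightarrow> 'v \<Rightarrow> ('k, 'v) tensor2 \<Rightarrow> ('k, 'v) tensor2" where
  "ad_tensor L a t = (\<lambda>\<alpha> \<beta>.
     t (restrict0 (lcarrier L) (\<lambda>b. \<alpha> (lbracket L a b))) \<beta> +
     t \<alpha> (restrict0 (lcarrier L) (\<lambda>b. \<beta> (lbracket L a b))))"

definition coboundary ::
  "('k::field, 'v::ab_group_add) lie_alg \<Rightarrow> ('k, 'v) tensor2 \<Rightarrow> 'v \<Rightarrow> ('k, 'v) tensor2" where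
  "coboundary L r = (\<lambda>a. ad_tensor L a r)"

text \<open>The dual space with the bracket dual to \<open>\<delta>\<close>.\<close>

definition dual_lie ::
  "('k::field, 'v::ab_group_add) lie_alg \<Rightarrow> ('v \<Rightarrow> ('k, 'v) tensor2) \<Rightarrow> ('k, 'v \<Rightarrow> 'k) lie_alg" where
  "dual_lie L \<delta> =
     \<lparr>lcarrier = dual_space L, lscale = fscale,
      lbracket = (\<lambda>\<xi> \<eta>. restrict0 (lcarrier L) (\<lambda>a. \<delta> a \<xi> \<eta>))\<rparr>"

definition lie_bialgebra ::
  "('k::field, 'v::ab_group_add) lie_alg \<Rightarrow> ('v \<Rightarrow> ('k, 'v) tensor2) \<Rightarrow> bool" where
  "lie_bialgebra L \<delta> \<longleftrightarrow>
     lie_algebra L \<and>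
     (\<forall>a\<in>lcarrier L. skew_tensor L (\<delta> a)) \<and>
     (\<forall>\<alpha>\<in>dual_space L. \<forall>\<beta>\<in>dual_space L. \<forall>a\<in>lcarrier L. \<forall>b\<in>lcarrier L. \<forall>s.
        \<delta> (a + b) \<alpha> \<beta> = \<delta> a \<alpha> \<beta> + \<delta> b \<alpha> \<beta> \<and>
        \<delta> (lscale L s a) \<alpha> \<beta> = s * \<delta> a \<alpha> \<beta> \<and>
        \<delta> (lbracket L a b) \<alpha> \<beta> = ad_tensor L a (\<delta> b) \<alpha> \<beta> - ad_tensor L b (\<delta> a) \<alpha> \<beta>) \<and>
     lie_algebra (dual_lie L \<delta>)"


section \<open>The double and its powers\<close>

definition double_form :: "'v \<times> ('v \<Rightarrow> 'k) \<Rightarrow> 'v \<times> ('v \<Rightarrow> 'k) \<Rightarrow> 'k::field" where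
  "double_form a b = snd b (fst a) + snd a (fst b)"

text \<open>
  \<open>D\<close> is the double of \<open>(G, \<delta>)\<close>. The bracket on the carrier is determined by these conditions.
\<close>

definition is_double ::
  "('k::field, 'v::ab_group_add) lie_alg \<Rightarrow> ('v \<Rightarrow> ('k, 'v) tensor2)
     \<Rightarrow> ('k, 'v \<times> ('v \<Rightarrow> 'k)) lie_alg \<Rightarrow> bool" where
  "is_double G \<delta> D \<longleftrightarrow>
     lcarrier D = lcarrier G \<times> dual_space G \<and>
     lscale D = (\<lambda>s (x, \<xi>). (lscale G s x, fscale s \<xi>)) \<and>
     lie_algebra D \<and>
     (\<forall>x\<in>lcarrier G. \<forall>y\<in>lcarrier G. lbracket D (x, 0) (y, 0) = (lbracket G x y, 0)) \<and>
     (\<forall>\<xi>\<in>dual_space G. \<forall>\<eta>\<in>dual_space G.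
        lbracket D (0, \<xi>) (0, \<eta>) = (0, lbracket (dual_lie G \<delta>) \<xi> \<eta>)) \<and>
     (\<forall>a\<in>lcarrier D. \<forall>b\<in>lcarrier D. \<forall>c\<in>lcarrier D.
        double_form (lbracket D a b) c + double_form b (lbracket D a c) = 0)"

text \<open>
  The \<open>n\<close>-th power of \<open>D\<close>: an \<open>n\<close>-tuple \<open>(a\<^sub>1, \<dots>, a\<^sub>n)\<close> is a function on \<open>nat\<close> vanishing outside
  \<open>{1..n}\<close>.
\<close>

definition power_lie :: "('k::field, 'v::ab_group_add) lie_alg \<Rightarrow> nat \<Rightarrow> ('k, nat \<Rightarrow> 'v) lie_alg" where
  "power_lie D n =
     \<lparr>lcarrier = {a. (\<forall>j\<in>{1..n}. a j \<in> lcarrier D) \<and> (\<forall>j. j \<notin> {1..n} \<longrightarrow> a j = 0)},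
      lscale = (\<lambda>s a j. lscale D s (a j)),
      lbracket = (\<lambda>a b j. if j \<in> {1..n} then lbracket D (a j) (b j) else 0)\<rparr>"

definition power_form ::
  "nat \<Rightarrow> (nat \<Rightarrow> 'v \<times> ('v \<Rightarrow> 'k)) \<Rightarrow> (nat \<Rightarrow> 'v \<times> ('v \<Rightarrow> 'k)) \<Rightarrow> 'k::field" where
  "power_form n a b = (\<Sum>j = 1..n. (-1) ^ (j + 1) * double_form (a j) (b j))"

definition g_part :: "('k, 'v \<times> ('v \<Rightarrow> 'k::zero)) lie_alg \<Rightarrow> ('v \<times> ('v \<Rightarrow> 'k)) set" where
  "g_part D = {a \<in> lcarrier D. snd a = 0}"

definition gstar_part :: "('k, 'v::zero \<times> ('v \<Rightarrow> 'k)) lie_alg \<Rightarrow> ('v \<times> ('v \<Rightarrow> 'k)) set" where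
  "gstar_part D = {a \<in> lcarrier D. fst a = 0}"

text \<open>
  The Lagrangian subalgebras: for \<open>lagr_g\<close> the diagonal copies of \<open>D\<close> occupy the positions
  \<open>(1,2), (3,4), \<dots>\<close> and for odd \<open>n\<close> the last entry is in \<open>\<gg>\<close>; for \<open>lagr_gstar\<close> the first entry is
  in the dual, the diagonal copies occupy the positions \<open>(2,3), (4,5), \<dots>\<close> and for even \<open>n\<close> the
  last entry is in \<open>\<gg>\<close>.
\<close>

definition lagr_g ::
  "('k::field, 'v::ab_group_add \<times> ('v \<Rightarrow> 'k)) lie_alg \<Rightarrow> nat \<Rightarrow> (nat \<Rightarrow> 'v \<times> ('v \<Rightarrow> 'k)) set" where
  "lagr_g D n = {a \<in> lcarrier (power_lie D n).
     (\<forall>i\<in>{1..<n}. odd i \<longrightarrow> a i = a (i + 1)) \<and>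
     (odd n \<longrightarrow> a n \<in> g_part D)}"

definition lagr_gstar ::
  "('k::field, 'v::ab_group_add \<times> ('v \<Rightarrow> 'k)) lie_alg \<Rightarrow> nat \<Rightarrow> (nat \<Rightarrow> 'v \<times> ('v \<Rightarrow> 'k)) set" where
  "lagr_gstar D n = {a \<in> lcarrier (power_lie D n).
     a 1 \<in> gstar_part D \<and>
     (\<forall>i\<in>{1..<n}. even i \<longrightarrow> a i = a (i + 1)) \<and>
     (even n \<longrightarrow> a n \<in> g_part D)}"

definition is_basis :: "('k::field \<Rightarrow> 'v::ab_group_add \<Rightarrow> 'v) \<Rightarrow> 'v set \<Rightarrow> 'b set \<Rightarrow> ('b \<Rightarrow> 'v) \<Rightarrow> bool" where
  "is_basis s V K u \<longleftrightarrow>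
     finite K \<and> inj_on u K \<and> \<not> module.dependent s (u ` K) \<and> module.span s (u ` K) = V"

definition dual_wrt :: "('v \<Rightarrow> 'w \<Rightarrow> 'k::zero_neq_one) \<Rightarrow> 'b set \<Rightarrow> ('b \<Rightarrow> 'v) \<Rightarrow> ('b \<Rightarrow> 'w) \<Rightarrow> bool" where
  "dual_wrt B K u v \<longleftrightarrow> (\<forall>k\<in>K. \<forall>l\<in>K. B (u k) (v l) = (if k = l then 1 else 0))"


section \<open>Smooth functions on open subsets of coordinate space\<close>

text \<open>
  Coordinates are labelled by a finite set \<open>I\<close> (so the dimension is \<open>card I\<close>), and points of
  coordinate space are functions on \<open>I\<close>, extended by \<^const>\<open>undefined\<close>.
\<close>

abbreviation coord_space :: "'i set \<Rightarrow> ('i \<Rightarrow> 'k::topological_space) topology" where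
  "coord_space I \<equiv> product_topology (\<lambda>_. euclidean) I"

definition pderiv_at :: "'i \<Rightarrow> (('i \<Rightarrow> 'k) \<Rightarrow> 'k) \<Rightarrow> ('i \<Rightarrow> 'k) \<Rightarrow> 'k::real_normed_field" where
  "pderiv_at i f x = deriv (\<lambda>t. f (x(i := t))) (x i)"

fun iter_pderiv :: "'i list \<Rightarrow> (('i \<Rightarrow> 'k) \<Rightarrow> 'k) \<Rightarrow> ('i \<Rightarrow> 'k) \<Rightarrow> 'k::real_normed_field" where
  "iter_pderiv [] f = f"
| "iter_pderiv (i # is) f = pderiv_at i (iter_pderiv is f)"

text \<open>
  On open \<open>W\<close>: all iterated partial derivatives exist and are continuous. Over the complex
  numbers this says that the function is holomorphic.
\<close>

definition smooth_on :: "'i set \<Rightarrow> ('i \<Rightarrow> 'k) set \<Rightarrow> (('i \<Rightarrow> 'k) \<Rightarrow> 'k::real_normed_field) \<Rightarrow> bool" where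
  "smooth_on I W f \<longleftrightarrow>
     (\<forall>is. set is \<subseteq> I \<longrightarrow>
        continuous_map (subtopology (coord_space I) W) euclidean (iter_pderiv is f) \<and>
        (\<forall>i\<in>I. \<forall>x\<in>W. (\<lambda>t. iter_pderiv is f (x(i := t))) field_differentiable at (x i)))"


section \<open>Manifolds\<close>

text \<open>
  A manifold is given by an atlas, not necessarily maximal: a family of charts indexed by the set
  \<open>mcharts\<close>. Labelling the charts keeps track of the factors of a product chart.
\<close>

record ('k, 'p, 'i, 'c) manifold =
  mtop :: "'p topology"
  mind :: "'i set"
  mcharts :: "'c set"
  mdom :: "'c \<Rightarrow> 'p set"
  mcoord :: "'c \<Rightarrow> 'p \<Rightarrow> 'i \<Rightarrow> 'k"

abbreviation mimg :: "('k, 'p, 'i, 'c) manifold \<Rightarrow> 'c \<Rightarrow> ('i \<Rightarrow> 'k) set" where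
  "mimg M c \<equiv> mcoord M c ` mdom M c"

abbreviation mparam :: "('k, 'p, 'i, 'c) manifold \<Rightarrow> 'c \<Rightarrow> ('i \<Rightarrow> 'k) \<Rightarrow> 'p" where
  "mparam M c \<equiv> inv_into (mdom M c) (mcoord M c)"

definition local_rep ::
  "('k, 'p, 'i, 'c) manifold \<Rightarrow> ('k, 'q, 'j, 'd) manifold \<Rightarrow> ('p \<Rightarrow> 'q) \<Rightarrow> 'c \<Rightarrow> 'd
     \<Rightarrow> 'j \<Rightarrow> ('i \<Rightarrow> 'k) \<Rightarrow> 'k" where
  "local_rep M N f c d j x = mcoord N d (f (mparam M c x)) j"

definition local_dom ::
  "('k, 'p, 'i, 'c) manifold \<Rightarrow> ('k, 'q, 'j, 'd) manifold \<Rightarrow> ('p \<Rightarrow> 'q) \<Rightarrow> 'c \<Rightarrow> 'd \<Rightarrow> 'p set" where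
  "local_dom M N f c d = {p \<in> mdom M c. f p \<in> mdom N d}"

definition jacobian ::
  "('k::real_normed_field, 'p, 'i, 'c) manifold \<Rightarrow> ('k, 'q, 'j, 'd) manifold \<Rightarrow> ('p \<Rightarrow> 'q)
     \<Rightarrow> 'c \<Rightarrow> 'd \<Rightarrow> 'p \<Rightarrow> 'j \<Rightarrow> 'i \<Rightarrow> 'k" where
  "jacobian M N f c d p j i = pderiv_at i (local_rep M N f c d j) (mcoord M c p)"

definition smooth_map ::
  "('k::real_normed_field, 'p, 'i, 'c) manifold \<Rightarrow> ('k, 'q, 'j, 'd) manifold \<Rightarrow> ('p \<Rightarrow> 'q) \<Rightarrow> bool" where
  "smooth_map M N f \<longleftrightarrow>
     continuous_map (mtop M) (mtop N) f \<and>
     (\<forall>c\<in>mcharts M. \<forall>d\<in>mcharts N. \<forall>j\<in>mind N.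
        smooth_on (mind M) (mcoord M c ` local_dom M N f c d) (local_rep M N f c d j))"

definition manifold :: "('k::real_normed_field, 'p, 'i, 'c) manifold \<Rightarrow> bool" where
  "manifold M \<longleftrightarrow>
     Hausdorff_space (mtop M) \<and> second_countable (mtop M) \<and> finite (mind M) \<and>
     (\<Union>c\<in>mcharts M. mdom M c) = topspace (mtop M) \<and>
     (\<forall>c\<in>mcharts M.
        openin (mtop M) (mdom M c) \<and> openin (coord_space (mind M)) (mimg M c) \<and>
        homeomorphic_map (subtopology (mtop M) (mdom M c))
          (subtopology (coord_space (mind M)) (mimg M c)) (mcoord M c)) \<and>
     (\<forall>c\<in>mcharts M. \<forall>c'\<in>mcharts M. \<forall>i\<in>mind M.
        smooth_on (mind M) (mcoord M c ` (mdom M c \<inter> mdom M c')) (local_rep M M id c c' i))"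


section \<open>Vector fields, bivector fields and Poisson structures\<close>

text \<open>
  Tensor fields are given by their components: \<open>X c x i\<close> is the \<open>i\<close>-th component of the vector
  field \<open>X\<close> with respect to the chart \<open>c\<close> at the point with coordinates \<open>x\<close>, and bivector fields
  have components \<open>P c x i j\<close>, those of a skew-symmetric section of the tensor square of the
  tangent bundle. Only the values for charts \<open>c\<close> of the atlas, \<open>x\<close> in the image of \<open>c\<close>, and
  coordinate labels \<open>i\<close>, \<open>j\<close> matter.
\<close>

type_synonym ('k, 'i, 'c) vf = "'c \<Rightarrow> ('i \<Rightarrow> 'k) \<Rightarrow> 'i \<Rightarrow> 'k"
type_synonym ('k, 'i, 'c) bvf = "'c \<Rightarrow> ('i \<Rightarrow> 'k) \<Rightarrow> 'i \<Rightarrow> 'i \<Rightarrow> 'k"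

definition vf_eq :: "('k, 'p, 'i, 'c) manifold \<Rightarrow> ('k, 'i, 'c) vf \<Rightarrow> ('k, 'i, 'c) vf \<Rightarrow> bool" where
  "vf_eq M X Z \<longleftrightarrow> (\<forall>c\<in>mcharts M. \<forall>x\<in>mimg M c. \<forall>i\<in>mind M. X c x i = Z c x i)"

definition bvf_eq :: "('k, 'p, 'i, 'c) manifold \<Rightarrow> ('k, 'i, 'c) bvf \<Rightarrow> ('k, 'i, 'c) bvf \<Rightarrow> bool" where
  "bvf_eq M P Q \<longleftrightarrow>
     (\<forall>c\<in>mcharts M. \<forall>x\<in>mimg M c. \<forall>i\<in>mind M. \<forall>j\<in>mind M. P c x i j = Q c x i j)"

text \<open>
  \<open>X\<close> and \<open>Z\<close> are related by \<open>f\<close>, i.e. the differential of \<open>f\<close> maps the value of \<open>X\<close> at \<open>p\<close> to the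
  value of \<open>Z\<close> at \<open>f p\<close>, for all \<open>p\<close>. For the identity map this is the transformation law of
  vector fields under changes of charts.
\<close>

definition vf_related ::
  "('k::real_normed_field, 'p, 'i, 'c) manifold \<Rightarrow> ('k, 'q, 'j, 'd) manifold \<Rightarrow> ('p \<Rightarrow> 'q)
     \<Rightarrow> ('k, 'i, 'c) vf \<Rightarrow> ('k, 'j, 'd) vf \<Rightarrow> bool" where
  "vf_related M N f X Z \<longleftrightarrow>
     (\<forall>c\<in>mcharts M. \<forall>d\<in>mcharts N. \<forall>p\<in>local_dom M N f c d. \<forall>j\<in>mind N.
        Z d (mcoord N d (f p)) j =
          (\<Sum>a\<in>mind M. jacobian M N f c d p j a * X c (mcoord M c p) a))"

definition bvf_related ::
  "('k::real_normed_field, 'p, 'i, 'c) manifold \<Rightarrow> ('k, 'q, 'j, 'd) manifold \<Rightarrow> ('p \<Rightarrow> 'q)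
     \<Rightarrow> ('k, 'i, 'c) bvf \<Rightarrow> ('k, 'j, 'd) bvf \<Rightarrow> bool" where
  "bvf_related M N f P Q \<longleftrightarrow>
     (\<forall>c\<in>mcharts M. \<forall>d\<in>mcharts N. \<forall>p\<in>local_dom M N f c d. \<forall>j\<in>mind N. \<forall>l\<in>mind N.
        Q d (mcoord N d (f p)) j l =
          (\<Sum>a\<in>mind M. \<Sum>b\<in>mind M.
             jacobian M N f c d p j a * jacobian M N f c d p l b * P c (mcoord M c p) a b))"

definition vector_field :: "('k::real_normed_field, 'p, 'i, 'c) manifold \<Rightarrow> ('k, 'i, 'c) vf \<Rightarrow> bool" where
  "vector_field M X \<longleftrightarrow>
     (\<forall>c\<in>mcharts M. \<forall>i\<in>mind M. smooth_on (mind M) (mimg M c) (\<lambda>x. X c x i)) \<and>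
     vf_related M M id X X"

definition bivector_field :: "('k::real_normed_field, 'p, 'i, 'c) manifold \<Rightarrow> ('k, 'i, 'c) bvf \<Rightarrow> bool" where
  "bivector_field M P \<longleftrightarrow>
     (\<forall>c\<in>mcharts M. \<forall>i\<in>mind M. \<forall>j\<in>mind M.
        smooth_on (mind M) (mimg M c) (\<lambda>x. P c x i j)) \<and>
     (\<forall>c\<in>mcharts M. \<forall>x\<in>mimg M c. \<forall>i\<in>mind M. \<forall>j\<in>mind M. P c x j i = - P c x i j) \<and>
     bvf_related M M id P P"

definition wedge :: "('k::ring, 'i, 'c) vf \<Rightarrow> ('k, 'i, 'c) vf \<Rightarrow> ('k, 'i, 'c) bvf" where
  "wedge X Z = (\<lambda>c x i j. X c x i * Z c x j - Z c x i * X c x j)"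

definition vf_bracket ::
  "('k::real_normed_field, 'p, 'i, 'c) manifold \<Rightarrow> ('k, 'i, 'c) vf \<Rightarrow> ('k, 'i, 'c) vf
     \<Rightarrow> ('k, 'i, 'c) vf" where
  "vf_bracket M X Z = (\<lambda>c x i. \<Sum>l\<in>mind M.
     X c x l * pderiv_at l (\<lambda>y. Z c y i) x - Z c x l * pderiv_at l (\<lambda>y. X c y i) x)"

text \<open>
  The Schouten bracket \<open>[X, P]\<close> of a vector field and a bivector field, i.e. the Lie derivative of
  \<open>P\<close> along \<open>X\<close>, so that \<open>[X, U \<and> V] = [X, U] \<and> V + U \<and> [X, V]\<close>.
\<close>

definition schouten_vf ::
  "('k::real_normed_field, 'p, 'i, 'c) manifold \<Rightarrow> ('k, 'i, 'c) vf \<Rightarrow> ('k, 'i, 'c) bvf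
     \<Rightarrow> ('k, 'i, 'c) bvf" where
  "schouten_vf M X P = (\<lambda>c x i j. \<Sum>l\<in>mind M.
     X c x l * pderiv_at l (\<lambda>y. P c y i j) x
     - P c x l j * pderiv_at l (\<lambda>y. X c y i) x
     - P c x i l * pderiv_at l (\<lambda>y. X c y j) x)"

text \<open>
  The components of the Schouten bracket \<open>[P, P]\<close>, up to a nonzero constant factor depending on
  conventions. They are the Jacobiators of the coordinate functions under the bracket
  \<open>{f, g} = P(df, dg)\<close>.
\<close>

definition schouten_self ::
  "('k::real_normed_field, 'p, 'i, 'c) manifold \<Rightarrow> ('k, 'i, 'c) bvf
     \<Rightarrow> 'c \<Rightarrow> ('i \<Rightarrow> 'k) \<Rightarrow> 'i \<Rightarrow> 'i \<Rightarrow> 'i \<Rightarrow> 'k" where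
  "schouten_self M P = (\<lambda>c x i j k. \<Sum>l\<in>mind M.
     P c x i l * pderiv_at l (\<lambda>y. P c y j k) x
     + P c x j l * pderiv_at l (\<lambda>y. P c y k i) x
     + P c x k l * pderiv_at l (\<lambda>y. P c y i j) x)"

definition poisson_structure :: "('k::real_normed_field, 'p, 'i, 'c) manifold \<Rightarrow> ('k, 'i, 'c) bvf \<Rightarrow> bool" where
  "poisson_structure M P \<longleftrightarrow>
     bivector_field M P \<and>
     (\<forall>c\<in>mcharts M. \<forall>x\<in>mimg M c. \<forall>i\<in>mind M. \<forall>j\<in>mind M. \<forall>k\<in>mind M.
        schouten_self M P c x i j k = 0)"

definition left_action ::
  "('k::real_normed_field, 'v::ab_group_add) lie_alg \<Rightarrow> ('k, 'p, 'i, 'c) manifold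
     \<Rightarrow> ('v \<Rightarrow> ('k, 'i, 'c) vf) \<Rightarrow> bool" where
  "left_action L M \<sigma> \<longleftrightarrow>
     (\<forall>a\<in>lcarrier L. vector_field M (\<sigma> a)) \<and>
     (\<forall>a\<in>lcarrier L. \<forall>b\<in>lcarrier L. vf_eq M (\<sigma> (a + b)) (\<sigma> a + \<sigma> b)) \<and>
     (\<forall>s. \<forall>a\<in>lcarrier L. vf_eq M (\<sigma> (lscale L s a)) (\<lambda>c x i. s * \<sigma> a c x i)) \<and>
     (\<forall>a\<in>lcarrier L. \<forall>b\<in>lcarrier L. vf_eq M (\<sigma> (lbracket L a b)) (- vf_bracket M (\<sigma> a) (\<sigma> b)))"

text \<open>
  The bivector field \<open>\<sigma>(t)\<close> for a tensor \<open>t\<close>, determined by linearity and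
  \<open>\<sigma>(u \<otimes> v) = \<sigma>(u) \<otimes> \<sigma>(v)\<close>: the \<open>(i, j)\<close> component is the value of \<open>t\<close>, viewed as a bilinear
  form, on the functionals sending \<open>a\<close> to the \<open>i\<close>-th and to the \<open>j\<close>-th component of \<open>\<sigma>(a)\<close>.
\<close>

definition act_tensor ::
  "('k::real_normed_field, 'v::ab_group_add) lie_alg \<Rightarrow> ('v \<Rightarrow> ('k, 'i, 'c) vf)
     \<Rightarrow> ('k, 'v) tensor2 \<Rightarrow> ('k, 'i, 'c) bvf" where
  "act_tensor L \<sigma> t = (\<lambda>c x i j.
     t (restrict0 (lcarrier L) (\<lambda>a. \<sigma> a c x i)) (restrict0 (lcarrier L) (\<lambda>a. \<sigma> a c x j)))"

definition left_poisson_space ::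
  "('k::real_normed_field, 'v::ab_group_add) lie_alg \<Rightarrow> ('v \<Rightarrow> ('k, 'v) tensor2)
     \<Rightarrow> ('k, 'p, 'i, 'c) manifold \<Rightarrow> ('k, 'i, 'c) bvf \<Rightarrow> ('v \<Rightarrow> ('k, 'i, 'c) vf) \<Rightarrow> bool" where
  "left_poisson_space L \<delta> M P \<sigma> \<longleftrightarrow>
     lie_bialgebra L \<delta> \<and> manifold M \<and> poisson_structure M P \<and> left_action L M \<sigma> \<and>
     (\<forall>a\<in>lcarrier L. bvf_eq M (schouten_vf M (\<sigma> a) P) (act_tensor L \<sigma> (\<delta> a)))"


section \<open>Products of manifolds\<close>

text \<open>The product \<open>Y\<^sub>1 \<times> \<dots> \<times> Y\<^sub>n\<close>, with the atlas of product charts.\<close>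

definition prod_manifold ::
  "nat \<Rightarrow> (nat \<Rightarrow> ('k, 'p, 'i, 'c) manifold) \<Rightarrow> ('k, nat \<Rightarrow> 'p, nat \<times> 'i, nat \<Rightarrow> 'c) manifold" where
  "prod_manifold n Y =
     \<lparr>mtop = product_topology (\<lambda>j. mtop (Y j)) {1..n},
      mind = (SIGMA j:{1..n}. mind (Y j)),
      mcharts = (\<Pi>\<^sub>E j\<in>{1..n}. mcharts (Y j)),
      mdom = (\<lambda>c. \<Pi>\<^sub>E j\<in>{1..n}. mdom (Y j) (c j)),
      mcoord = (\<lambda>c y. \<lambda>(j, i)\<in>(SIGMA j:{1..n}. mind (Y j)). mcoord (Y j) (c j) (y j) i)\<rparr>"

text \<open>A (bi)vector field on the \<open>j\<close>-th factor, regarded as one on the product.\<close>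

definition lift_vf ::
  "(nat \<Rightarrow> ('k, 'p, 'i, 'c) manifold) \<Rightarrow> nat \<Rightarrow> ('k::zero, 'i, 'c) vf
     \<Rightarrow> ('k, nat \<times> 'i, nat \<Rightarrow> 'c) vf" where
  "lift_vf Y j X = (\<lambda>c x (j', i).
     if j' = j then X (c j) (\<lambda>l\<in>mind (Y j). x (j, l)) i else 0)"

definition lift_bvf ::
  "(nat \<Rightarrow> ('k, 'p, 'i, 'c) manifold) \<Rightarrow> nat \<Rightarrow> ('k::zero, 'i, 'c) bvf
     \<Rightarrow> ('k, nat \<times> 'i, nat \<Rightarrow> 'c) bvf" where
  "lift_bvf Y j P = (\<lambda>c x (j', i) (j'', i').
     if j' = j \<and> j'' = j then P (c j) (\<lambda>l\<in>mind (Y j). x (j, l)) i i' else 0)"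

definition pair_manifold ::
  "('k, 'p, 'i, 'c) manifold \<Rightarrow> ('k, 'q, 'j, 'd) manifold \<Rightarrow> ('k, 'p \<times> 'q, 'i + 'j, 'c \<times> 'd) manifold" where
  "pair_manifold X W =
     \<lparr>mtop = prod_topology (mtop X) (mtop W),
      mind = mind X <+> mind W,
      mcharts = mcharts X \<times> mcharts W,
      mdom = (\<lambda>(c, d). mdom X c \<times> mdom W d),
      mcoord = (\<lambda>(c, d) (p, q). \<lambda>s\<in>mind X <+> mind W.
        (case s of Inl i \<Rightarrow> mcoord X c p i | Inr j \<Rightarrow> mcoord W d q j))\<rparr>"

definition lift_vf_fst ::
  "('k, 'p, 'i, 'c) manifold \<Rightarrow> ('k::zero, 'i, 'c) vf \<Rightarrow> ('k, 'i + 'j, 'c \<times> 'd) vf" where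
  "lift_vf_fst X A = (\<lambda>(c, d) x s.
     case s of Inl i \<Rightarrow> A c (\<lambda>l\<in>mind X. x (Inl l)) i | Inr j \<Rightarrow> 0)"

definition lift_vf_snd ::
  "('k, 'q, 'j, 'd) manifold \<Rightarrow> ('k::zero, 'j, 'd) vf \<Rightarrow> ('k, 'i + 'j, 'c \<times> 'd) vf" where
  "lift_vf_snd W A = (\<lambda>(c, d) x s.
     case s of Inl i \<Rightarrow> 0 | Inr j \<Rightarrow> A d (\<lambda>l\<in>mind W. x (Inr l)) j)"

definition lift_bvf_fst ::
  "('k, 'p, 'i, 'c) manifold \<Rightarrow> ('k::zero, 'i, 'c) bvf \<Rightarrow> ('k, 'i + 'j, 'c \<times> 'd) bvf" where
  "lift_bvf_fst X P = (\<lambda>(c, d) x s s'. case (s, s') of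
     (Inl i, Inl i') \<Rightarrow> P c (\<lambda>l\<in>mind X. x (Inl l)) i i' | _ \<Rightarrow> 0)"

definition lift_bvf_snd ::
  "('k, 'q, 'j, 'd) manifold \<Rightarrow> ('k::zero, 'j, 'd) bvf \<Rightarrow> ('k, 'i + 'j, 'c \<times> 'd) bvf" where
  "lift_bvf_snd W P = (\<lambda>(c, d) x s s'. case (s, s') of
     (Inr j, Inr j') \<Rightarrow> P d (\<lambda>l\<in>mind W. x (Inr l)) j j' | _ \<Rightarrow> 0)"


section \<open>Mixed products\<close>

text \<open>
  The two-fold mixed product of bivector fields \<open>P\<close> on \<open>X\<close> and \<open>Q\<close> on \<open>W\<close>; here \<open>x i\<close> and \<open>\<xi> i\<close>,
  \<open>i \<in> {1..m}\<close>, are dual bases of \<open>\<gg>\<close> and its dual.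
\<close>

definition mixed_product2 ::
  "nat \<Rightarrow> (nat \<Rightarrow> 'g) \<Rightarrow> (nat \<Rightarrow> 'h)
     \<Rightarrow> ('k::real_normed_field, 'p, 'i, 'c) manifold \<Rightarrow> ('k, 'i, 'c) bvf \<Rightarrow> ('h \<Rightarrow> ('k, 'i, 'c) vf)
     \<Rightarrow> ('k, 'q, 'j, 'd) manifold \<Rightarrow> ('k, 'j, 'd) bvf \<Rightarrow> ('g \<Rightarrow> ('k, 'j, 'd) vf)
     \<Rightarrow> ('k, 'i + 'j, 'c \<times> 'd) bvf" where
  "mixed_product2 m x \<xi> X P \<rho> W Q \<kappa> =
     lift_bvf_fst X P + lift_bvf_snd W Q
     - (\<Sum>i = 1..m. wedge (lift_vf_fst X (\<rho> (\<xi> i))) (lift_vf_snd W (\<kappa> (x i))))"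

definition mixed_product ::
  "nat \<Rightarrow> nat \<Rightarrow> (nat \<Rightarrow> 'g) \<Rightarrow> (nat \<Rightarrow> 'h)
     \<Rightarrow> (nat \<Rightarrow> ('k::real_normed_field, 'p, 'i, 'c) manifold) \<Rightarrow> (nat \<Rightarrow> ('k, 'i, 'c) bvf)
     \<Rightarrow> (nat \<Rightarrow> 'h \<Rightarrow> ('k, 'i, 'c) vf) \<Rightarrow> (nat \<Rightarrow> 'g \<Rightarrow> ('k, 'i, 'c) vf)
     \<Rightarrow> ('k, nat \<times> 'i, nat \<Rightarrow> 'c) bvf" where
  "mixed_product n m x \<xi> Y P \<rho> \<kappa> =
     (\<Sum>j = 1..n. lift_bvf Y j (P j))
     - (\<Sum>(j, k) \<in> {(j, k). 1 \<le> j \<and> j < k \<and> k \<le> n}. \<Sum>i = 1..m.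
          wedge (lift_vf Y j (\<rho> j (\<xi> i))) (lift_vf Y k (\<kappa> k (x i))))"

definition product_action ::
  "nat \<Rightarrow> (nat \<Rightarrow> ('k::real_normed_field, 'p, 'i, 'c) manifold)
     \<Rightarrow> (nat \<Rightarrow> 'v \<Rightarrow> ('k, 'i, 'c) vf) \<Rightarrow> (nat \<Rightarrow> 'v) \<Rightarrow> ('k, nat \<times> 'i, nat \<Rightarrow> 'c) vf" where
  "product_action n Y \<sigma> = (\<lambda>a. \<Sum>j = 1..n. lift_vf Y j (\<sigma> j (a j)))"

text \<open>The restrictions \<open>\<rho> = - \<sigma>|\<gg>\<^sup>*\<close> and \<open>\<lambda> = \<sigma>|\<gg>\<close> of an action of the double.\<close>

definition rho_of :: "('g::zero \<times> 'h \<Rightarrow> ('k::ring, 'i, 'c) vf) \<Rightarrow> 'h \<Rightarrow> ('k, 'i, 'c) vf" where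
  "rho_of \<sigma> = (\<lambda>\<xi>. - \<sigma> (0, \<xi>))"

definition lambda_of :: "('g \<times> 'h::zero \<Rightarrow> ('k::ring, 'i, 'c) vf) \<Rightarrow> 'g \<Rightarrow> ('k, 'i, 'c) vf" where
  "lambda_of \<sigma> = (\<lambda>x. \<sigma> (x, 0))"

end

theory Submission
  imports Defs
begin

text \<open>
  Write \<open>\<sigma>\<close> for the direct product action of the power of the double and \<open>T\<close> for the sum of the
  tensors with \<open>\<xi> i\<close> in position \<open>j\<close> wedge \<open>x i\<close> in position \<open>k\<close>, over all \<open>i\<close> and all \<open>j < k\<close>. Since
  \<open>\<rho>\<close> is minus the restriction of the action, the mixed product is the direct product bivector field
  twisted by \<open>T\<close>: it is the direct product plus \<open>\<sigma>(T)\<close>. The theorem holds because the double Lie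
  bialgebra structure on the power is the direct product structure twisted by the same \<open>T\<close>, and
  because \<open>T\<close> satisfies the twist equation.

  On the side of Lie algebras, both the double and its power are Manin triples. In a Manin triple
  \<open>(L, A, B)\<close> the form identifies a functional with a vector, and the bracket dual to the coboundary
  of the \<open>r\<close>-matrix becomes the bracket of the components in \<open>B\<close> minus the bracket of the components
  in \<open>A\<close> (\<open>cobracket_form\<close>). So the dual is a direct sum of two Lie algebras, and \<open>L\<close> is a Lie
  bialgebra (\<open>lie_bialgebra_coboundary\<close>). For the power, the decomposition into the two Lagrangian
  subalgebras is explicit: each component of an element with one nonzero entry is constant before
  and after the position of that entry. It follows that the \<open>r\<close>-matrix of the power
  is the sum of the \<open>r\<close>-matrices of the factors minus \<open>T\<close>, up to invariant symmetric tensors, which do not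
  contribute to the cobracket (\<open>cobracket_power\<close>).

  On the side of geometry, fix a point. Contraction of \<open>\<sigma>(T)\<close> with the differential of a coordinate
  \<open>i\<close> is the value of \<open>\<sigma>(A i)\<close> for an element \<open>A i\<close> of the power, and by the product rule the first
  derivatives of \<open>\<sigma>(T)\<close> are those of the vector fields \<open>\<sigma>(A i)\<close> with \<open>A i\<close> kept fixed. Therefore
  the Schouten brackets of the mixed product with itself and with \<open>\<sigma>(a)\<close> are those of the direct
  product, corrected by Lie derivatives of the direct product along \<open>\<sigma>(A i)\<close> and by the brackets
  \<open>[\<sigma>(A i), \<sigma>(A j)]\<close> and \<open>[\<sigma>(a), \<sigma>(A i)]\<close> (\<open>schouten_self_twist\<close>, \<open>schouten_vf_twist\<close>). All of
  these are known from the action. Each coordinate of the product belongs to one factor, so the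
  resulting identities in the power need to hold only for functionals of a single factor. For the
  Jacobi identity this is the twist equation (\<open>twist_equation\<close>), which is the compatibility of the
  brackets and cobrackets of the two halves of the double when two of three factors agree, and the
  invariance of the form when all three differ. For the action it is the formula for the cobracket
  of the power.

  The product charts make all this legitimate: functions on a factor pull back to smooth functions
  whose derivatives in the coordinates of the other factors vanish (\<open>smooth_on_factor\<close>,
  \<open>manifold_PM\<close>). For the same reason the identity and the projections to pairs of factors have
  Jacobian matrices made of blocks of the factors, which yields both the transformation law of the
  mixed product and its projections (\<open>jacobian_sum_mixed_product\<close>).
\<close>

section \<open>Calculus on coordinate space\<close>

lemma has_field_derivative_pderiv_at:
  "(\<lambda>t. f (x(i := t))) field_differentiable at (x i) \<Longrightarrow>
   ((\<lambda>t. f (x(i := t))) has_field_derivative pderiv_at i f x) (at (x i))"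
  unfolding pderiv_at_def by (simp add: DERIV_deriv_iff_field_differentiable)

lemma pderiv_atI:
  "((\<lambda>t. f (x(i := t))) has_field_derivative d) (at (x i)) \<Longrightarrow> pderiv_at i f x = d"
  unfolding pderiv_at_def by (rule DERIV_imp_deriv)

lemma eventually_update_in_open:
  fixes x :: "'i \<Rightarrow> 'k::topological_space"
  assumes W: "openin (coord_space I) W" and "x \<in> W" "i \<in> I"
  shows "\<forall>\<^sub>F t in nhds (x i). x(i := t) \<in> W"
proof -
  obtain U where U: "\<forall>j\<in>I. openin euclidean (U j)" "x \<in> Pi\<^sub>E I U" "Pi\<^sub>E I U \<subseteq> W"
    using W \<open>x \<in> W\<close> unfolding openin_product_topology_alt by blast
  then have "open (U i)" "x i \<in> U i" using \<open>i \<in> I\<close> by (auto simp: PiE_iff)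
  then have "\<forall>\<^sub>F t in nhds (x i). t \<in> U i" by (rule eventually_nhds_in_open)
  then show ?thesis
  proof eventually_elim
    case (elim t)
    then have "x(i := t) \<in> Pi\<^sub>E I U" using U(2) \<open>i \<in> I\<close> by (auto simp: PiE_iff extensional_def)
    then show ?case using U(3) by blast
  qed
qed

lemma has_coord_derivative_cong:
  fixes f g :: "('i \<Rightarrow> 'k::real_normed_field) \<Rightarrow> 'k"
  assumes "openin (coord_space I) W" "x \<in> W" "i \<in> I" "\<And>y. y \<in> W \<Longrightarrow> f y = g y"
  shows "DERIV (\<lambda>t. f (x(i := t))) (x i) :> d \<longleftrightarrow> DERIV (\<lambda>t. g (x(i := t))) (x i) :> d"
proof -
  have "\<forall>\<^sub>F t in nhds (x i). f (x(i := t)) = g (x(i := t))"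
    using eventually_update_in_open[OF assms(1-3)] by eventually_elim (rule assms(4))
  then show ?thesis by (intro DERIV_cong_ev) auto
qed

lemma pderiv_at_cong:
  fixes f g :: "('i \<Rightarrow> 'k::real_normed_field) \<Rightarrow> 'k"
  assumes "openin (coord_space I) W" "x \<in> W" "i \<in> I" "\<And>y. y \<in> W \<Longrightarrow> f y = g y"
  shows "pderiv_at i f x = pderiv_at i g x"
  unfolding pderiv_at_def deriv_def using has_coord_derivative_cong[where f = f and g = g, OF assms] by simp

lemma field_differentiable_coord_cong:
  fixes f g :: "('i \<Rightarrow> 'k::real_normed_field) \<Rightarrow> 'k"
  assumes "openin (coord_space I) W" "x \<in> W" "i \<in> I" "\<And>y. y \<in> W \<Longrightarrow> f y = g y"
    and "(\<lambda>t. f (x(i := t))) field_differentiable at (x i)"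
  shows "(\<lambda>t. g (x(i := t))) field_differentiable at (x i)"
  using has_coord_derivative_cong[where f = f and g = g, OF assms(1-4)] assms(5)
  unfolding field_differentiable_def by blast

text \<open>
  Partial derivatives on an open set depend on the values there only. So smoothness follows once a
  function belongs to a class of continuous, partially differentiable functions that is stable
  under partial derivatives up to equality on \<open>W\<close>.
\<close>

lemma smooth_on_coinduct:
  fixes f :: "('i \<Rightarrow> 'k::real_normed_field) \<Rightarrow> 'k"
  assumes W: "openin (coord_space I) W" and "Q f"
    and step: "\<And>g. Q g \<Longrightarrow> continuous_map (subtopology (coord_space I) W) euclidean g \<and>
      (\<forall>i\<in>I. (\<forall>x\<in>W. (\<lambda>t. g (x(i := t))) field_differentiable at (x i)) \<and>
        (\<exists>h. Q h \<and> (\<forall>x\<in>W. pderiv_at i g x = h x)))"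
  shows "smooth_on I W f"
proof -
  have ex: "\<exists>g. Q g \<and> (\<forall>x\<in>W. iter_pderiv is f x = g x)" if "set is \<subseteq> I" for "is"
    using that
  proof (induction "is")
    case Nil
    then show ?case using \<open>Q f\<close> by auto
  next
    case (Cons i "is")
    then obtain g where g: "Q g" "\<forall>x\<in>W. iter_pderiv is f x = g x" by auto
    have i: "i \<in> I" using Cons.prems by simp
    obtain h where h: "Q h" "\<forall>x\<in>W. pderiv_at i g x = h x" using step[OF g(1)] i by blast
    have "\<forall>x\<in>W. iter_pderiv (i # is) f x = h x"
      using pderiv_at_cong[OF W _ i, of _ "iter_pderiv is f" g] g(2) h(2) by simp
    with h(1) show ?case by blast
  qed
  show ?thesis unfolding smooth_on_def
  proof (intro allI impI conjI ballI)
    fix "is" assume "set is \<subseteq> I"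
    then obtain g where g: "Q g" "\<forall>x\<in>W. iter_pderiv is f x = g x" using ex by blast
    have "continuous_map (subtopology (coord_space I) W) euclidean g" using step[OF g(1)] by blast
    then show "continuous_map (subtopology (coord_space I) W) euclidean (iter_pderiv is f)"
      by (rule continuous_map_eq) (use g(2) in auto)
    fix i x assume "i \<in> I" "x \<in> W"
    then show "(\<lambda>t. iter_pderiv is f (x(i := t))) field_differentiable at (x i)"
      using field_differentiable_coord_cong[OF W, of x i g "iter_pderiv is f"] step[OF g(1)] g(2)
      by auto
  qed
qed

lemma smooth_on_imp_continuous_map:
  "smooth_on I W f \<Longrightarrow> continuous_map (subtopology (coord_space I) W) euclidean f"
  unfolding smooth_on_def by (drule spec[of _ "[]"]) simp

lemma smooth_on_imp_field_differentiable:
  "smooth_on I W f \<Longrightarrow> i \<in> I \<Longrightarrow> x \<in> W \<Longrightarrow> (\<lambda>t. f (x(i := t))) field_differentiable at (x i)"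
  unfolding smooth_on_def by (drule spec[of _ "[]"]) simp

lemma smooth_on_has_pderiv:
  "smooth_on I W f \<Longrightarrow> i \<in> I \<Longrightarrow> x \<in> W \<Longrightarrow>
   ((\<lambda>t. f (x(i := t))) has_field_derivative pderiv_at i f x) (at (x i))"
  by (rule has_field_derivative_pderiv_at) (rule smooth_on_imp_field_differentiable)

lemma iter_pderiv_snoc: "iter_pderiv (is @ [i]) f = iter_pderiv is (pderiv_at i f)"
  by (induction "is") simp_all

lemma smooth_on_pderiv_at:
  assumes "smooth_on I W f" "i \<in> I"
  shows "smooth_on I W (pderiv_at i f)"
  unfolding smooth_on_def
proof (intro allI impI)
  fix "is" assume "set is \<subseteq> I"
  then have "set (is @ [i]) \<subseteq> I" using \<open>i \<in> I\<close> by simp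
  then show "continuous_map (subtopology (coord_space I) W) euclidean (iter_pderiv is (pderiv_at i f)) \<and>
    (\<forall>ia\<in>I. \<forall>x\<in>W. (\<lambda>t. iter_pderiv is (pderiv_at i f) (x(ia := t))) field_differentiable at (x ia))"
    using assms(1) unfolding smooth_on_def iter_pderiv_snoc[symmetric] by blast
qed

lemma smooth_on_cong:
  fixes f g :: "('i \<Rightarrow> 'k::real_normed_field) \<Rightarrow> 'k"
  assumes W: "openin (coord_space I) W" and "smooth_on I W f" "\<And>x. x \<in> W \<Longrightarrow> f x = g x"
  shows "smooth_on I W g"
proof (rule smooth_on_coinduct[OF W, where Q = "\<lambda>g. \<exists>f. smooth_on I W f \<and> (\<forall>x\<in>W. f x = g x)"])
  show "\<exists>f. smooth_on I W f \<and> (\<forall>x\<in>W. f x = g x)" using assms by blast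
  fix g :: "('i \<Rightarrow> 'k) \<Rightarrow> 'k" assume "\<exists>f. smooth_on I W f \<and> (\<forall>x\<in>W. f x = g x)"
  then obtain f where f: "smooth_on I W f" "\<And>x. x \<in> W \<Longrightarrow> f x = g x" by blast
  have c: "continuous_map (subtopology (coord_space I) W) euclidean g"
    by (rule continuous_map_eq[OF smooth_on_imp_continuous_map[OF f(1)]]) (use f(2) in auto)
  have d: "(\<lambda>t. g (x(i := t))) field_differentiable at (x i)" if "i \<in> I" "x \<in> W" for i x
    using field_differentiable_coord_cong[OF W that(2,1), of f g] f
      smooth_on_imp_field_differentiable[OF f(1) that] by auto
  have e: "pderiv_at i f x = pderiv_at i g x" if "i \<in> I" "x \<in> W" for i x
    using pderiv_at_cong[OF W that(2,1), of f g] f(2) by auto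
  show "continuous_map (subtopology (coord_space I) W) euclidean g \<and>
      (\<forall>i\<in>I. (\<forall>x\<in>W. (\<lambda>t. g (x(i := t))) field_differentiable at (x i)) \<and>
        (\<exists>h. (\<exists>f. smooth_on I W f \<and> (\<forall>x\<in>W. f x = h x)) \<and> (\<forall>x\<in>W. pderiv_at i g x = h x)))"
    using c d e smooth_on_pderiv_at[OF f(1)] by metis
qed

text \<open>
  By the product rule, the algebra generated by the smooth functions satisfies the hypothesis of
  \<open>smooth_on_coinduct\<close>; hence the smooth functions form an algebra.
\<close>

inductive smooth_algebra :: "'i set \<Rightarrow> ('i \<Rightarrow> 'k) set \<Rightarrow> (('i \<Rightarrow> 'k) \<Rightarrow> 'k::real_normed_field) \<Rightarrow> bool"
  for I W where
  generator: "smooth_on I W f \<Longrightarrow> smooth_algebra I W f"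
| const: "smooth_algebra I W (\<lambda>_. a)"
| add: "smooth_algebra I W f \<Longrightarrow> smooth_algebra I W g \<Longrightarrow> smooth_algebra I W (\<lambda>x. f x + g x)"
| mult: "smooth_algebra I W f \<Longrightarrow> smooth_algebra I W g \<Longrightarrow> smooth_algebra I W (\<lambda>x. f x * g x)"

lemma continuous_map_add_field:
  fixes f g :: "'a \<Rightarrow> 'k::real_normed_field"
  shows "continuous_map X euclidean f \<Longrightarrow> continuous_map X euclidean g \<Longrightarrow>
    continuous_map X euclidean (\<lambda>x. f x + g x)"
  by (simp add: continuous_map_atin tendsto_add)

lemma continuous_map_mult_field:
  fixes f g :: "'a \<Rightarrow> 'k::real_normed_field"
  shows "continuous_map X euclidean f \<Longrightarrow> continuous_map X euclidean g \<Longrightarrow>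
    continuous_map X euclidean (\<lambda>x. f x * g x)"
  by (simp add: continuous_map_atin tendsto_mult)

lemma smooth_algebra_imp_smooth_on:
  fixes f :: "('i \<Rightarrow> 'k::real_normed_field) \<Rightarrow> 'k"
  assumes W: "openin (coord_space I) W" and "smooth_algebra I W f"
  shows "smooth_on I W f"
proof (rule smooth_on_coinduct[OF W, where Q = "smooth_algebra I W", OF assms(2)])
  fix g :: "('i \<Rightarrow> 'k) \<Rightarrow> 'k" assume "smooth_algebra I W g"
  then show "continuous_map (subtopology (coord_space I) W) euclidean g \<and>
      (\<forall>i\<in>I. (\<forall>x\<in>W. (\<lambda>t. g (x(i := t))) field_differentiable at (x i)) \<and>
        (\<exists>h. smooth_algebra I W h \<and> (\<forall>x\<in>W. pderiv_at i g x = h x)))"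
  proof (induction rule: smooth_algebra.induct)
    case (generator f)
    have "\<exists>h. smooth_algebra I W h \<and> (\<forall>x\<in>W. pderiv_at i f x = h x)" if "i \<in> I" for i
      using smooth_algebra.generator[OF smooth_on_pderiv_at[OF generator that]] by blast
    then show ?case
      using smooth_on_imp_continuous_map[OF generator] smooth_on_imp_field_differentiable[OF generator]
      by blast
  next
    case (const a)
    have "pderiv_at i (\<lambda>_. a) x = 0" for i and x :: "'i \<Rightarrow> 'k" by (rule pderiv_atI) simp
    then show ?case using smooth_algebra.const[of I W 0] by (auto intro: field_differentiable_const)
  next
    case (add f g)
    have "\<exists>h. smooth_algebra I W h \<and> (\<forall>x\<in>W. pderiv_at i (\<lambda>x. f x + g x) x = h x)" if i: "i \<in> I" for i
    proof -
      obtain f' g' where f': "smooth_algebra I W f'" "\<forall>x\<in>W. pderiv_at i f x = f' x"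
        and g': "smooth_algebra I W g'" "\<forall>x\<in>W. pderiv_at i g x = g' x"
        using add.IH i by meson
      have "\<forall>x\<in>W. pderiv_at i (\<lambda>x. f x + g x) x = f' x + g' x"
      proof
        fix x assume "x \<in> W"
        have "((\<lambda>t. f (x(i := t)) + g (x(i := t))) has_field_derivative
            pderiv_at i f x + pderiv_at i g x) (at (x i))"
          by (rule DERIV_add; rule has_field_derivative_pderiv_at) (use add.IH i \<open>x \<in> W\<close> in blast)+
        from pderiv_atI[OF this] show "pderiv_at i (\<lambda>x. f x + g x) x = f' x + g' x"
          using f'(2) g'(2) \<open>x \<in> W\<close> by simp
      qed
      then show ?thesis using smooth_algebra.add[OF f'(1) g'(1)] by blast
    qed
    moreover have "(\<lambda>t. f (x(i := t)) + g (x(i := t))) field_differentiable at (x i)"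
      if "i \<in> I" "x \<in> W" for i x
      using add.IH that by (intro field_differentiable_add) blast+
    ultimately show ?case using continuous_map_add_field add.IH by blast
  next
    case (mult f g)
    have "\<exists>h. smooth_algebra I W h \<and> (\<forall>x\<in>W. pderiv_at i (\<lambda>x. f x * g x) x = h x)" if i: "i \<in> I" for i
    proof -
      obtain f' g' where f': "smooth_algebra I W f'" "\<forall>x\<in>W. pderiv_at i f x = f' x"
        and g': "smooth_algebra I W g'" "\<forall>x\<in>W. pderiv_at i g x = g' x"
        using mult.IH i by meson
      have "\<forall>x\<in>W. pderiv_at i (\<lambda>x. f x * g x) x = f' x * g x + f x * g' x"
      proof
        fix x assume "x \<in> W"
        have "((\<lambda>t. f (x(i := t)) * g (x(i := t))) has_field_derivative
            pderiv_at i f x * g (x(i := x i)) + pderiv_at i g x * f (x(i := x i))) (at (x i))"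
          by (rule DERIV_mult; rule has_field_derivative_pderiv_at) (use mult.IH i \<open>x \<in> W\<close> in blast)+
        from pderiv_atI[OF this] show "pderiv_at i (\<lambda>x. f x * g x) x = f' x * g x + f x * g' x"
          using f'(2) g'(2) \<open>x \<in> W\<close> by (simp add: mult.commute)
      qed
      then show ?thesis
        using smooth_algebra.add[OF smooth_algebra.mult[OF f'(1) mult.hyps(2)]
            smooth_algebra.mult[OF mult.hyps(1) g'(1)]] by blast
    qed
    moreover have "(\<lambda>t. f (x(i := t)) * g (x(i := t))) field_differentiable at (x i)"
      if "i \<in> I" "x \<in> W" for i x
      using mult.IH that by (intro field_differentiable_mult) blast+
    ultimately show ?case using continuous_map_mult_field mult.IH by blast
  qed
qed

lemma smooth_on_const: "openin (coord_space I) W \<Longrightarrow> smooth_on I W (\<lambda>_. a)"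
  by (intro smooth_algebra_imp_smooth_on smooth_algebra.const)

lemma smooth_on_mult:
  "openin (coord_space I) W \<Longrightarrow> smooth_on I W f \<Longrightarrow> smooth_on I W g \<Longrightarrow> smooth_on I W (\<lambda>x. f x * g x)"
  by (rule smooth_algebra_imp_smooth_on) (auto intro: smooth_algebra.intros)

lemma smooth_on_add:
  "openin (coord_space I) W \<Longrightarrow> smooth_on I W f \<Longrightarrow> smooth_on I W g \<Longrightarrow> smooth_on I W (\<lambda>x. f x + g x)"
  by (rule smooth_algebra_imp_smooth_on) (auto intro: smooth_algebra.intros)

lemma smooth_on_uminus:
  fixes f :: "('i \<Rightarrow> 'k::real_normed_field) \<Rightarrow> 'k"
  assumes "openin (coord_space I) W" "smooth_on I W f"
  shows "smooth_on I W (\<lambda>x. - f x)"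
  using smooth_on_mult[OF assms(1) smooth_on_const[OF assms(1), of "-1"] assms(2)] by simp

lemma smooth_on_sum:
  fixes f :: "'s \<Rightarrow> ('i \<Rightarrow> 'k::real_normed_field) \<Rightarrow> 'k"
  assumes "openin (coord_space I) W" "\<And>s. s \<in> S \<Longrightarrow> smooth_on I W (f s)"
  shows "smooth_on I W (\<lambda>x. \<Sum>s\<in>S. f s x)"
  using assms(2)
  by (induction S rule: infinite_finite_induct)
    (auto intro: smooth_on_const[OF assms(1)] smooth_on_add[OF assms(1)])


section \<open>Pulling functions back from a factor of a product\<close>

definition factor_coord :: "(nat \<Rightarrow> 'i set) \<Rightarrow> nat \<Rightarrow> (nat \<times> 'i \<Rightarrow> 'k) \<Rightarrow> 'i \<Rightarrow> 'k" where
  "factor_coord I e x = (\<lambda>l\<in>I e. x (e, l))"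

lemma factor_coord_apply [simp]: "l \<in> I e \<Longrightarrow> factor_coord I e x l = x (e, l)"
  by (simp add: factor_coord_def)

lemma factor_coord_update:
  "i \<in> I e \<Longrightarrow> factor_coord I e (x((e, i) := t)) = (factor_coord I e x)(i := t)"
  by (auto simp: fun_eq_iff factor_coord_def)

lemma factor_coord_update_other:
  "j \<noteq> e \<Longrightarrow> factor_coord I e (x((j, i) := t)) = factor_coord I e x"
  by (auto simp: fun_eq_iff factor_coord_def)

lemma pderiv_at_factor:
  fixes h :: "('i \<Rightarrow> 'k::real_normed_field) \<Rightarrow> 'k"
  assumes "i \<in> I j"
  shows "pderiv_at (j, i) (\<lambda>x. h (factor_coord I e x)) x =
    (if j = e then pderiv_at i h (factor_coord I e x) else 0)"
proof (cases "j = e")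
  case True
  then show ?thesis using assms by (simp add: pderiv_at_def factor_coord_update)
next
  case False
  then show ?thesis by (simp add: pderiv_at_def factor_coord_update_other)
qed

text \<open>
  Each coordinate of the product belongs to one factor, so a derivative in a coordinate of another
  factor kills a function pulled back from the factor \<open>e\<close>, and so do all iterated derivatives that
  involve one.
\<close>

lemma iter_pderiv_factor:
  fixes h :: "('i \<Rightarrow> 'k::real_normed_field) \<Rightarrow> 'k"
  assumes "set is \<subseteq> Sigma J I"
  shows "iter_pderiv is (\<lambda>x. h (factor_coord I e x)) =
    (\<lambda>x. if \<forall>p\<in>set is. fst p = e then iter_pderiv (map snd is) h (factor_coord I e x) else 0)"
  using assms
proof (induction "is")
  case (Cons p "is")
  obtain j i where p: "p = (j, i)" "i \<in> I j" using Cons.prems by auto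
  have z: "pderiv_at p (\<lambda>x. 0) x = (0::'k)" for x by (rule pderiv_atI) simp
  have IH: "iter_pderiv is (\<lambda>x. h (factor_coord I e x)) =
    (\<lambda>x. if \<forall>p\<in>set is. fst p = e then iter_pderiv (map snd is) h (factor_coord I e x) else 0)"
    using Cons by simp
  show ?case
  proof (cases "\<forall>p\<in>set is. fst p = e")
    case True
    then have eq: "iter_pderiv is (\<lambda>x. h (factor_coord I e x)) =
        (\<lambda>x. iter_pderiv (map snd is) h (factor_coord I e x))" using IH by simp
    show ?thesis
    proof
      fix x show "iter_pderiv (p # is) (\<lambda>x. h (factor_coord I e x)) x =
          (if \<forall>p\<in>set (p # is). fst p = e then iter_pderiv (map snd (p # is)) h (factor_coord I e x) else 0)"
        using p(1) True eq pderiv_at_factor[of i I j "iter_pderiv (map snd is) h" e x, OF p(2)] by simp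
    qed
  next
    case False
    then have eq: "iter_pderiv is (\<lambda>x. h (factor_coord I e x)) = (\<lambda>x. 0)" using IH by metis
    have "\<not> (\<forall>p\<in>set (p # is). fst p = e)" using False by simp
    then show ?thesis by (simp only: iter_pderiv.simps eq z if_False)
  qed
qed auto

lemma continuous_map_factor_coord:
  assumes "e \<in> J"
  shows "continuous_map (coord_space (Sigma J I)) (coord_space (I e)) (factor_coord I e)"
  unfolding continuous_map_componentwise
proof (intro conjI ballI)
  fix l assume "l \<in> I e"
  then have "continuous_map (coord_space (Sigma J I)) euclidean (\<lambda>x. x (e, l))"
    using assms by (intro continuous_map_product_coordinates) auto
  then show "continuous_map (coord_space (Sigma J I)) euclidean (\<lambda>x. factor_coord I e x l)"
    using \<open>l \<in> I e\<close> by simp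
qed (auto simp: factor_coord_def)

lemma smooth_on_factor:
  fixes h :: "('i \<Rightarrow> 'k::real_normed_field) \<Rightarrow> 'k"
  assumes "smooth_on (I e) V h" "e \<in> J" and W: "\<And>x. x \<in> W \<Longrightarrow> factor_coord I e x \<in> V"
  shows "smooth_on (Sigma J I) W (\<lambda>x. h (factor_coord I e x))"
  unfolding smooth_on_def
proof (intro allI impI conjI ballI)
  fix "is" assume "is": "set is \<subseteq> Sigma J I"
  have sub: "set (map snd is) \<subseteq> I e" if "\<forall>p\<in>set is. fst p = e" using "is" that by force
  have c: "continuous_map (subtopology (coord_space (Sigma J I)) W) (subtopology (coord_space (I e)) V)
      (factor_coord I e)"
    unfolding continuous_map_in_subtopology
    using continuous_map_from_subtopology[OF continuous_map_factor_coord[OF \<open>e \<in> J\<close>]] W by fastforce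
  have "continuous_map (subtopology (coord_space (I e)) V) euclidean (iter_pderiv (map snd is) h)"
    if "\<forall>p\<in>set is. fst p = e"
    using assms(1) sub[OF that] unfolding smooth_on_def by blast
  from continuous_map_compose[OF c this]
  have "continuous_map (subtopology (coord_space (Sigma J I)) W) euclidean
      (\<lambda>x. if C then iter_pderiv (map snd is) h (factor_coord I e x) else 0)"
    if "C \<longleftrightarrow> (\<forall>p\<in>set is. fst p = e)" for C
    using that by (cases C) (simp_all add: o_def)
  then show "continuous_map (subtopology (coord_space (Sigma J I)) W) euclidean
      (iter_pderiv is (\<lambda>x. h (factor_coord I e x)))"
    unfolding iter_pderiv_factor[OF "is"] by blast
  fix p x assume p: "p \<in> Sigma J I" and x: "x \<in> W"
  obtain j i where ji: "p = (j, i)" "j \<in> J" "i \<in> I j" using p by auto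
  show "(\<lambda>t. iter_pderiv is (\<lambda>x. h (factor_coord I e x)) (x(p := t))) field_differentiable at (x p)"
  proof (cases "(\<forall>p\<in>set is. fst p = e) \<and> j = e")
    case True
    then have i: "i \<in> I e" and sis: "set (map snd is) \<subseteq> I e" using ji sub by auto
    then have "(\<lambda>t. iter_pderiv (map snd is) h ((factor_coord I e x)(i := t)))
        field_differentiable at (factor_coord I e x i)"
      using assms(1) W[OF x] unfolding smooth_on_def by blast
    moreover have "factor_coord I e x i = x p" using i ji True by simp
    moreover have "iter_pderiv is (\<lambda>x. h (factor_coord I e x)) (x(p := t)) =
        iter_pderiv (map snd is) h ((factor_coord I e x)(i := t))" for t
      unfolding iter_pderiv_factor[OF "is"] using True ji i by (simp only: factor_coord_update) simp
    ultimately show ?thesis by simp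
  next
    case False
    then have "iter_pderiv is (\<lambda>x. h (factor_coord I e x)) (x(p := t)) =
        iter_pderiv is (\<lambda>x. h (factor_coord I e x)) x" for t
      unfolding iter_pderiv_factor[OF "is"] ji(1)
      by (cases "\<forall>p\<in>set is. fst p = e") (auto simp: factor_coord_update_other)
    then show ?thesis by (simp add: field_differentiable_const)
  qed
qed

section \<open>Products of manifolds\<close>

text \<open>The products of members of countable bases of the factors form a countable base.\<close>

lemma second_countable_product_topology:
  assumes "finite J" "\<And>j. j \<in> J \<Longrightarrow> second_countable (X j)"
  shows "second_countable (product_topology X J)"
proof -
  have "\<forall>j\<in>J. \<exists>\<B>. countable \<B> \<and> (\<forall>V \<in> \<B>. openin (X j) V) \<and>
      (\<forall>U x. openin (X j) U \<and> x \<in> U \<longrightarrow> (\<exists>V \<in> \<B>. x \<in> V \<and> V \<subseteq> U))"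
    using assms(2) unfolding second_countable_def by blast
  then obtain \<B> where \<B>: "\<And>j. j \<in> J \<Longrightarrow> countable (\<B> j)"
      "\<And>j V. j \<in> J \<Longrightarrow> V \<in> \<B> j \<Longrightarrow> openin (X j) V"
      "\<And>j U x. j \<in> J \<Longrightarrow> openin (X j) U \<Longrightarrow> x \<in> U \<Longrightarrow> \<exists>V\<in>\<B> j. x \<in> V \<and> V \<subseteq> U"
    by metis
  show ?thesis unfolding second_countable_def
  proof (intro exI[of _ "Pi\<^sub>E J ` (Pi\<^sub>E J \<B>)"] conjI ballI allI impI)
    show "countable (Pi\<^sub>E J ` (Pi\<^sub>E J \<B>))" using \<B>(1) assms(1) by (intro countable_image countable_PiE)
    fix V assume "V \<in> Pi\<^sub>E J ` (Pi\<^sub>E J \<B>)"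
    then show "openin (product_topology X J) V" using assms(1) \<B>(2) by (auto simp: openin_PiE_gen PiE_iff)
  next
    fix U x assume *: "openin (product_topology X J) U \<and> x \<in> U"
    then obtain U' where U': "\<forall>j\<in>J. openin (X j) (U' j)" "x \<in> Pi\<^sub>E J U'" "Pi\<^sub>E J U' \<subseteq> U"
      unfolding openin_product_topology_alt by blast
    then have "\<forall>j\<in>J. \<exists>V\<in>\<B> j. x j \<in> V \<and> V \<subseteq> U' j" using \<B>(3) by (auto simp: PiE_iff)
    then obtain V where V: "\<And>j. j \<in> J \<Longrightarrow> V j \<in> \<B> j \<and> x j \<in> V j \<and> V j \<subseteq> U' j" by metis
    have "Pi\<^sub>E J (restrict V J) \<in> Pi\<^sub>E J ` (Pi\<^sub>E J \<B>)" using V by (intro imageI) auto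
    moreover have "x \<in> Pi\<^sub>E J (restrict V J)" using V U'(2) by (auto simp: PiE_iff)
    moreover have "Pi\<^sub>E J (restrict V J) \<subseteq> Pi\<^sub>E J U'" using V by (intro PiE_mono) simp
    then have "Pi\<^sub>E J (restrict V J) \<subseteq> U" using U'(3) by (rule subset_trans)
    ultimately show "\<exists>V\<in>Pi\<^sub>E J ` (Pi\<^sub>E J \<B>). x \<in> V \<and> V \<subseteq> U" by blast
  qed
qed

lemma manifoldD:
  assumes "manifold M"
  shows manifold_Hausdorff: "Hausdorff_space (mtop M)"
    and manifold_second_countable: "second_countable (mtop M)"
    and manifold_finite_mind: "finite (mind M)"
    and manifold_covered: "(\<Union>c\<in>mcharts M. mdom M c) = topspace (mtop M)"
    and manifold_open_mdom: "c \<in> mcharts M \<Longrightarrow> openin (mtop M) (mdom M c)"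
    and manifold_open_mimg: "c \<in> mcharts M \<Longrightarrow> openin (coord_space (mind M)) (mimg M c)"
    and manifold_homeomorphic_map: "c \<in> mcharts M \<Longrightarrow>
      homeomorphic_map (subtopology (mtop M) (mdom M c)) (subtopology (coord_space (mind M)) (mimg M c)) (mcoord M c)"
    and manifold_transition: "c \<in> mcharts M \<Longrightarrow> c' \<in> mcharts M \<Longrightarrow> i \<in> mind M \<Longrightarrow>
      smooth_on (mind M) (mcoord M c ` (mdom M c \<inter> mdom M c')) (local_rep M M id c c' i)"
  using assms unfolding manifold_def by simp_all

lemma manifold_mdom_subset: "manifold M \<Longrightarrow> c \<in> mcharts M \<Longrightarrow> mdom M c \<subseteq> topspace (mtop M)"
  by (rule openin_subset) (rule manifold_open_mdom)

lemma manifold_mimg_extensional: "manifold M \<Longrightarrow> c \<in> mcharts M \<Longrightarrow> mimg M c \<subseteq> extensional (mind M)"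
  using openin_subset[OF manifold_open_mimg] by (fastforce simp: PiE_iff)

lemma manifold_inj_on_mcoord:
  assumes "manifold M" "c \<in> mcharts M"
  shows "inj_on (mcoord M c) (mdom M c)"
  using homeomorphic_imp_injective_map[OF manifold_homeomorphic_map[OF assms]]
    manifold_mdom_subset[OF assms] by (simp add: Int_absorb1)

lemma manifold_mparam_mcoord:
  "manifold M \<Longrightarrow> c \<in> mcharts M \<Longrightarrow> p \<in> mdom M c \<Longrightarrow> mparam M c (mcoord M c p) = p"
  by (simp add: manifold_inj_on_mcoord)

lemma continuous_map_mparam:
  assumes "manifold M" "c \<in> mcharts M"
  shows "continuous_map (subtopology (coord_space (mind M)) (mimg M c))
    (subtopology (mtop M) (mdom M c)) (mparam M c)"
proof -
  obtain g where g: "homeomorphic_maps (subtopology (mtop M) (mdom M c))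
      (subtopology (coord_space (mind M)) (mimg M c)) (mcoord M c) g"
    using manifold_homeomorphic_map[OF assms] unfolding homeomorphic_map_maps by blast
  then have "g (mcoord M c p) = p" if "p \<in> mdom M c" for p
    using that manifold_mdom_subset[OF assms] unfolding homeomorphic_maps_def by auto
  then have "g x = mparam M c x" if "x \<in> mimg M c" for x
    using that manifold_mparam_mcoord[OF assms] by auto
  then show ?thesis using g unfolding homeomorphic_maps_def
    by (auto intro: continuous_map_eq[where f = g])
qed

lemma continuous_map_mcoord:
  assumes "manifold M" "c \<in> mcharts M"
  shows "continuous_map (subtopology (mtop M) (mdom M c)) (coord_space (mind M)) (mcoord M c)"
  using homeomorphic_imp_continuous_map[OF manifold_homeomorphic_map[OF assms]]
  by (simp add: continuous_map_in_subtopology)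

text \<open>
  Stated for a chart of a topological space, so as to apply to the charts of a product before that
  is known to be a manifold.
\<close>

lemma openin_chart_image:
  assumes "openin X A" "openin Z (f ` A)"
    and "homeomorphic_map (subtopology X A) (subtopology Z (f ` A)) f"
    and "openin X U" "U \<subseteq> A"
  shows "openin Z (f ` U)"
proof -
  have "openin (subtopology X A) U" using assms by (simp add: openin_open_subtopology)
  then have "openin (subtopology Z (f ` A)) (f ` U)"
    using homeomorphic_map_openness_eq[OF assms(3)] by blast
  then show ?thesis using assms(2) by (simp add: openin_open_subtopology)
qed

locale manifold_family =
  fixes n :: nat and Y :: "nat \<Rightarrow> ('k::real_normed_field, 'p, 'i, 'c) manifold"
  assumes factor_manifold: "\<And>j. j \<in> {1..n} \<Longrightarrow> manifold (Y j)"
begin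

abbreviation PM :: "('k, nat \<Rightarrow> 'p, nat \<times> 'i, nat \<Rightarrow> 'c) manifold" where
  "PM \<equiv> prod_manifold n Y"

abbreviation fac :: "nat \<Rightarrow> (nat \<times> 'i \<Rightarrow> 'k) \<Rightarrow> 'i \<Rightarrow> 'k" where
  "fac \<equiv> factor_coord (\<lambda>j. mind (Y j))"

lemma PM_simps:
  "mtop PM = product_topology (\<lambda>j. mtop (Y j)) {1..n}"
  "mind PM = (SIGMA j:{1..n}. mind (Y j))"
  "mcharts PM = (\<Pi>\<^sub>E j\<in>{1..n}. mcharts (Y j))"
  "mdom PM c = (\<Pi>\<^sub>E j\<in>{1..n}. mdom (Y j) (c j))"
  "mcoord PM c y = (\<lambda>(j, i)\<in>(SIGMA j:{1..n}. mind (Y j)). mcoord (Y j) (c j) (y j) i)"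
  by (simp_all add: prod_manifold_def)

lemma chart_factor: "c \<in> mcharts PM \<Longrightarrow> j \<in> {1..n} \<Longrightarrow> c j \<in> mcharts (Y j)"
  by (auto simp: PM_simps)

lemma mdom_factor: "p \<in> mdom PM c \<Longrightarrow> j \<in> {1..n} \<Longrightarrow> p j \<in> mdom (Y j) (c j)"
  by (auto simp: PM_simps)

lemma finite_mind_PM: "finite (mind PM)"
  using manifold_finite_mind[OF factor_manifold] by (auto simp: PM_simps)

lemma fac_mcoord:
  assumes "c \<in> mcharts PM" "p \<in> mdom PM c" "j \<in> {1..n}"
  shows "fac j (mcoord PM c p) = mcoord (Y j) (c j) (p j)"
proof (rule extensionalityI[of _ "mind (Y j)"])
  show "mcoord (Y j) (c j) (p j) \<in> extensional (mind (Y j))"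
    using manifold_mimg_extensional[OF factor_manifold[OF assms(3)] chart_factor[OF assms(1,3)]]
      mdom_factor[OF assms(2,3)] by blast
  show "fac j (mcoord PM c p) \<in> extensional (mind (Y j))" by (simp add: factor_coord_def)
qed (use assms(3) in \<open>simp_all add: PM_simps\<close>)

text \<open>
  The image of a product chart is the product of the images, after the coordinates, labelled by
  pairs, are regrouped by factors. Openness of the image and continuity of the inverse chart are
  read off from the factors in this way.
\<close>

lemma mimg_PM_iff:
  assumes c: "c \<in> mcharts PM"
  shows "x \<in> mimg PM c \<longleftrightarrow> x \<in> extensional (mind PM) \<and> (\<forall>j\<in>{1..n}. fac j x \<in> mimg (Y j) (c j))"
proof
  assume "x \<in> mimg PM c"
  then obtain p where p: "p \<in> mdom PM c" "x = mcoord PM c p" by blast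
  then have "x \<in> extensional (mind PM)" by (simp add: PM_simps)
  then show "x \<in> extensional (mind PM) \<and> (\<forall>j\<in>{1..n}. fac j x \<in> mimg (Y j) (c j))"
    using p fac_mcoord[OF c] mdom_factor by auto
next
  assume x: "x \<in> extensional (mind PM) \<and> (\<forall>j\<in>{1..n}. fac j x \<in> mimg (Y j) (c j))"
  define p where "p = (\<lambda>j\<in>{1..n}. mparam (Y j) (c j) (fac j x))"
  have p: "p j \<in> mdom (Y j) (c j)" "mcoord (Y j) (c j) (p j) = fac j x" if "j \<in> {1..n}" for j
    using x that by (auto simp: p_def inv_into_into f_inv_into_f)
  then have pd: "p \<in> mdom PM c" by (auto simp: PM_simps p_def)
  have "mcoord PM c p = x"
  proof (rule extensionalityI[of _ "mind PM"])
    show "mcoord PM c p \<in> extensional (mind PM)" by (simp add: PM_simps)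
    show "x \<in> extensional (mind PM)" using x by blast
    show "mcoord PM c p a = x a" if "a \<in> mind PM" for a
      using that p(2) by (auto simp: PM_simps)
  qed
  then show "x \<in> mimg PM c" using pd by blast
qed

lemma fac_mimg: "c \<in> mcharts PM \<Longrightarrow> x \<in> mimg PM c \<Longrightarrow> j \<in> {1..n} \<Longrightarrow> fac j x \<in> mimg (Y j) (c j)"
  using mimg_PM_iff by blast

lemma inj_on_mcoord_PM:
  assumes c: "c \<in> mcharts PM"
  shows "inj_on (mcoord PM c) (mdom PM c)"
proof (rule inj_onI)
  fix p q assume p: "p \<in> mdom PM c" and q: "q \<in> mdom PM c" and eq: "mcoord PM c p = mcoord PM c q"
  have "p j = q j" if "j \<in> {1..n}" for j
    using fac_mcoord[OF c p that] fac_mcoord[OF c q that] eq mdom_factor[OF p that] mdom_factor[OF q that]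
      inj_onD[OF manifold_inj_on_mcoord[OF factor_manifold[OF that] chart_factor[OF c that]]] by simp
  then show "p = q" using p q by (auto simp: PM_simps intro: PiE_ext)
qed

lemma mparam_PM:
  assumes c: "c \<in> mcharts PM" and x: "x \<in> mimg PM c" and j: "j \<in> {1..n}"
  shows "mparam PM c x j = mparam (Y j) (c j) (fac j x)"
proof -
  obtain p where p: "p \<in> mdom PM c" "x = mcoord PM c p" using x by blast
  then show ?thesis
    using fac_mcoord[OF c p(1) j] manifold_mparam_mcoord[OF factor_manifold[OF j] chart_factor[OF c j]]
      mdom_factor[OF p(1) j] inj_on_mcoord_PM[OF c] by simp
qed

lemma continuous_map_fac:
  assumes "j \<in> {1..n}"
  shows "continuous_map (coord_space (mind PM)) (coord_space (mind (Y j))) (fac j)"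
  using continuous_map_factor_coord[OF assms, of "\<lambda>j. mind (Y j)"] by (simp add: PM_simps)

lemma openin_mdom_PM: "c \<in> mcharts PM \<Longrightarrow> openin (mtop PM) (mdom PM c)"
  using manifold_open_mdom[OF factor_manifold chart_factor] by (simp add: PM_simps(1,4) openin_PiE_gen)

lemma openin_mimg_PM:
  assumes c: "c \<in> mcharts PM"
  shows "openin (coord_space (mind PM)) (mimg PM c)"
proof -
  have "openin (coord_space (mind PM)) {x \<in> topspace (coord_space (mind PM)). fac j x \<in> mimg (Y j) (c j)}"
    if "j \<in> {1..n}" for j
    using openin_continuous_map_preimage[OF continuous_map_fac[OF that]
        manifold_open_mimg[OF factor_manifold[OF that] chart_factor[OF c that]]] .
  then have "openin (coord_space (mind PM))
      ((\<Inter>j\<in>{1..n}. {x \<in> topspace (coord_space (mind PM)). fac j x \<in> mimg (Y j) (c j)})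
        \<inter> topspace (coord_space (mind PM)))"
    by (intro openin_INT) auto
  moreover have "\<dots> = mimg PM c"
  proof (rule set_eqI)
    fix x show "x \<in> (\<Inter>j\<in>{1..n}. {x \<in> topspace (coord_space (mind PM)). fac j x \<in> mimg (Y j) (c j)})
        \<inter> topspace (coord_space (mind PM)) \<longleftrightarrow> x \<in> mimg PM c"
      unfolding mimg_PM_iff[OF c] by (auto simp: PiE_def)
  qed
  ultimately show ?thesis by metis
qed

lemma homeomorphic_map_PM:
  assumes c: "c \<in> mcharts PM"
  shows "homeomorphic_map (subtopology (mtop PM) (mdom PM c))
    (subtopology (coord_space (mind PM)) (mimg PM c)) (mcoord PM c)"
proof (rule homeomorphic_maps_imp_map)
  let ?A = "subtopology (mtop PM) (mdom PM c)" and ?B = "subtopology (coord_space (mind PM)) (mimg PM c)"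
  have tA: "topspace ?A = mdom PM c" using openin_subset[OF openin_mdom_PM[OF c]] by auto
  have tB: "topspace ?B = mimg PM c" using openin_subset[OF openin_mimg_PM[OF c]] by auto
  show "homeomorphic_maps ?A ?B (mcoord PM c) (mparam PM c)"
    unfolding homeomorphic_maps_def tA tB
  proof (intro conjI ballI)
    have "continuous_map ?A euclidean (\<lambda>p. mcoord PM c p a)" if "a \<in> mind PM" for a
    proof -
      obtain j i where a: "a = (j, i)" "j \<in> {1..n}" "i \<in> mind (Y j)" using \<open>a \<in> mind PM\<close> by (auto simp: PM_simps)
      have "continuous_map ?A (subtopology (mtop (Y j)) (mdom (Y j) (c j))) (\<lambda>p. p j)"
        unfolding continuous_map_in_subtopology PM_simps(1)
        using continuous_map_from_subtopology[OF continuous_map_product_coordinates[OF a(2)]]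
          mdom_factor[of _ c, OF _ a(2)] by auto
      from continuous_map_compose[OF this continuous_map_mcoord[OF factor_manifold[OF a(2)] chart_factor[OF c a(2)]]]
      have "continuous_map ?A (coord_space (mind (Y j))) (\<lambda>p. mcoord (Y j) (c j) (p j))"
        by (simp add: o_def)
      then have "continuous_map ?A euclidean (\<lambda>p. mcoord (Y j) (c j) (p j) i)"
        using a(3) by (simp add: continuous_map_componentwise)
      then show ?thesis using a by (simp add: PM_simps(5))
    qed
    moreover have "mcoord PM c ` topspace ?A \<subseteq> extensional (mind PM)" by (auto simp: PM_simps)
    ultimately show "continuous_map ?A ?B (mcoord PM c)"
      unfolding continuous_map_in_subtopology continuous_map_componentwise using tA by auto
  next
    have "continuous_map ?B (mtop (Y j)) (\<lambda>x. mparam PM c x j)" if j: "j \<in> {1..n}" for j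
    proof -
      have "continuous_map ?B (subtopology (coord_space (mind (Y j))) (mimg (Y j) (c j))) (fac j)"
        unfolding continuous_map_in_subtopology
        using continuous_map_from_subtopology[OF continuous_map_fac[OF j]] fac_mimg[OF c _ j] tB by auto
      from continuous_map_compose[OF this continuous_map_mparam[OF factor_manifold[OF j] chart_factor[OF c j]]]
      have "continuous_map ?B (mtop (Y j)) (mparam (Y j) (c j) \<circ> fac j)"
        by (simp add: continuous_map_in_subtopology)
      then show ?thesis
        by (rule continuous_map_eq) (use tB mparam_PM[OF c _ j] in auto)
    qed
    moreover have m: "mparam PM c x \<in> mdom PM c" if "x \<in> mimg PM c" for x
      using that by (rule inv_into_into)
    moreover have "mparam PM c ` topspace ?B \<subseteq> extensional {1..n}"
      using m tB by (auto simp: PM_simps(4) PiE_iff)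
    ultimately show "continuous_map ?B ?A (mparam PM c)"
      unfolding continuous_map_in_subtopology PM_simps(1) continuous_map_componentwise using tB by auto
  next
    show "mparam PM c (mcoord PM c p) = p" if "p \<in> mdom PM c" for p
      using that inj_on_mcoord_PM[OF c] by simp
    show "mcoord PM c (mparam PM c x) = x" if "x \<in> mimg PM c" for x
      using that by (rule f_inv_into_f)
  qed
qed

lemma openin_mcoord_PM_image:
  assumes "c \<in> mcharts PM" "openin (mtop PM) U" "U \<subseteq> mdom PM c"
  shows "openin (coord_space (mind PM)) (mcoord PM c ` U)"
  using openin_chart_image[OF openin_mdom_PM openin_mimg_PM homeomorphic_map_PM] assms by blast

text \<open>
  A coordinate of the target that is a coordinate of one factor is represented by the pull-back of a
  transition function of that factor; so changes of product charts and projections are smooth.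
\<close>

lemma local_rep_factor:
  assumes c: "c \<in> mcharts PM" and e: "e \<in> {1..n}" and x: "x \<in> mimg PM c"
    and f: "\<And>q. q \<in> mdom PM c \<Longrightarrow> mcoord N d (f q) s = mcoord (Y e) d' (q e) i"
  shows "local_rep PM N f c d s x = local_rep (Y e) (Y e) id (c e) d' i (fac e x)"
  using f[OF inv_into_into[OF x]] mparam_PM[OF c x e] by (simp add: local_rep_def)

lemma smooth_on_local_rep_factor:
  assumes c: "c \<in> mcharts PM" and e: "e \<in> {1..n}" and d': "d' \<in> mcharts (Y e)" and i: "i \<in> mind (Y e)"
    and U: "openin (mtop PM) U" "U \<subseteq> mdom PM c" "\<And>p. p \<in> U \<Longrightarrow> p e \<in> mdom (Y e) d'"
    and f: "\<And>q. q \<in> mdom PM c \<Longrightarrow> mcoord N d (f q) s = mcoord (Y e) d' (q e) i"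
  shows "smooth_on (mind PM) (mcoord PM c ` U) (local_rep PM N f c d s)"
proof (rule smooth_on_cong[OF openin_mcoord_PM_image[OF c U(1,2)]])
  have "fac e x \<in> mcoord (Y e) (c e) ` (mdom (Y e) (c e) \<inter> mdom (Y e) d')" if "x \<in> mcoord PM c ` U" for x
    using that U(2,3) fac_mcoord[OF c _ e] mdom_factor[OF _ e] by fastforce
  then show "smooth_on (mind PM) (mcoord PM c ` U) (\<lambda>x. local_rep (Y e) (Y e) id (c e) d' i (fac e x))"
    unfolding PM_simps(2)
    by (rule smooth_on_factor[where I = "\<lambda>j. mind (Y j)" and e = e and h = "local_rep (Y e) (Y e) id (c e) d' i",
          OF manifold_transition[OF factor_manifold[OF e] chart_factor[OF c e] d' i] e])
  show "local_rep (Y e) (Y e) id (c e) d' i (fac e x) = local_rep PM N f c d s x" if "x \<in> mcoord PM c ` U" for x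
    using local_rep_factor[where f = f, OF c e _ f] that U(2) by fastforce
qed

proposition manifold_PM: "manifold PM"
  unfolding manifold_def
proof (intro conjI ballI)
  show "Hausdorff_space (mtop PM)"
    using manifold_Hausdorff[OF factor_manifold] by (simp add: PM_simps Hausdorff_space_product_topology)
  show "second_countable (mtop PM)"
    using manifold_second_countable[OF factor_manifold] unfolding PM_simps by (intro second_countable_product_topology) auto
  show "finite (mind PM)" by (rule finite_mind_PM)
  show "(\<Union>c\<in>mcharts PM. mdom PM c) = topspace (mtop PM)"
  proof
    show "(\<Union>c\<in>mcharts PM. mdom PM c) \<subseteq> topspace (mtop PM)"
      using openin_subset[OF openin_mdom_PM] by blast
    show "topspace (mtop PM) \<subseteq> (\<Union>c\<in>mcharts PM. mdom PM c)"
    proof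
      fix p assume p: "p \<in> topspace (mtop PM)"
      have "\<exists>c. c \<in> mcharts (Y j) \<and> p j \<in> mdom (Y j) c" if "j \<in> {1..n}" for j
      proof -
        have "p j \<in> topspace (mtop (Y j))" using p that by (auto simp: PM_simps(1))
        then show ?thesis unfolding manifold_covered[OF factor_manifold[OF that], symmetric] by blast
      qed
      then obtain c where "\<And>j. j \<in> {1..n} \<Longrightarrow> c j \<in> mcharts (Y j) \<and> p j \<in> mdom (Y j) (c j)" by metis
      then have "restrict c {1..n} \<in> mcharts PM" "p \<in> mdom PM (restrict c {1..n})"
        using p by (auto simp: PM_simps PiE_iff)
      then show "p \<in> (\<Union>c\<in>mcharts PM. mdom PM c)" by blast
    qed
  qed
  fix c assume c: "c \<in> mcharts PM"
  show "openin (mtop PM) (mdom PM c)" by (rule openin_mdom_PM[OF c])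
  show "openin (coord_space (mind PM)) (mimg PM c)" by (rule openin_mimg_PM[OF c])
  show "homeomorphic_map (subtopology (mtop PM) (mdom PM c))
    (subtopology (coord_space (mind PM)) (mimg PM c)) (mcoord PM c)" by (rule homeomorphic_map_PM[OF c])
  fix c' a assume c': "c' \<in> mcharts PM" and "a \<in> mind PM"
  then obtain e i where a: "a = (e, i)" "e \<in> {1..n}" "i \<in> mind (Y e)" by (auto simp: PM_simps)
  show "smooth_on (mind PM) (mcoord PM c ` (mdom PM c \<inter> mdom PM c')) (local_rep PM PM id c c' a)"
  proof (rule smooth_on_local_rep_factor[OF c a(2) chart_factor[OF c' a(2)] a(3)])
    show "openin (mtop PM) (mdom PM c \<inter> mdom PM c')" using c c' openin_mdom_PM by blast
    show "mcoord PM c' (id q) a = mcoord (Y e) (c' e) (q e) i" for q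
      using a by (simp add: PM_simps(5))
  qed (use mdom_factor[OF _ a(2)] in auto)
qed

end

section \<open>Tensor fields on a product\<close>

(* The index sets {1..n} of factors and bases keep their stated form in simplified goals. *)
declare One_nat_def [simp del]

lemma sum_fun_apply: "(\<Sum>s\<in>S. f s) x = (\<Sum>s\<in>S. f s x)"
  by (induction S rule: infinite_finite_induct) simp_all

context manifold_family
begin

lemma lift_vf_apply: "lift_vf Y e X c x (j, i) = (if j = e then X (c e) (fac e x) i else 0)"
  by (simp add: lift_vf_def factor_coord_def)

lemma lift_bvf_apply:
  "lift_bvf Y e P c x (j, i) (j', i') = (if j = e \<and> j' = e then P (c e) (fac e x) i i' else 0)"
  by (simp add: lift_bvf_def factor_coord_def)

lemma product_action_apply:
  "j \<in> {1..n} \<Longrightarrow> product_action n Y \<sigma> a c x (j, i) = \<sigma> j (a j) (c j) (fac j x) i"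
  by (simp add: product_action_def sum_fun_apply lift_vf_apply sum.delta)

lemma sum_lift_bvf_apply:
  assumes "e \<in> {1..n}"
  shows "(\<Sum>j = 1..n. lift_bvf Y j (P j)) c y (e, i) (f, j') = (if e = f then P e (c e) (fac e y) i j' else 0)"
proof -
  have "(\<Sum>j = 1..n. lift_bvf Y j (P j)) c y (e, i) (f, j') =
      (\<Sum>j = 1..n. if j = e then (if e = f then P e (c e) (fac e y) i j' else 0) else 0)"
    unfolding sum_fun_apply by (intro sum.cong refl) (auto simp: lift_bvf_apply)
  then show ?thesis using assms by (simp add: sum.delta)
qed

lemma mixed_product_apply:
  assumes "e \<in> {1..n}" "f \<in> {1..n}"
  shows "mixed_product n m x \<xi> Y P \<rho> \<kappa> c y (e, i) (f, j) =
    (if e = f then P e (c e) (fac e y) i j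
     else if e < f then - (\<Sum>s = 1..m. \<rho> e (\<xi> s) (c e) (fac e y) i * \<kappa> f (x s) (c f) (fac f y) j)
     else (\<Sum>s = 1..m. \<kappa> e (x s) (c e) (fac e y) i * \<rho> f (\<xi> s) (c f) (fac f y) j))"
proof -
  let ?S = "{(j, k). 1 \<le> j \<and> j < k \<and> k \<le> n}"
  let ?A = "\<Sum>s = 1..m. \<rho> e (\<xi> s) (c e) (fac e y) i * \<kappa> f (x s) (c f) (fac f y) j"
  let ?B = "\<Sum>s = 1..m. \<kappa> e (x s) (c e) (fac e y) i * \<rho> f (\<xi> s) (c f) (fac f y) j"
  have fin: "finite ?S" by (rule finite_subset[of _ "{1..n} \<times> {1..n}"]) auto
  have W: "(\<Sum>s = 1..m. wedge (lift_vf Y j' (\<rho> j' (\<xi> s))) (lift_vf Y k (\<kappa> k (x s))) c y (e, i) (f, j)) =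
      (if (j', k) = (e, f) then ?A else 0) - (if (j', k) = (f, e) then ?B else 0)" for j' k
  proof -
    have "lift_vf Y j' (\<rho> j' (\<xi> s)) c y (e, i) * lift_vf Y k (\<kappa> k (x s)) c y (f, j) =
        (if (j', k) = (e, f) then \<rho> e (\<xi> s) (c e) (fac e y) i * \<kappa> f (x s) (c f) (fac f y) j else 0)" for s
      by (cases "j' = e"; cases "k = f") (simp_all add: lift_vf_apply)
    moreover have "lift_vf Y k (\<kappa> k (x s)) c y (e, i) * lift_vf Y j' (\<rho> j' (\<xi> s)) c y (f, j) =
        (if (j', k) = (f, e) then \<kappa> e (x s) (c e) (fac e y) i * \<rho> f (\<xi> s) (c f) (fac f y) j else 0)" for s
      by (cases "k = e"; cases "j' = f") (simp_all add: lift_vf_apply)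
    moreover have "(\<Sum>s = 1..m. if C then g s else 0) = (if C then \<Sum>s = 1..m. g s else 0)" for C and g :: "nat \<Rightarrow> 'k"
      by simp
    ultimately show ?thesis by (simp only: wedge_def sum_subtractf)
  qed
  have "(\<Sum>(j', k)\<in>?S. \<Sum>s = 1..m. wedge (lift_vf Y j' (\<rho> j' (\<xi> s))) (lift_vf Y k (\<kappa> k (x s)))) c y (e, i) (f, j) =
      (\<Sum>q\<in>?S. (if q = (e, f) then ?A else 0) - (if q = (f, e) then ?B else 0))"
    unfolding sum_fun_apply
  proof (rule sum.cong[OF refl], goal_cases)
    case (1 q)
    obtain j' k where q: "q = (j', k)" by (cases q)
    show ?case
      unfolding q prod.case sum_fun_apply W ..
  qed
  also have "\<dots> = (if (e, f) \<in> ?S then ?A else 0) - (if (f, e) \<in> ?S then ?B else 0)"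
    using fin by (simp add: sum_subtractf sum.delta)
  finally have 1: "(\<Sum>(j', k)\<in>?S. \<Sum>s = 1..m. wedge (lift_vf Y j' (\<rho> j' (\<xi> s))) (lift_vf Y k (\<kappa> k (x s)))) c y (e, i) (f, j) =
      (if (e, f) \<in> ?S then ?A else 0) - (if (f, e) \<in> ?S then ?B else 0)" .
  show ?thesis unfolding mixed_product_def using 1 assms by (auto simp: sum_lift_bvf_apply)
qed

lemma sum_mind_PM: "(\<Sum>a\<in>mind PM. g a) = (\<Sum>j = 1..n. \<Sum>l\<in>mind (Y j). g (j, l))"
  unfolding PM_simps using manifold_finite_mind[OF factor_manifold] by (subst sum.Sigma) auto

text \<open>
  The identity of the product and the projections to pairs of factors have in common that each
  coordinate of the target is a coordinate of a single factor: \<open>E s\<close> is the factor read by the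
  coordinate \<open>s\<close>, \<open>L s\<close> the coordinate label there, and \<open>K d e\<close> the chart of the factor \<open>e\<close> that
  belongs to the chart \<open>d\<close> of the target.
\<close>

definition reads_factors ::
  "('k, 'q, 's, 'd) manifold \<Rightarrow> ((nat \<Rightarrow> 'p) \<Rightarrow> 'q) \<Rightarrow> ('s \<Rightarrow> nat) \<Rightarrow> ('s \<Rightarrow> 'i) \<Rightarrow> ('d \<Rightarrow> nat \<Rightarrow> 'c) \<Rightarrow> bool" where
  "reads_factors N f E L K \<longleftrightarrow>
     (\<forall>s\<in>mind N. E s \<in> {1..n} \<and> L s \<in> mind (Y (E s))) \<and>
     (\<forall>d\<in>mcharts N. \<forall>s\<in>mind N. K d (E s) \<in> mcharts (Y (E s)) \<and>
        (\<forall>q. f q \<in> mdom N d \<longrightarrow> q (E s) \<in> mdom (Y (E s)) (K d (E s))) \<and>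
        (\<forall>q. mcoord N d (f q) s = mcoord (Y (E s)) (K d (E s)) (q (E s)) (L s)))"

lemma reads_factors_id: "reads_factors PM id fst snd (\<lambda>d e. d e)"
  by (auto simp: reads_factors_def PM_simps)

abbreviation factor_jacobian :: "(nat \<Rightarrow> 'c) \<Rightarrow> (nat \<Rightarrow> 'c) \<Rightarrow> (nat \<Rightarrow> 'p) \<Rightarrow> nat \<Rightarrow> 'i \<Rightarrow> 'i \<Rightarrow> 'k" where
  "factor_jacobian c d p e \<equiv> jacobian (Y e) (Y e) id (c e) (d e) (p e)"

text \<open>
  Near the point, the local representative of the coordinate \<open>s\<close> is the pull-back of a transition
  function of the factor \<open>E s\<close>, so the Jacobian matrix is made of blocks of the Jacobian matrices of
  changes of charts of the factors.
\<close>

lemma jacobian_factor: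
  assumes rf: "reads_factors N f E L K" and c: "c \<in> mcharts PM" and d: "d \<in> mcharts N"
    and p: "p \<in> mdom PM c" and s: "s \<in> mind N" and j: "j \<in> {1..n}" and l: "l \<in> mind (Y j)"
  shows "jacobian PM N f c d p s (j, l) =
    (if j = E s then factor_jacobian c (K d) p j (L s) l else 0)"
proof -
  let ?e = "E s"
  have e: "?e \<in> {1..n}" and f: "\<And>q. mcoord N d (f q) s = mcoord (Y ?e) (K d ?e) (q ?e) (L s)"
    using rf d s unfolding reads_factors_def by blast+
  let ?h = "local_rep (Y ?e) (Y ?e) id (c ?e) (K d ?e) (L s)"
  have "jacobian PM N f c d p s (j, l) = pderiv_at (j, l) (local_rep PM N f c d s) (mcoord PM c p)"
    by (simp add: jacobian_def)
  also have "\<dots> = pderiv_at (j, l) (\<lambda>x. ?h (fac ?e x)) (mcoord PM c p)"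
  proof (rule pderiv_at_cong[OF openin_mimg_PM[OF c]])
    show "mcoord PM c p \<in> mimg PM c" using p by simp
    show "(j, l) \<in> mind PM" using j l by (simp add: PM_simps)
    show "local_rep PM N f c d s y = ?h (fac ?e y)" if "y \<in> mimg PM c" for y
      using local_rep_factor[where f = f, OF c e that f] .
  qed
  also have "\<dots> = (if j = ?e then pderiv_at l ?h (fac ?e (mcoord PM c p)) else 0)"
    by (rule pderiv_at_factor) (rule l)
  also have "\<dots> = (if j = E s then factor_jacobian c (K d) p j (L s) l else 0)"
    using fac_mcoord[OF c p e] by (simp add: jacobian_def)
  finally show ?thesis .
qed

lemma jacobian_sum_factor:
  assumes rf: "reads_factors N f E L K" and c: "c \<in> mcharts PM" and d: "d \<in> mcharts N"
    and p: "p \<in> mdom PM c" and s: "s \<in> mind N" and e: "e = E s"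
  shows "(\<Sum>a\<in>mind PM. jacobian PM N f c d p s a * g a) =
    (\<Sum>l\<in>mind (Y e). factor_jacobian c (K d) p e (L s) l * g (e, l))"
proof -
  have en: "e \<in> {1..n}" using rf s e unfolding reads_factors_def by blast
  have "(\<Sum>a\<in>mind PM. jacobian PM N f c d p s a * g a) =
      (\<Sum>j = 1..n. if j = e then (\<Sum>l\<in>mind (Y e). factor_jacobian c (K d) p e (L s) l * g (e, l)) else 0)"
    unfolding sum_mind_PM e
    by (intro sum.cong refl) (auto simp: jacobian_factor[OF rf c d p s] intro!: sum.cong)
  then show ?thesis using en by (simp add: sum.delta)
qed

lemma jacobian_sum_vector_fields:
  assumes rf: "reads_factors N f E L K" and c: "c \<in> mcharts PM" and d: "d \<in> mcharts N"
    and p: "p \<in> local_dom PM N f c d" and s: "s \<in> mind N"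
    and X: "\<And>e. e \<in> {1..n} \<Longrightarrow> vf_related (Y e) (Y e) id (X e) (X e)"
    and A: "\<And>l. l \<in> mind (Y (E s)) \<Longrightarrow> A (E s, l) = X (E s) (c (E s)) (mcoord (Y (E s)) (c (E s)) (p (E s))) l"
  shows "(\<Sum>a\<in>mind PM. jacobian PM N f c d p s a * A a) =
    X (E s) (K d (E s)) (mcoord (Y (E s)) (K d (E s)) (p (E s))) (L s)"
proof -
  have p': "p \<in> mdom PM c" "f p \<in> mdom N d" using p by (auto simp: local_dom_def)
  have e: "E s \<in> {1..n}" "L s \<in> mind (Y (E s))" "K d (E s) \<in> mcharts (Y (E s))"
      "p (E s) \<in> mdom (Y (E s)) (K d (E s))"
    using rf d s p'(2) unfolding reads_factors_def by blast+
  have "p (E s) \<in> local_dom (Y (E s)) (Y (E s)) id (c (E s)) (K d (E s))"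
    using mdom_factor[OF p'(1) e(1)] e(4) by (simp add: local_dom_def)
  then have "X (E s) (K d (E s)) (mcoord (Y (E s)) (K d (E s)) (id (p (E s)))) (L s) =
      (\<Sum>a\<in>mind (Y (E s)). factor_jacobian c (K d) p (E s) (L s) a
        * X (E s) (c (E s)) (mcoord (Y (E s)) (c (E s)) (p (E s))) a)"
    using X[OF e(1)] chart_factor[OF c e(1)] e unfolding vf_related_def by blast
  then show ?thesis unfolding jacobian_sum_factor[OF rf c d p'(1) s refl] using A by simp
qed

text \<open>
  Transformation of a mixed product under such a map: the diagonal blocks transform like the
  bivector fields of the factors, and the off-diagonal blocks like sums of products of vector
  fields of the factors.
\<close>

lemma jacobian_sum_mixed_product:
  assumes rf: "reads_factors N f E L K" and c: "c \<in> mcharts PM" and d: "d \<in> mcharts N"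
    and p: "p \<in> local_dom PM N f c d" and s: "s \<in> mind N" and t: "t \<in> mind N"
    and P: "\<And>e. e \<in> {1..n} \<Longrightarrow> bvf_related (Y e) (Y e) id (P e) (P e)"
    and R: "\<And>e q. e \<in> {1..n} \<Longrightarrow> q \<in> {1..m} \<Longrightarrow> vf_related (Y e) (Y e) id (\<rho> e (\<xi> q)) (\<rho> e (\<xi> q))"
    and Q: "\<And>e q. e \<in> {1..n} \<Longrightarrow> q \<in> {1..m} \<Longrightarrow> vf_related (Y e) (Y e) id (\<kappa> e (x q)) (\<kappa> e (x q))"
    and y: "\<And>e. e \<in> {1..n} \<Longrightarrow> y e = mcoord (Y e) (K d e) (p e)"
  shows "(\<Sum>a\<in>mind PM. \<Sum>b\<in>mind PM. jacobian PM N f c d p s a * jacobian PM N f c d p t b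
      * mixed_product n m x \<xi> Y P \<rho> \<kappa> c (mcoord PM c p) a b) =
    (if E s = E t then P (E s) (K d (E s)) (y (E s)) (L s) (L t)
     else if E s < E t then - (\<Sum>q = 1..m. \<rho> (E s) (\<xi> q) (K d (E s)) (y (E s)) (L s) * \<kappa> (E t) (x q) (K d (E t)) (y (E t)) (L t))
     else (\<Sum>q = 1..m. \<kappa> (E s) (x q) (K d (E s)) (y (E s)) (L s) * \<rho> (E t) (\<xi> q) (K d (E t)) (y (E t)) (L t)))"
    (is "?lhs = ?rhs")
proof -
  let ?z = "mcoord PM c p"
  let ?M = "mixed_product n m x \<xi> Y P \<rho> \<kappa> c ?z"
  define e where "e = E s"
  define g where "g = E t"
  define Js where "Js = factor_jacobian c (K d) p e (L s)"
  define Jt where "Jt = factor_jacobian c (K d) p g (L t)"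
  have p': "p \<in> mdom PM c" "f p \<in> mdom N d" using p by (auto simp: local_dom_def)
  have e: "e \<in> {1..n}" "L s \<in> mind (Y e)" "K d e \<in> mcharts (Y e)" "p e \<in> mdom (Y e) (K d e)"
    and g: "g \<in> {1..n}" "L t \<in> mind (Y g)" "K d g \<in> mcharts (Y g)" "p g \<in> mdom (Y g) (K d g)"
    using rf d s t p'(2) unfolding reads_factors_def e_def g_def by blast+
  have pe: "p e \<in> local_dom (Y e) (Y e) id (c e) (K d e)" and pg: "p g \<in> local_dom (Y g) (Y g) id (c g) (K d g)"
    using mdom_factor[OF p'(1)] e g by (simp_all add: local_dom_def)
  have Fe: "fac e ?z = mcoord (Y e) (c e) (p e)" using fac_mcoord[OF c p'(1) e(1)] .
  have "?lhs = (\<Sum>a\<in>mind PM. jacobian PM N f c d p s a * (\<Sum>b\<in>mind PM. jacobian PM N f c d p t b * ?M a b))"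
    by (simp add: sum_distrib_left mult.assoc)
  also have "\<dots> = (\<Sum>l\<in>mind (Y e). Js l * (\<Sum>l'\<in>mind (Y g). Jt l' * ?M (e, l) (g, l')))"
    unfolding jacobian_sum_factor[OF rf c d p'(1) s e_def] jacobian_sum_factor[OF rf c d p'(1) t g_def]
      Js_def Jt_def ..
  also have "\<dots> = ?rhs"
  proof -
    have rel: "(\<Sum>l\<in>mind (Y h). factor_jacobian c (K d) p h i l * X (c h) (fac h ?z) l) = X (K d h) (y h) i"
      if "vf_related (Y h) (Y h) id X X" "h \<in> {1..n}" "i \<in> mind (Y h)" "K d h \<in> mcharts (Y h)"
        "p h \<in> local_dom (Y h) (Y h) id (c h) (K d h)" for X h i
      using that(1) chart_factor[OF c that(2)] that(3-5) y[OF that(2)] fac_mcoord[OF c p'(1) that(2)]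
      unfolding vf_related_def by auto
    have rel_s: "(\<Sum>l\<in>mind (Y e). Js l * X (c e) (fac e ?z) l) = X (K d e) (y e) (L s)"
      if "vf_related (Y e) (Y e) id X X" for X
      unfolding Js_def using rel[OF that e(1-3) pe] .
    have rel_t: "(\<Sum>l\<in>mind (Y g). Jt l * X (c g) (fac g ?z) l) = X (K d g) (y g) (L t)"
      if "vf_related (Y g) (Y g) id X X" for X
      unfolding Jt_def using rel[OF that g(1-3) pg] .
    have tensor: "(\<Sum>l\<in>mind (Y e). Js l * (\<Sum>l'\<in>mind (Y g). Jt l' * (\<Sum>q = 1..m. A q l * B q l'))) =
        (\<Sum>q = 1..m. (\<Sum>l\<in>mind (Y e). Js l * A q l) * (\<Sum>l'\<in>mind (Y g). Jt l' * B q l'))" for A B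
    proof -
      have "(\<Sum>l\<in>mind (Y e). Js l * (\<Sum>l'\<in>mind (Y g). Jt l' * (\<Sum>q = 1..m. A q l * B q l'))) =
        (\<Sum>l\<in>mind (Y e). \<Sum>l'\<in>mind (Y g). \<Sum>q = 1..m. (Js l * A q l) * (Jt l' * B q l'))"
        by (simp add: sum_distrib_left mult_ac)
      also have "\<dots> = (\<Sum>l\<in>mind (Y e). \<Sum>q = 1..m. \<Sum>l'\<in>mind (Y g). (Js l * A q l) * (Jt l' * B q l'))"
        by (intro sum.cong refl sum.swap)
      also have "\<dots> = (\<Sum>q = 1..m. \<Sum>l\<in>mind (Y e). \<Sum>l'\<in>mind (Y g). (Js l * A q l) * (Jt l' * B q l'))"
        by (rule sum.swap)
      finally show ?thesis by (simp add: sum_product)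
    qed
    consider "e = g" | "e < g" | "g < e" by linarith
    then show ?thesis
    proof cases
      case 1
      have "P e (K d e) (mcoord (Y e) (K d e) (id (p e))) (L s) (L t) =
          (\<Sum>l\<in>mind (Y e). \<Sum>l'\<in>mind (Y e). Js l * Jt l' * P e (c e) (mcoord (Y e) (c e) (p e)) l l')"
        using P[OF e(1)] chart_factor[OF c e(1)] e(2,3) g(2) pe 1
        unfolding bvf_related_def Js_def Jt_def by blast
      then show ?thesis using 1 y[OF e(1)] Fe e(1) unfolding e_def[symmetric] g_def[symmetric]
        by (simp add: mixed_product_apply sum_distrib_left mult.assoc)
    next
      case 2
      then have "?M (e, l) (g, l') = - (\<Sum>q = 1..m. \<rho> e (\<xi> q) (c e) (fac e ?z) l * \<kappa> g (x q) (c g) (fac g ?z) l')" for l l'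
        using e(1) g(1) by (simp add: mixed_product_apply)
      then show ?thesis using 2 unfolding e_def[symmetric] g_def[symmetric]
        by (simp add: sum_negf tensor rel_s[OF R[OF e(1)]] rel_t[OF Q[OF g(1)]])
    next
      case 3
      then have "?M (e, l) (g, l') = (\<Sum>q = 1..m. \<kappa> e (x q) (c e) (fac e ?z) l * \<rho> g (\<xi> q) (c g) (fac g ?z) l')" for l l'
        using e(1) g(1) by (simp add: mixed_product_apply)
      then show ?thesis using 3 unfolding e_def[symmetric] g_def[symmetric]
        by (simp add: tensor rel_s[OF Q[OF e(1)]] rel_t[OF R[OF g(1)]])
    qed
  qed
  finally show ?thesis .
qed

lemma smooth_on_fac:
  assumes "c \<in> mcharts PM" "e \<in> {1..n}" "smooth_on (mind (Y e)) (mimg (Y e) (c e)) h"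
  shows "smooth_on (mind PM) (mimg PM c) (\<lambda>y. h (fac e y))"
  unfolding PM_simps(2)
  by (rule smooth_on_factor[where I = "\<lambda>j. mind (Y j)" and e = e and h = h, OF assms(3,2)])
    (rule fac_mimg[OF assms(1) _ assms(2)])

lemma vector_field_product_action:
  assumes X: "\<And>e. e \<in> {1..n} \<Longrightarrow> vector_field (Y e) (\<sigma> e (a e))"
  shows "vector_field PM (product_action n Y \<sigma> a)"
  unfolding vector_field_def
proof (intro conjI ballI)
  fix c b assume c: "c \<in> mcharts PM" and "b \<in> mind PM"
  then obtain e i where b: "b = (e, i)" "e \<in> {1..n}" "i \<in> mind (Y e)" by (auto simp: PM_simps)
  have "smooth_on (mind (Y e)) (mimg (Y e) (c e)) (\<lambda>y. \<sigma> e (a e) (c e) y i)"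
    using X[OF b(2)] b(3) chart_factor[OF c b(2)] unfolding vector_field_def by blast
  from smooth_on_fac[OF c b(2) this] show "smooth_on (mind PM) (mimg PM c) (\<lambda>y. product_action n Y \<sigma> a c y b)"
    unfolding b(1) product_action_apply[OF b(2)] .
next
  show "vf_related PM PM id (product_action n Y \<sigma> a) (product_action n Y \<sigma> a)"
    unfolding vf_related_def
  proof (intro ballI)
    fix c d p s assume c: "c \<in> mcharts PM" and d: "d \<in> mcharts PM" and p: "p \<in> local_dom PM PM id c d"
      and s: "s \<in> mind PM"
    obtain e i where se: "s = (e, i)" "e \<in> {1..n}" using s by (auto simp: PM_simps)
    have p': "p \<in> mdom PM c" "p \<in> mdom PM d" using p by (auto simp: local_dom_def)
    show "product_action n Y \<sigma> a d (mcoord PM d (id p)) s =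
        (\<Sum>b\<in>mind PM. jacobian PM PM id c d p s b * product_action n Y \<sigma> a c (mcoord PM c p) b)"
      using jacobian_sum_vector_fields[OF reads_factors_id c d p s, of "\<lambda>e. \<sigma> e (a e)"
          "product_action n Y \<sigma> a c (mcoord PM c p)"] X se
      by (simp add: vector_field_def product_action_apply fac_mcoord[OF c p'(1)] fac_mcoord[OF d p'(2)])
  qed
qed

lemma bivector_field_mixed_product:
  assumes P: "\<And>e. e \<in> {1..n} \<Longrightarrow> bivector_field (Y e) (P e)"
    and R: "\<And>e q. e \<in> {1..n} \<Longrightarrow> q \<in> {1..m} \<Longrightarrow> vector_field (Y e) (\<rho> e (\<xi> q))"
    and Q: "\<And>e q. e \<in> {1..n} \<Longrightarrow> q \<in> {1..m} \<Longrightarrow> vector_field (Y e) (\<kappa> e (x q))"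
  shows "bivector_field PM (mixed_product n m x \<xi> Y P \<rho> \<kappa>)"
  unfolding bivector_field_def
proof (intro conjI ballI)
  fix c a b assume c: "c \<in> mcharts PM" and "a \<in> mind PM" "b \<in> mind PM"
  then obtain e i g j where a: "a = (e, i)" "e \<in> {1..n}" "i \<in> mind (Y e)"
    and b: "b = (g, j)" "g \<in> {1..n}" "j \<in> mind (Y g)" by (auto simp: PM_simps)
  note W = openin_mimg_PM[OF c]
  have v: "smooth_on (mind PM) (mimg PM c) (\<lambda>y. X (c e) (fac e y) i)"
    if "vector_field (Y e) X" "e \<in> {1..n}" "i \<in> mind (Y e)" for X e i
  proof (rule smooth_on_fac[OF c that(2)])
    show "smooth_on (mind (Y e)) (mimg (Y e) (c e)) (\<lambda>y. X (c e) y i)"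
      using that chart_factor[OF c that(2)] unfolding vector_field_def by blast
  qed
  have d: "smooth_on (mind PM) (mimg PM c) (\<lambda>y. P e (c e) (fac e y) i j)" if "e = g"
  proof (rule smooth_on_fac[OF c a(2)])
    show "smooth_on (mind (Y e)) (mimg (Y e) (c e)) (\<lambda>y. P e (c e) y i j)"
      using P[OF a(2)] chart_factor[OF c a(2)] a(3) b(3) that unfolding bivector_field_def by blast
  qed
  consider "e = g" | "e < g" | "g < e" by linarith
  then show "smooth_on (mind PM) (mimg PM c) (\<lambda>y. mixed_product n m x \<xi> Y P \<rho> \<kappa> c y a b)"
  proof cases
    case 1
    then show ?thesis using d a b by (simp add: mixed_product_apply)
  next
    case 2
    have "smooth_on (mind PM) (mimg PM c)
        (\<lambda>y. - (\<Sum>s = 1..m. \<rho> e (\<xi> s) (c e) (fac e y) i * \<kappa> g (x s) (c g) (fac g y) j))"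
      by (intro smooth_on_uminus[OF W] smooth_on_sum[OF W] smooth_on_mult[OF W] v R Q a b)
    then show ?thesis using 2 a b by (simp add: mixed_product_apply)
  next
    case 3
    have "smooth_on (mind PM) (mimg PM c)
        (\<lambda>y. \<Sum>s = 1..m. \<kappa> e (x s) (c e) (fac e y) i * \<rho> g (\<xi> s) (c g) (fac g y) j)"
      by (intro smooth_on_sum[OF W] smooth_on_mult[OF W] v R Q a b)
    then show ?thesis using 3 a b by (simp add: mixed_product_apply)
  qed
next
  fix c y a b assume c: "c \<in> mcharts PM" and y: "y \<in> mimg PM c" and "a \<in> mind PM" "b \<in> mind PM"
  then obtain e i g j where a: "a = (e, i)" "e \<in> {1..n}" "i \<in> mind (Y e)"
    and b: "b = (g, j)" "g \<in> {1..n}" "j \<in> mind (Y g)" by (auto simp: PM_simps)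
  have "P e (c e) (fac e y) j i = - P e (c e) (fac e y) i j" if "e = g"
    using P[OF a(2)] chart_factor[OF c a(2)] a(3) b(3) that fac_mimg[OF c y a(2)]
    unfolding bivector_field_def by blast
  then show "mixed_product n m x \<xi> Y P \<rho> \<kappa> c y b a = - mixed_product n m x \<xi> Y P \<rho> \<kappa> c y a b"
    using a b by (auto simp: mixed_product_apply mult.commute)
next
  show "bvf_related PM PM id (mixed_product n m x \<xi> Y P \<rho> \<kappa>) (mixed_product n m x \<xi> Y P \<rho> \<kappa>)"
    unfolding bvf_related_def
  proof (intro ballI)
    fix c d p s t assume c: "c \<in> mcharts PM" and d: "d \<in> mcharts PM" and p: "p \<in> local_dom PM PM id c d"
      and s: "s \<in> mind PM" and t: "t \<in> mind PM"
    obtain e i g j where st: "s = (e, i)" "e \<in> {1..n}" "t = (g, j)" "g \<in> {1..n}"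
      using s t by (auto simp: PM_simps)
    have p': "p \<in> mdom PM c" "p \<in> mdom PM d" using p by (auto simp: local_dom_def)
    show "mixed_product n m x \<xi> Y P \<rho> \<kappa> d (mcoord PM d (id p)) s t =
        (\<Sum>a\<in>mind PM. \<Sum>b\<in>mind PM. jacobian PM PM id c d p s a * jacobian PM PM id c d p t b
          * mixed_product n m x \<xi> Y P \<rho> \<kappa> c (mcoord PM c p) a b)"
      by (subst jacobian_sum_mixed_product[OF reads_factors_id c d p s t, where y = "\<lambda>e. mcoord (Y e) (d e) (p e)"])
        (use P R Q st(2,4) in \<open>simp_all add: bivector_field_def vector_field_def st(1,3) mixed_product_apply fac_mcoord[OF d p'(2)]\<close>)
  qed
qed

end

section \<open>Lie bialgebras from Manin triples\<close>

locale lie_alg_on =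
  fixes L :: "('k::field, 'v::ab_group_add) lie_alg"
  assumes lie: "lie_algebra L"
begin

abbreviation C :: "'v set" where "C \<equiv> lcarrier L"
abbreviation scl :: "'k \<Rightarrow> 'v \<Rightarrow> 'v" where "scl \<equiv> lscale L"
abbreviation br :: "'v \<Rightarrow> 'v \<Rightarrow> 'v" where "br \<equiv> lbracket L"

sublocale V: vector_space scl
  using lie unfolding lie_algebra_def by blast

lemma subspace_C: "V.subspace C"
  using lie unfolding lie_algebra_def by blast

lemma finite_span_C: "\<exists>B. finite B \<and> V.span B = C"
  using lie unfolding lie_algebra_def by blast

lemmas C_add = V.subspace_add[OF subspace_C]
  and C_scale = V.subspace_scale[OF subspace_C]
  and C_0 = V.subspace_0[OF subspace_C]
  and C_neg = V.subspace_neg[OF subspace_C]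
  and C_diff = V.subspace_diff[OF subspace_C]
  and C_sum = V.subspace_sum[OF subspace_C]

lemma C_bracket: "a \<in> C \<Longrightarrow> b \<in> C \<Longrightarrow> br a b \<in> C"
  using lie by (simp add: lie_algebra_def)

lemma bracket_add_left: "a \<in> C \<Longrightarrow> b \<in> C \<Longrightarrow> c \<in> C \<Longrightarrow> br (a + b) c = br a c + br b c"
  and bracket_add_right: "a \<in> C \<Longrightarrow> b \<in> C \<Longrightarrow> c \<in> C \<Longrightarrow> br c (a + b) = br c a + br c b"
  using lie by (simp_all add: lie_algebra_def)

lemma bracket_scale_left: "a \<in> C \<Longrightarrow> b \<in> C \<Longrightarrow> br (scl s a) b = scl s (br a b)"
  and bracket_scale_right: "a \<in> C \<Longrightarrow> b \<in> C \<Longrightarrow> br a (scl s b) = scl s (br a b)"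
  using lie by (simp_all add: lie_algebra_def)

lemma bracket_self: "a \<in> C \<Longrightarrow> br a a = 0"
  using lie by (simp add: lie_algebra_def)

lemma jacobi: "a \<in> C \<Longrightarrow> b \<in> C \<Longrightarrow> c \<in> C \<Longrightarrow> br a (br b c) + br b (br c a) + br c (br a b) = 0"
  using lie by (simp add: lie_algebra_def)

lemma bracket_anticomm: "a \<in> C \<Longrightarrow> b \<in> C \<Longrightarrow> br b a = - br a b"
proof -
  assume a: "a \<in> C" and b: "b \<in> C"
  have "0 = br (a + b) (a + b)" using a b by (simp add: bracket_self C_add)
  also have "\<dots> = br a b + br b a"
    using a b bracket_self[OF a] bracket_self[OF b] by (simp add: bracket_add_left bracket_add_right C_add)
  finally have "br a b + br b a = 0" by (rule sym)
  then show ?thesis by (rule minus_unique[symmetric])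
qed

lemma bracket_0_right: "a \<in> C \<Longrightarrow> br a 0 = 0"
  using bracket_scale_right[of a 0 0] C_0 by simp

lemma bracket_0_left: "a \<in> C \<Longrightarrow> br 0 a = 0"
  using bracket_scale_left[of 0 a 0] C_0 by simp

lemma bracket_neg_right: "a \<in> C \<Longrightarrow> b \<in> C \<Longrightarrow> br a (- b) = - br a b"
  using bracket_scale_right[of a b "- 1"] by simp

lemma bracket_neg_left: "a \<in> C \<Longrightarrow> b \<in> C \<Longrightarrow> br (- a) b = - br a b"
  using bracket_scale_left[of a b "- 1"] by simp

lemma bracket_sum_right: "a \<in> C \<Longrightarrow> (\<And>k. k \<in> K \<Longrightarrow> f k \<in> C) \<Longrightarrow> br a (\<Sum>k\<in>K. f k) = (\<Sum>k\<in>K. br a (f k))"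
  by (induction K rule: infinite_finite_induct)
    (auto simp: bracket_0_right bracket_add_right C_sum)

lemma bracket_derivation:
  assumes "a \<in> C" "b \<in> C" "c \<in> C"
  shows "br (br a b) c = br a (br b c) - br b (br a c)"
proof -
  have "br a (br b c) + br b (br c a) + br c (br a b) = 0" using jacobi assms by blast
  moreover have "br b (br c a) = - br b (br a c)"
    using assms bracket_anticomm[of a c] by (simp add: bracket_neg_right C_bracket)
  moreover have "br c (br a b) = - br (br a b) c"
    using assms by (intro bracket_anticomm C_bracket)
  ultimately show ?thesis by (simp add: algebra_simps)
qed

lemma dual_add: "\<alpha> \<in> dual_space L \<Longrightarrow> a \<in> C \<Longrightarrow> b \<in> C \<Longrightarrow> \<alpha> (a + b) = \<alpha> a + \<alpha> b"
  and dual_scale: "\<alpha> \<in> dual_space L \<Longrightarrow> a \<in> C \<Longrightarrow> \<alpha> (scl s a) = s * \<alpha> a"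
  and dual_outside: "\<alpha> \<in> dual_space L \<Longrightarrow> a \<notin> C \<Longrightarrow> \<alpha> a = 0"
  by (simp_all add: dual_space_def)

lemma dual_0: "\<alpha> \<in> dual_space L \<Longrightarrow> \<alpha> 0 = 0"
  using dual_scale[of \<alpha> 0 0] C_0 by simp

lemma dual_neg: "\<alpha> \<in> dual_space L \<Longrightarrow> a \<in> C \<Longrightarrow> \<alpha> (- a) = - \<alpha> a"
  using dual_scale[of \<alpha> a "- 1"] by simp

lemma dual_diff: "\<alpha> \<in> dual_space L \<Longrightarrow> a \<in> C \<Longrightarrow> b \<in> C \<Longrightarrow> \<alpha> (a - b) = \<alpha> a - \<alpha> b"
  using dual_add[of \<alpha> a "- b"] dual_neg[of \<alpha> b] C_neg by simp

lemma dual_sum: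
  "\<alpha> \<in> dual_space L \<Longrightarrow> (\<And>k. k \<in> K \<Longrightarrow> f k \<in> C) \<Longrightarrow> \<alpha> (\<Sum>k\<in>K. f k) = (\<Sum>k\<in>K. \<alpha> (f k))"
  by (induction K rule: infinite_finite_induct) (auto simp: dual_0 dual_add C_sum)

lemma restrict0_in_dual:
  assumes "\<And>a b. a \<in> C \<Longrightarrow> b \<in> C \<Longrightarrow> f (a + b) = f a + f b"
    and "\<And>s a. a \<in> C \<Longrightarrow> f (scl s a) = s * f a"
  shows "restrict0 C f \<in> dual_space L"
  using assms unfolding dual_space_def by (auto simp: restrict0_def C_add C_scale)

lemma dual_plus: "\<alpha> \<in> dual_space L \<Longrightarrow> \<beta> \<in> dual_space L \<Longrightarrow> \<alpha> + \<beta> \<in> dual_space L"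
  and dual_fscale: "\<alpha> \<in> dual_space L \<Longrightarrow> fscale s \<alpha> \<in> dual_space L"
  by (auto simp: dual_space_def fscale_def algebra_simps)

lemma dual_ext:
  assumes "\<alpha> \<in> dual_space L" "\<beta> \<in> dual_space L" "\<And>a. a \<in> C \<Longrightarrow> \<alpha> a = \<beta> a"
  shows "\<alpha> = \<beta>"
  using assms dual_outside by (metis ext)

definition coad :: "'v \<Rightarrow> ('v \<Rightarrow> 'k) \<Rightarrow> 'v \<Rightarrow> 'k" where
  "coad a \<alpha> = restrict0 C (\<lambda>b. \<alpha> (br a b))"

lemma coad_apply: "b \<in> C \<Longrightarrow> coad a \<alpha> b = \<alpha> (br a b)"
  by (simp add: coad_def restrict0_def)

lemma ad_tensor_coad: "ad_tensor L a t \<alpha> \<beta> = t (coad a \<alpha>) \<beta> + t \<alpha> (coad a \<beta>)"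
  by (simp add: ad_tensor_def coad_def)

lemma coboundary_tensor_sum:
  assumes "a \<in> C" "\<alpha> \<in> dual_space L" "\<beta> \<in> dual_space L"
    and "\<And>k. k \<in> K \<Longrightarrow> u k \<in> C" "\<And>k. k \<in> K \<Longrightarrow> v k \<in> C"
  shows "coboundary L (tensor_sum K u v) a \<alpha> \<beta> =
    \<alpha> (br a (\<Sum>k\<in>K. scl (\<beta> (v k)) (u k))) + \<beta> (br a (\<Sum>k\<in>K. scl (\<alpha> (u k)) (v k)))"
  using assms
  by (simp add: coboundary_def ad_tensor_coad tensor_sum_def coad_apply bracket_sum_right
      dual_sum bracket_scale_right dual_scale C_scale C_bracket mult.commute)

text \<open>
  Both sides are obtained from the tensor by applying \<open>ad\<close> of \<open>[a, b]\<close> and the commutator of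
  \<open>ad\<close> of \<open>a\<close> and of \<open>b\<close>, and these agree by the Jacobi identity.
\<close>

lemma coboundary_cocycle:
  assumes a: "a \<in> C" and b: "b \<in> C" and \<alpha>: "\<alpha> \<in> dual_space L" and \<beta>: "\<beta> \<in> dual_space L"
    and u: "\<And>k. k \<in> K \<Longrightarrow> u k \<in> C" and v: "\<And>k. k \<in> K \<Longrightarrow> v k \<in> C"
  shows "coboundary L (tensor_sum K u v) (br a b) \<alpha> \<beta> =
    ad_tensor L a (coboundary L (tensor_sum K u v) b) \<alpha> \<beta>
      - ad_tensor L b (coboundary L (tensor_sum K u v) a) \<alpha> \<beta>"
proof -
  have D: "coad (br a b) \<gamma> c = coad b (coad a \<gamma>) c - coad a (coad b \<gamma>) c"
    if "c \<in> C" "\<gamma> \<in> dual_space L" for c \<gamma>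
    using that a b by (simp add: coad_apply C_bracket bracket_derivation dual_diff)
  show ?thesis
    using a b \<alpha> \<beta> u v
    by (simp add: coboundary_def ad_tensor_coad tensor_sum_def D sum.distrib sum_subtractf algebra_simps)
qed

end

text \<open>The vectors that satisfy the expansion form a subspace, which contains the basis vectors.\<close>

lemma (in vector_space) expand_in_dual_basis:
  assumes fin: "finite K" and S: "subspace S" and u: "\<And>l. l \<in> K \<Longrightarrow> u l \<in> S"
    and add: "\<And>k a b. k \<in> K \<Longrightarrow> a \<in> S \<Longrightarrow> b \<in> S \<Longrightarrow> \<phi> k (a + b) = \<phi> k a + \<phi> k b"
    and scl: "\<And>k s a. k \<in> K \<Longrightarrow> a \<in> S \<Longrightarrow> \<phi> k (scale s a) = s * \<phi> k a"
    and dual: "\<And>k l. k \<in> K \<Longrightarrow> l \<in> K \<Longrightarrow> \<phi> k (u l) = (if k = l then 1 else 0)"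
    and b: "b \<in> span (u ` K)"
  shows "b = (\<Sum>k\<in>K. scale (\<phi> k b) (u k))"
proof -
  have z: "\<phi> k 0 = 0" if "k \<in> K" for k using scl[OF that, of 0 0] S subspace_0 by simp
  let ?T = "{b \<in> S. b = (\<Sum>k\<in>K. scale (\<phi> k b) (u k))}"
  have "subspace ?T"
  proof (unfold subspace_def, intro conjI ballI allI)
    show "0 \<in> ?T" using subspace_0[OF S] by (simp add: z)
    fix a assume a: "a \<in> ?T"
    then have aS: "a \<in> S" by blast
    show "a + b \<in> ?T" if "b \<in> ?T" for b
    proof -
      have bS: "b \<in> S" using that by blast
      have "a = (\<Sum>k\<in>K. scale (\<phi> k a) (u k))" "b = (\<Sum>k\<in>K. scale (\<phi> k b) (u k))" using a that by blast+
      then have "a + b = (\<Sum>k\<in>K. scale (\<phi> k a) (u k)) + (\<Sum>k\<in>K. scale (\<phi> k b) (u k))"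
        by (rule arg_cong2)
      also have "\<dots> = (\<Sum>k\<in>K. scale (\<phi> k (a + b)) (u k))"
        using aS bS by (simp add: add scale_left_distrib sum.distrib)
      finally show ?thesis using aS bS subspace_add[OF S] by blast
    qed
    show "scale s a \<in> ?T" for s
    proof -
      have "a = (\<Sum>k\<in>K. scale (\<phi> k a) (u k))" using a by blast
      then have "scale s a = scale s (\<Sum>k\<in>K. scale (\<phi> k a) (u k))" by (rule arg_cong)
      also have "\<dots> = (\<Sum>k\<in>K. scale (\<phi> k (scale s a)) (u k))"
        using aS by (simp add: scl scale_sum_right)
      finally show ?thesis using aS subspace_scale[OF S] by blast
    qed
  qed
  moreover have "u ` K \<subseteq> ?T"
  proof (clarsimp simp: u)
    fix l assume l: "l \<in> K"
    have "(\<Sum>k\<in>K. scale (\<phi> k (u l)) (u k)) = (\<Sum>k\<in>K. if k = l then u l else 0)"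
      by (intro sum.cong refl) (auto simp: dual l)
    then show "u l = (\<Sum>k\<in>K. scale (\<phi> k (u l)) (u k))" using fin l by simp
  qed
  ultimately show ?thesis using b span_minimal by blast
qed

lemma vector_space_fscale: "vector_space (fscale :: 'k::field \<Rightarrow> ('v \<Rightarrow> 'k) \<Rightarrow> 'v \<Rightarrow> 'k)"
  by unfold_locales (auto simp: fscale_def fun_eq_iff algebra_simps)

text \<open>
  A Manin triple \<open>(L, A, B)\<close>: a Lie algebra with an invariant symmetric bilinear form and
  complementary isotropic subalgebras \<open>A\<close>, \<open>B\<close>. That \<open>u\<close>, \<open>v\<close> are dual bases of \<open>A\<close>, \<open>B\<close> is encoded
  in the form in which it is used, by the two expansions.
\<close>

locale manin_triple = lie_alg_on L
  for L :: "('k::field, 'v::ab_group_add) lie_alg" +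
  fixes F :: "'v \<Rightarrow> 'v \<Rightarrow> 'k" and A B :: "'v set"
    and K :: "'b set" and u v :: "'b \<Rightarrow> 'v"
  assumes F_add: "\<And>a b c. a \<in> lcarrier L \<Longrightarrow> b \<in> lcarrier L \<Longrightarrow> c \<in> lcarrier L \<Longrightarrow> F (a + b) c = F a c + F b c"
    and F_scale: "\<And>s a b. a \<in> lcarrier L \<Longrightarrow> b \<in> lcarrier L \<Longrightarrow> F (lscale L s a) b = s * F a b"
    and F_sym: "\<And>a b. a \<in> lcarrier L \<Longrightarrow> b \<in> lcarrier L \<Longrightarrow> F a b = F b a"
    and F_inv: "\<And>a b c. a \<in> lcarrier L \<Longrightarrow> b \<in> lcarrier L \<Longrightarrow> c \<in> lcarrier L \<Longrightarrow>
      F (lbracket L a b) c + F b (lbracket L a c) = 0"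
    and A_C: "A \<subseteq> lcarrier L" and B_C: "B \<subseteq> lcarrier L"
    and A_bracket: "\<And>a b. a \<in> A \<Longrightarrow> b \<in> A \<Longrightarrow> lbracket L a b \<in> A"
    and B_bracket: "\<And>a b. a \<in> B \<Longrightarrow> b \<in> B \<Longrightarrow> lbracket L a b \<in> B"
    and A_isotropic: "\<And>a b. a \<in> A \<Longrightarrow> b \<in> A \<Longrightarrow> F a b = 0"
    and B_isotropic: "\<And>a b. a \<in> B \<Longrightarrow> b \<in> B \<Longrightarrow> F a b = 0"
    and A_subspace: "module.subspace (lscale L) A" and B_subspace: "module.subspace (lscale L) B"
    and u_A: "\<And>k. k \<in> K \<Longrightarrow> u k \<in> A" and v_B: "\<And>k. k \<in> K \<Longrightarrow> v k \<in> B"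
    and expand_A: "\<And>a. a \<in> A \<Longrightarrow> a = (\<Sum>k\<in>K. lscale L (F a (v k)) (u k))"
    and expand_B: "\<And>b. b \<in> B \<Longrightarrow> b = (\<Sum>k\<in>K. lscale L (F (u k) b) (v k))"
    and finite_K: "finite K"
    and decompose: "\<And>c. c \<in> lcarrier L \<Longrightarrow> \<exists>a\<in>A. \<exists>b\<in>B. c = a + b"
begin

definition pA :: "('v \<Rightarrow> 'k) \<Rightarrow> 'v" where "pA \<alpha> = (\<Sum>k\<in>K. scl (\<alpha> (v k)) (u k))"
definition pB :: "('v \<Rightarrow> 'k) \<Rightarrow> 'v" where "pB \<alpha> = (\<Sum>k\<in>K. scl (\<alpha> (u k)) (v k))"

lemma u_C: "k \<in> K \<Longrightarrow> u k \<in> C" and v_C: "k \<in> K \<Longrightarrow> v k \<in> C"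
  using u_A v_B A_C B_C by blast+

lemma pA_A: "pA \<alpha> \<in> A" and pB_B: "pB \<alpha> \<in> B"
  unfolding pA_def pB_def
  by (intro V.subspace_sum V.subspace_scale A_subspace B_subspace u_A v_B; assumption)+

lemma pA_C: "pA \<alpha> \<in> C" and pB_C: "pB \<alpha> \<in> C"
  using pA_A pB_B A_C B_C by blast+

lemma F_add_right: "a \<in> C \<Longrightarrow> b \<in> C \<Longrightarrow> c \<in> C \<Longrightarrow> F c (a + b) = F c a + F c b"
  using F_add F_sym C_add by metis

lemma F_scale_right: "a \<in> C \<Longrightarrow> b \<in> C \<Longrightarrow> F b (scl s a) = s * F b a"
  using F_scale F_sym C_scale by metis

lemma F_0: "a \<in> C \<Longrightarrow> F 0 a = 0"
  using F_scale[of 0 a 0] C_0 by simp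

lemma F_neg: "a \<in> C \<Longrightarrow> b \<in> C \<Longrightarrow> F (- a) b = - F a b"
  using F_scale[of a b "- 1"] by simp

lemma F_diff: "a \<in> C \<Longrightarrow> b \<in> C \<Longrightarrow> c \<in> C \<Longrightarrow> F (a - b) c = F a c - F b c"
  using F_add[of a "- b" c] F_neg[of b c] C_neg by simp

lemma F_sum: "(\<And>k. k \<in> J \<Longrightarrow> f k \<in> C) \<Longrightarrow> c \<in> C \<Longrightarrow> F (\<Sum>k\<in>J. f k) c = (\<Sum>k\<in>J. F (f k) c)"
  by (induction J rule: infinite_finite_induct) (auto simp: F_0 F_add C_sum)

lemma F_bracket: "a \<in> C \<Longrightarrow> b \<in> C \<Longrightarrow> c \<in> C \<Longrightarrow> F (br a b) c = F a (br b c)"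
proof -
  assume "a \<in> C" "b \<in> C" "c \<in> C"
  then have "F (br b a) c + F a (br b c) = 0" "br b a = - br a b"
    by (auto intro: F_inv bracket_anticomm)
  then show ?thesis using \<open>a \<in> C\<close> \<open>b \<in> C\<close> \<open>c \<in> C\<close> by (simp add: F_neg C_bracket)
qed

text \<open>
  On \<open>A\<close> a functional is determined by its values on the basis \<open>u\<close>, that is by \<open>pB \<alpha>\<close>, and the
  form does not see \<open>pA \<alpha>\<close> there since \<open>A\<close> is isotropic; on \<open>B\<close> the roles are exchanged. Hence
  \<open>pA \<alpha>\<close> and \<open>pB \<alpha>\<close> are the components of the vector that represents \<open>\<alpha>\<close>.
\<close>

lemma dual_rep:
  assumes \<alpha>: "\<alpha> \<in> dual_space L" and "c \<in> C"
  shows "\<alpha> c = F (pA \<alpha> + pB \<alpha>) c"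
proof -
  obtain a b where ab: "a \<in> A" "b \<in> B" "c = a + b" using decompose \<open>c \<in> C\<close> by blast
  have aC: "a \<in> C" and bC: "b \<in> C" using ab A_C B_C by blast+
  have "\<alpha> a = (\<Sum>k\<in>K. F a (v k) * \<alpha> (u k))"
    by (subst expand_A[OF ab(1)])
      (use \<alpha> u_C in \<open>simp add: dual_sum dual_scale C_scale\<close>)
  also have "\<dots> = F (pB \<alpha>) a"
    unfolding pB_def using aC v_C by (simp add: F_sum F_scale C_scale F_sym[OF aC] mult.commute)
  finally have 1: "\<alpha> a = F (pB \<alpha>) a" .
  have "\<alpha> b = (\<Sum>k\<in>K. F (u k) b * \<alpha> (v k))"
    by (subst expand_B[OF ab(2)])
      (use \<alpha> v_C in \<open>simp add: dual_sum dual_scale C_scale\<close>)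
  also have "\<dots> = F (pA \<alpha>) b"
    unfolding pA_def using bC u_C by (simp add: F_sum F_scale C_scale mult.commute)
  finally have 2: "\<alpha> b = F (pA \<alpha>) b" .
  show ?thesis
    using 1 2 \<alpha> aC bC ab A_isotropic[OF pA_A ab(1)] B_isotropic[OF pB_B ab(2)]
    by (simp add: dual_add F_add F_add_right pA_C pB_C C_add)
qed

lemma pA_unique:
  assumes "a \<in> A" "b \<in> B" "\<And>k. k \<in> K \<Longrightarrow> \<alpha> (v k) = F (a + b) (v k)"
  shows "pA \<alpha> = a"
proof -
  have "F (a + b) (v k) = F a (v k)" if "k \<in> K" for k
    using that assms A_C B_C v_C[OF that] B_isotropic[OF assms(2) v_B[OF that]] by (simp add: F_add subset_iff)
  then show ?thesis unfolding pA_def using expand_A[OF assms(1)] assms(3) by simp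
qed

lemma pB_unique:
  assumes "a \<in> A" "b \<in> B" "\<And>k. k \<in> K \<Longrightarrow> \<alpha> (u k) = F (a + b) (u k)"
  shows "pB \<alpha> = b"
proof -
  have "F (a + b) (u k) = F (u k) b" if "k \<in> K" for k
    using that assms A_C B_C u_C[OF that] A_isotropic[OF assms(1) u_A[OF that]]
    by (simp add: F_add F_sym subset_iff)
  then show ?thesis unfolding pB_def using expand_B[OF assms(2)] assms(3) by simp
qed

abbreviation \<delta> :: "'v \<Rightarrow> ('k, 'v) tensor2" where "\<delta> \<equiv> coboundary L (tensor_sum K u v)"

lemma cobracket_apply:
  assumes "a \<in> C" "\<alpha> \<in> dual_space L" "\<beta> \<in> dual_space L"
  shows "\<delta> a \<alpha> \<beta> = \<alpha> (br a (pA \<beta>)) + \<beta> (br a (pB \<alpha>))"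
  unfolding pA_def pB_def using assms u_C v_C by (rule coboundary_tensor_sum)

text \<open>
  Invariance moves both brackets to the side of \<open>a\<close>, and the mixed brackets of components in \<open>A\<close> and
  \<open>B\<close> cancel. Thus, under the identification of \<open>L\<close> with its dual, the bracket dual to the cobracket
  makes the dual the direct sum of the Lie algebra \<open>B\<close> and the opposite of the Lie algebra \<open>A\<close>.
\<close>

lemma cobracket_form:
  assumes a: "a \<in> C" and \<alpha>: "\<alpha> \<in> dual_space L" and \<beta>: "\<beta> \<in> dual_space L"
  shows "\<delta> a \<alpha> \<beta> = F a (br (pB \<alpha>) (pB \<beta>) - br (pA \<alpha>) (pA \<beta>))"
proof -
  have inv: "\<theta> (br a y) = F (br y (pA \<theta> + pB \<theta>)) a" if \<theta>: "\<theta> \<in> dual_space L" and y: "y \<in> C" for \<theta> y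
  proof -
    have "F (pA \<theta> + pB \<theta>) (br a y) = - F (pA \<theta> + pB \<theta>) (br y a)"
      using a y bracket_anticomm[of y a] F_scale_right[of "br y a" "pA \<theta> + pB \<theta>" "- 1"]
      by (simp add: pA_C pB_C C_bracket C_add)
    also have "\<dots> = F (br y (pA \<theta> + pB \<theta>)) a"
      using F_inv[of y "pA \<theta> + pB \<theta>" a] a y by (intro minus_unique) (simp add: pA_C pB_C C_add add.commute)
    finally show ?thesis using dual_rep[OF \<theta>] a y by (simp add: C_bracket)
  qed
  have "\<alpha> (br a (pA \<beta>)) = F (br (pA \<beta>) (pA \<alpha> + pB \<alpha>)) a" by (rule inv[OF \<alpha> pA_C])
  moreover have "\<beta> (br a (pB \<alpha>)) = F (br (pB \<alpha>) (pA \<beta> + pB \<beta>)) a" by (rule inv[OF \<beta> pB_C])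
  moreover have "br (pA \<beta>) (pA \<alpha> + pB \<alpha>) = - br (pA \<alpha>) (pA \<beta>) - br (pB \<alpha>) (pA \<beta>)"
    using bracket_anticomm[OF pA_C pA_C, of \<beta> \<alpha>] bracket_anticomm[OF pB_C pA_C, of \<beta> \<alpha>]
    by (simp add: bracket_add_right pA_C pB_C)
  moreover have "br (pB \<alpha>) (pA \<beta> + pB \<beta>) = br (pB \<alpha>) (pA \<beta>) + br (pB \<alpha>) (pB \<beta>)"
    by (simp add: bracket_add_right pA_C pB_C)
  ultimately show ?thesis using cobracket_apply[OF assms] a
    by (simp add: F_add F_diff F_neg pA_C pB_C C_bracket C_neg C_diff F_sym[OF a])
qed

lemma pA_linear: "pA (\<alpha> + \<beta>) = pA \<alpha> + pA \<beta>" "pA (fscale s \<alpha>) = scl s (pA \<alpha>)"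
  and pB_linear: "pB (\<alpha> + \<beta>) = pB \<alpha> + pB \<beta>" "pB (fscale s \<alpha>) = scl s (pB \<alpha>)"
  by (simp_all add: pA_def pB_def fscale_def V.scale_left_distrib sum.distrib V.scale_sum_right)

definition dual_bracket :: "('v \<Rightarrow> 'k) \<Rightarrow> ('v \<Rightarrow> 'k) \<Rightarrow> 'v \<Rightarrow> 'k" where
  "dual_bracket \<alpha> \<beta> = restrict0 C (\<lambda>a. \<delta> a \<alpha> \<beta>)"

lemma dual_bracket_apply:
  "a \<in> C \<Longrightarrow> \<alpha> \<in> dual_space L \<Longrightarrow> \<beta> \<in> dual_space L \<Longrightarrow>
   dual_bracket \<alpha> \<beta> a = F (br (pB \<alpha>) (pB \<beta>) - br (pA \<alpha>) (pA \<beta>)) a"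
  by (simp add: dual_bracket_def restrict0_def cobracket_form F_sym pA_C pB_C C_bracket C_diff)

lemma dual_bracket_in_dual:
  "\<alpha> \<in> dual_space L \<Longrightarrow> \<beta> \<in> dual_space L \<Longrightarrow> dual_bracket \<alpha> \<beta> \<in> dual_space L"
  unfolding dual_bracket_def
  by (rule restrict0_in_dual)
    (simp_all add: cobracket_form F_add F_scale pA_C pB_C C_bracket C_diff C_add C_scale)

lemma pA_dual_bracket:
  assumes "\<alpha> \<in> dual_space L" "\<beta> \<in> dual_space L"
  shows "pA (dual_bracket \<alpha> \<beta>) = - br (pA \<alpha>) (pA \<beta>)"
  by (rule pA_unique[where b = "br (pB \<alpha>) (pB \<beta>)"])
    (use assms in \<open>simp_all add: V.subspace_neg[OF A_subspace] A_bracket B_bracket pA_A pB_B dual_bracket_apply v_C\<close>)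

lemma pB_dual_bracket:
  assumes "\<alpha> \<in> dual_space L" "\<beta> \<in> dual_space L"
  shows "pB (dual_bracket \<alpha> \<beta>) = br (pB \<alpha>) (pB \<beta>)"
  by (rule pB_unique[where a = "- br (pA \<alpha>) (pA \<beta>)"])
    (use assms in \<open>simp_all add: V.subspace_neg[OF A_subspace] A_bracket B_bracket pA_A pB_B dual_bracket_apply u_C\<close>)

lemma dual_eqI:
  assumes "\<alpha> \<in> dual_space L" "\<beta> \<in> dual_space L" "pA \<alpha> = pA \<beta>" "pB \<alpha> = pB \<beta>"
  shows "\<alpha> = \<beta>"
  using assms by (intro dual_ext) (simp_all add: dual_rep)

text \<open>
  A functional is determined by its two components, and on them the dual bracket is, up to a sign,
  the bracket of \<open>A\<close> and of \<open>B\<close>; so the axioms hold componentwise.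
\<close>

lemma lie_algebra_dual: "lie_algebra (dual_lie L \<delta>)"
proof -
  interpret W: vector_space "fscale :: 'k \<Rightarrow> ('v \<Rightarrow> 'k) \<Rightarrow> 'v \<Rightarrow> 'k" by (rule vector_space_fscale)
  have sub: "W.subspace (dual_space L)"
    unfolding W.subspace_def using dual_plus dual_fscale by (auto simp: dual_space_def)
  define f where "f a = restrict0 C (F a)" for a
  have f: "f a \<in> dual_space L" if "a \<in> C" for a
    unfolding f_def using that by (intro restrict0_in_dual) (simp_all add: F_add_right F_scale_right)
  let ?S = "f ` (u ` K \<union> v ` K)"
  have "W.span ?S = dual_space L"
  proof
    show "W.span ?S \<subseteq> dual_space L"
      using sub f u_C v_C by (intro W.span_minimal) auto
    show "dual_space L \<subseteq> W.span ?S"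
    proof
      fix \<alpha> assume \<alpha>: "\<alpha> \<in> dual_space L"
      let ?\<beta> = "(\<Sum>k\<in>K. fscale (\<alpha> (v k)) (f (u k))) + (\<Sum>k\<in>K. fscale (\<alpha> (u k)) (f (v k)))"
      have span: "?\<beta> \<in> W.span ?S"
        by (intro W.span_add W.span_sum W.span_scale W.span_base) auto
      have "\<alpha> = ?\<beta>"
      proof (rule dual_ext[OF \<alpha>])
        show "?\<beta> \<in> dual_space L"
          using f u_C v_C by (intro W.subspace_add[OF sub] W.subspace_sum[OF sub] W.subspace_scale[OF sub]) auto
        fix a assume a: "a \<in> C"
        have app: "(\<Sum>k\<in>K. g k) a = (\<Sum>k\<in>K. g k a)" for g :: "'b \<Rightarrow> 'v \<Rightarrow> 'k"
          by (induction K rule: infinite_finite_induct) simp_all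
        show "\<alpha> a = ?\<beta> a"
          using a u_C v_C
          by (simp add: dual_rep[OF \<alpha> a] F_add pA_C pB_C app fscale_def f_def restrict0_def)
            (simp add: pA_def pB_def F_sum F_scale C_scale)
      qed
      then show "\<alpha> \<in> W.span ?S" using span by simp
    qed
  qed
  moreover have "finite ?S" using finite_K by simp
  ultimately have fin: "\<exists>S. finite S \<and> W.span S = dual_space L" by blast
  note simps = dual_plus dual_fscale dual_bracket_in_dual pA_linear pB_linear pA_dual_bracket
    pB_dual_bracket pA_C pB_C bracket_add_left bracket_add_right bracket_scale_left bracket_scale_right
  have bil: "dual_bracket (\<alpha> + \<beta>) \<gamma> = dual_bracket \<alpha> \<gamma> + dual_bracket \<beta> \<gamma> \<and>
      dual_bracket \<gamma> (\<alpha> + \<beta>) = dual_bracket \<gamma> \<alpha> + dual_bracket \<gamma> \<beta> \<and>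
      dual_bracket (fscale s \<alpha>) \<beta> = fscale s (dual_bracket \<alpha> \<beta>) \<and>
      dual_bracket \<alpha> (fscale s \<beta>) = fscale s (dual_bracket \<alpha> \<beta>)"
    if "\<alpha> \<in> dual_space L" "\<beta> \<in> dual_space L" "\<gamma> \<in> dual_space L" for \<alpha> \<beta> \<gamma> s
    using that by (intro conjI; intro dual_eqI) (simp_all add: simps)
  have zero: "(0 :: 'v \<Rightarrow> 'k) \<in> dual_space L" by (simp add: dual_space_def)
  have p0: "pA 0 = 0" "pB 0 = 0" by (simp_all add: pA_def pB_def)
  have self: "dual_bracket \<alpha> \<alpha> = 0" if "\<alpha> \<in> dual_space L" for \<alpha>
    using that by (intro dual_eqI) (simp_all add: simps bracket_self p0 zero)
  have jac: "dual_bracket \<alpha> (dual_bracket \<beta> \<gamma>) + dual_bracket \<beta> (dual_bracket \<gamma> \<alpha>)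
      + dual_bracket \<gamma> (dual_bracket \<alpha> \<beta>) = 0"
    if "\<alpha> \<in> dual_space L" "\<beta> \<in> dual_space L" "\<gamma> \<in> dual_space L" for \<alpha> \<beta> \<gamma>
    using that by (intro dual_eqI)
      (simp_all add: simps jacobi p0 zero bracket_neg_right C_bracket)
  have eq: "dual_lie L \<delta> = \<lparr>lcarrier = dual_space L, lscale = fscale, lbracket = dual_bracket\<rparr>"
    by (simp add: dual_lie_def dual_bracket_def fun_eq_iff)
  show ?thesis
    unfolding lie_algebra_def eq lie_alg.select_convs
  proof (intro conjI ballI allI)
    show "vector_space (fscale :: 'k \<Rightarrow> ('v \<Rightarrow> 'k) \<Rightarrow> 'v \<Rightarrow> 'k)" by (rule vector_space_fscale)
  qed (use sub fin bil dual_bracket_in_dual self jac in simp_all)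
qed

proposition lie_bialgebra_coboundary: "lie_bialgebra L \<delta>"
proof -
  note simps = dual_plus dual_fscale cobracket_form pA_linear pB_linear pA_C pB_C bracket_add_left
    bracket_scale_left F_add F_scale F_add_right F_scale_right C_bracket C_diff C_add C_scale
  have "\<delta> a (\<alpha> + \<beta>) \<gamma> = \<delta> a \<alpha> \<gamma> + \<delta> a \<beta> \<gamma> \<and> \<delta> a (fscale s \<alpha>) \<beta> = s * \<delta> a \<alpha> \<beta> \<and> \<delta> a \<beta> \<alpha> = - \<delta> a \<alpha> \<beta>"
    if a: "a \<in> C" and d: "\<alpha> \<in> dual_space L" "\<beta> \<in> dual_space L" "\<gamma> \<in> dual_space L" for a \<alpha> \<beta> \<gamma> s
  proof (intro conjI)
    have "br (pB \<alpha> + pB \<beta>) (pB \<gamma>) - br (pA \<alpha> + pA \<beta>) (pA \<gamma>) =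
        (br (pB \<alpha>) (pB \<gamma>) - br (pA \<alpha>) (pA \<gamma>)) + (br (pB \<beta>) (pB \<gamma>) - br (pA \<beta>) (pA \<gamma>))"
      by (simp add: simps)
    then show "\<delta> a (\<alpha> + \<beta>) \<gamma> = \<delta> a \<alpha> \<gamma> + \<delta> a \<beta> \<gamma>" using a d by (simp only: simps)
    have "br (scl s (pB \<alpha>)) (pB \<beta>) - br (scl s (pA \<alpha>)) (pA \<beta>) = scl s (br (pB \<alpha>) (pB \<beta>) - br (pA \<alpha>) (pA \<beta>))"
      by (simp add: simps V.scale_right_diff_distrib)
    then show "\<delta> a (fscale s \<alpha>) \<beta> = s * \<delta> a \<alpha> \<beta>" using a d by (simp only: simps)
    have "br (pB \<beta>) (pB \<alpha>) - br (pA \<beta>) (pA \<alpha>) = scl (- 1) (br (pB \<alpha>) (pB \<beta>) - br (pA \<alpha>) (pA \<beta>))"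
      using bracket_anticomm[OF pB_C pB_C, of \<beta> \<alpha>] bracket_anticomm[OF pA_C pA_C, of \<beta> \<alpha>] by simp
    then have "\<delta> a \<beta> \<alpha> = - 1 * \<delta> a \<alpha> \<beta>" using a d by (simp only: simps)
    then show "\<delta> a \<beta> \<alpha> = - \<delta> a \<alpha> \<beta>" by simp
  qed
  then have "\<forall>a\<in>C. skew_tensor L (\<delta> a)" unfolding skew_tensor_def by blast
  moreover have "\<delta> (a + b) \<alpha> \<beta> = \<delta> a \<alpha> \<beta> + \<delta> b \<alpha> \<beta> \<and> \<delta> (scl s a) \<alpha> \<beta> = s * \<delta> a \<alpha> \<beta>"
    if "a \<in> C" "b \<in> C" "\<alpha> \<in> dual_space L" "\<beta> \<in> dual_space L" for a b \<alpha> \<beta> s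
    using that by (simp add: simps)
  moreover have "\<delta> (br a b) \<alpha> \<beta> = ad_tensor L a (\<delta> b) \<alpha> \<beta> - ad_tensor L b (\<delta> a) \<alpha> \<beta>"
    if "a \<in> C" "b \<in> C" "\<alpha> \<in> dual_space L" "\<beta> \<in> dual_space L" for a b \<alpha> \<beta>
    using that u_C v_C by (rule coboundary_cocycle)
  ultimately show ?thesis
    unfolding lie_bialgebra_def using lie lie_algebra_dual by blast
qed

end

section \<open>The double and its powers as Manin triples\<close>

lemma lie_algebra_power:
  assumes "lie_algebra D"
  shows "lie_algebra (power_lie D n)"
proof -
  interpret D: lie_alg_on D using assms by unfold_locales
  let ?C = "lcarrier (power_lie D n)" and ?s = "lscale (power_lie D n)"
  have s: "?s = (\<lambda>s a j. D.scl s (a j))" by (simp add: power_lie_def)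
  have C: "?C = {a. (\<forall>j\<in>{1..n}. a j \<in> D.C) \<and> (\<forall>j. j \<notin> {1..n} \<longrightarrow> a j = 0)}" by (simp add: power_lie_def)
  interpret W: vector_space ?s
    unfolding s
    by unfold_locales (auto simp: fun_eq_iff D.V.scale_right_distrib D.V.scale_left_distrib)
  have sub: "W.subspace ?C"
    unfolding W.subspace_def unfolding C s by (auto simp: D.C_add D.C_scale D.C_0)
  obtain S where S: "finite S" "D.V.span S = D.C" using D.finite_span_C by blast
  define single where "single j b = (\<lambda>i. if i = j then b else 0)" for j :: nat and b :: 'b
  let ?T = "\<Union>j\<in>{1..n}. single j ` S"
  have "W.span ?T = ?C"
  proof
    have "S \<subseteq> D.C" using D.V.span_superset S by blast
    then have "?T \<subseteq> ?C" unfolding C single_def by (auto simp: D.C_0)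
    then show "W.span ?T \<subseteq> ?C" using sub by (rule W.span_minimal)
    show "?C \<subseteq> W.span ?T"
    proof
      fix a assume a: "a \<in> ?C"
      have "single j b \<in> W.span ?T" if j: "j \<in> {1..n}" and b: "b \<in> D.V.span S" for j b
        using b
      proof (induction rule: D.V.span_induct_alt)
        case base
        have "single j 0 = 0" by (simp add: single_def fun_eq_iff)
        then show ?case by (simp only: W.span_zero)
      next
        case (step c x y)
        have "single j (D.scl c x + y) = ?s c (single j x) + single j y"
          by (simp add: single_def fun_eq_iff s)
        moreover have "single j x \<in> W.span ?T" using step(1) j by (intro W.span_base) auto
        ultimately show ?case using step(2) by (simp only: W.span_add W.span_scale)
      qed
      then have "(\<Sum>j = 1..n. single j (a j)) \<in> W.span ?T"
        using a S(2) unfolding C by (intro W.span_sum) auto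
      moreover have "(\<Sum>j = 1..n. single j (a j)) = a"
        using a unfolding C by (auto simp: fun_eq_iff sum_fun_apply single_def sum.delta')
      ultimately show "a \<in> W.span ?T" by simp
    qed
  qed
  moreover have "finite ?T" using S by simp
  ultimately have fin: "\<exists>T. finite T \<and> W.span T = ?C" by blast
  note simps = power_lie_def D.C_bracket D.bracket_add_left D.bracket_add_right D.bracket_scale_left
    D.bracket_scale_right D.bracket_self D.jacobi
  show ?thesis
    unfolding lie_algebra_def
    by (intro conjI W.vector_space_axioms sub fin) (simp_all add: simps fun_eq_iff)
qed

text \<open>
  The alternating sums telescope. With the pairings of the entries of two elements for \<open>f\<close>, they show
  that the two subalgebras \<open>lagr_g\<close> and \<open>lagr_gstar\<close> are isotropic for the alternating form.
\<close>

lemma alternating_sum_odd_pairs: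
  fixes f :: "nat \<Rightarrow> 'a::comm_ring_1"
  assumes "\<And>i. i \<in> {1..<n} \<Longrightarrow> odd i \<Longrightarrow> f i = f (i + 1)"
  shows "(\<Sum>j = 1..n. (- 1) ^ (j + 1) * f j) = (if odd n then f n else 0)"
  using assms
proof (induction n)
  case (Suc n)
  have IH: "(\<Sum>j = 1..n. (- 1) ^ (j + 1) * f j) = (if odd n then f n else 0)"
    using Suc.prems by (intro Suc.IH) auto
  have "f n = f (Suc n)" if "odd n" using Suc.prems[of n] that odd_pos[of n] by (auto simp: Suc_eq_plus1)
  then show ?case using IH by auto
qed simp

lemma alternating_sum_even_pairs:
  fixes f :: "nat \<Rightarrow> 'a::comm_ring_1"
  assumes "\<And>i. i \<in> {1..<n} \<Longrightarrow> even i \<Longrightarrow> f i = f (i + 1)" and "n \<ge> 1"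
  shows "(\<Sum>j = 1..n. (- 1) ^ (j + 1) * f j) = f 1 - (if even n then f n else 0)"
  using assms(2,1)
proof (induction n rule: dec_induct)
  case base
  then show ?case by simp
next
  case (step n)
  have IH: "(\<Sum>j = 1..n. (- 1) ^ (j + 1) * f j) = f 1 - (if even n then f n else 0)"
    using step.prems by (intro step.IH) auto
  have "f n = f (Suc n)" if "even n" using step.prems[of n] step.hyps that by (auto simp: Suc_eq_plus1)
  then show ?case using IH step.hyps by auto
qed

lemma manin_triple_double:
  fixes m :: nat
  assumes bi: "lie_bialgebra G \<delta>" and dbl: "is_double G \<delta> D"
    and bx: "is_basis (lscale G) (lcarrier G) {1..m} x"
    and b\<xi>: "is_basis fscale (dual_space G) {1..m} \<xi>"
    and du: "dual_wrt (\<lambda>a \<alpha>. \<alpha> a) {1..m} x \<xi>"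
  shows "manin_triple D double_form (g_part D) (gstar_part D) {1..m} (\<lambda>i. (x i, 0)) (\<lambda>i. (0, \<xi> i))"
proof -
  have "lie_algebra G" "lie_algebra (dual_lie G \<delta>)" using bi unfolding lie_bialgebra_def by blast+
  then interpret G: lie_alg_on G by unfold_locales
  have Gd: "lbracket (dual_lie G \<delta>) \<alpha> \<beta> \<in> dual_space G" if "\<alpha> \<in> dual_space G" "\<beta> \<in> dual_space G" for \<alpha> \<beta>
    using \<open>lie_algebra (dual_lie G \<delta>)\<close> that unfolding lie_algebra_def dual_lie_def by simp
  have C: "lcarrier D = lcarrier G \<times> dual_space G"
    and s: "lscale D = (\<lambda>s (x, \<xi>). (lscale G s x, fscale s \<xi>))"
    and "lie_algebra D"
    using dbl unfolding is_double_def by blast+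
  then interpret D: lie_alg_on D by unfold_locales
  interpret W: vector_space "fscale :: 'a \<Rightarrow> ('b \<Rightarrow> 'a) \<Rightarrow> 'b \<Rightarrow> 'a" by (rule vector_space_fscale)
  have bA: "lbracket D (a, 0) (b, 0) = (lbracket G a b, 0)" if "a \<in> lcarrier G" "b \<in> lcarrier G" for a b
    using dbl that unfolding is_double_def by blast
  have bB: "lbracket D (0, \<alpha>) (0, \<beta>) = (0, lbracket (dual_lie G \<delta>) \<alpha> \<beta>)"
    if "\<alpha> \<in> dual_space G" "\<beta> \<in> dual_space G" for \<alpha> \<beta>
    using dbl that unfolding is_double_def by blast
  have zero: "(0 :: 'b \<Rightarrow> 'a) \<in> dual_space G" by (simp add: dual_space_def)
  have Wsub: "W.subspace (dual_space G)"
    unfolding W.subspace_def using G.dual_plus G.dual_fscale zero by blast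
  have f0: "fscale t (0 :: 'b \<Rightarrow> 'a) = 0" for t by (simp add: fscale_def fun_eq_iff)
  have gA: "g_part D = {(a, 0) | a. a \<in> lcarrier G}" and gB: "gstar_part D = {(0, \<alpha>) | \<alpha>. \<alpha> \<in> dual_space G}"
    unfolding g_part_def gstar_part_def C using zero G.C_0 by auto
  have xC: "x k \<in> lcarrier G" if "k \<in> {1..m}" for k
    using bx that G.V.span_superset[of "x ` {1..m}"] unfolding is_basis_def by blast
  have \<xi>C: "\<xi> k \<in> dual_space G" if "k \<in> {1..m}" for k
    using b\<xi> that W.span_superset[of "\<xi> ` {1..m}"] unfolding is_basis_def by blast
  have dual: "\<xi> k (x l) = (if k = l then 1 else 0)" if "k \<in> {1..m}" "l \<in> {1..m}" for k l
    using du that unfolding dual_wrt_def by auto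
  have xg: "a = (\<Sum>k = 1..m. lscale G (\<xi> k a) (x k))" if "a \<in> lcarrier G" for a
    by (rule G.V.expand_in_dual_basis[where S = "lcarrier G"])
      (use bx that xC \<xi>C dual G.subspace_C in \<open>auto simp: is_basis_def G.dual_add G.dual_scale\<close>)
  have xa: "\<alpha> = (\<Sum>k = 1..m. fscale (\<alpha> (x k)) (\<xi> k))" if "\<alpha> \<in> dual_space G" for \<alpha>
    by (rule W.expand_in_dual_basis[where S = "dual_space G" and \<phi> = "\<lambda>k \<alpha>. \<alpha> (x k)"])
      (use b\<xi> that \<xi>C dual Wsub in \<open>auto simp: is_basis_def fscale_def\<close>)
  show ?thesis
  proof unfold_locales
    fix a b c assume "a \<in> lcarrier D" "b \<in> lcarrier D" "c \<in> lcarrier D"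
    then show "double_form (a + b) c = double_form a c + double_form b c"
      "double_form (lbracket D a b) c + double_form b (lbracket D a c) = 0"
      using dbl unfolding is_double_def by (auto simp: C double_form_def G.dual_add)
  next
    fix a b t assume "a \<in> lcarrier D" "b \<in> lcarrier D"
    then show "double_form (lscale D t a) b = t * double_form a b"
      by (auto simp: C s double_form_def G.dual_scale fscale_def algebra_simps)
  next
    fix a b assume "a \<in> g_part D" "b \<in> g_part D"
    then show "lbracket D a b \<in> g_part D" by (auto simp: gA bA G.C_bracket)
  next
    fix a b assume "a \<in> gstar_part D" "b \<in> gstar_part D"
    then show "lbracket D a b \<in> gstar_part D" by (auto simp: gB bB Gd)
  next
    fix a b assume "a \<in> gstar_part D" "b \<in> gstar_part D"
    then show "double_form a b = 0" by (auto simp: gB double_form_def G.dual_0)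
  next
    show "D.V.subspace (g_part D)"
      unfolding D.V.subspace_def by (auto simp: gA s f0 G.C_add G.C_scale G.C_0 zero_prod_def)
    show "D.V.subspace (gstar_part D)"
      unfolding D.V.subspace_def by (auto simp: gB s zero G.dual_plus G.dual_fscale zero_prod_def)
  next
    fix a assume "a \<in> g_part D"
    then obtain g where g: "a = (g, 0)" "g \<in> lcarrier G" by (auto simp: gA)
    have "(\<Sum>k = 1..m. lscale D (double_form a (0, \<xi> k)) (x k, 0)) = (\<Sum>k = 1..m. (lscale G (\<xi> k g) (x k), 0))"
      by (intro sum.cong refl) (simp add: g s f0 double_form_def)
    also have "\<dots> = a" using xg[OF g(2)] by (simp add: sum_prod g)
    finally show "a = (\<Sum>k = 1..m. lscale D (double_form a (0, \<xi> k)) (x k, 0))" by (rule sym)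
  next
    fix a assume "a \<in> gstar_part D"
    then obtain \<alpha> where g: "a = (0, \<alpha>)" "\<alpha> \<in> dual_space G" by (auto simp: gB)
    have "(\<Sum>k = 1..m. lscale D (double_form (x k, 0) a) (0, \<xi> k)) = (\<Sum>k = 1..m. (0, fscale (\<alpha> (x k)) (\<xi> k)))"
      by (intro sum.cong refl) (simp add: g s double_form_def)
    also have "\<dots> = a" using xa[OF g(2)] by (simp add: sum_prod g)
    finally show "a = (\<Sum>k = 1..m. lscale D (double_form (x k, 0) a) (0, \<xi> k))" by (rule sym)
  next
    fix c assume "c \<in> lcarrier D"
    then have "(fst c, 0) \<in> g_part D" "(0, snd c) \<in> gstar_part D" "c = (fst c, 0) + (0, snd c)"
      by (auto simp: gA gB C)
    then show "\<exists>a\<in>g_part D. \<exists>b\<in>gstar_part D. c = a + b" by blast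
  qed (use xC \<xi>C in \<open>auto simp: gA gB C zero G.C_0 double_form_def add.commute\<close>)
qed

locale double_triple = manin_triple D double_form "g_part D" "gstar_part D" K x\<^sub>D \<xi>\<^sub>D
  for D :: "('k::field, 'g::ab_group_add \<times> ('g \<Rightarrow> 'k)) lie_alg" and K :: "'b set" and x\<^sub>D \<xi>\<^sub>D
begin

text \<open>
  The entry in position \<open>j\<close> of the contraction of the mixed term with the functional on the factor
  \<open>e\<close> that is represented by \<open>a + b\<close>, with \<open>a\<close> in the Lie algebra and \<open>b\<close> in its dual.
\<close>

definition shift :: "nat \<Rightarrow> 'g \<times> ('g \<Rightarrow> 'k) \<Rightarrow> 'g \<times> ('g \<Rightarrow> 'k) \<Rightarrow> nat \<Rightarrow> 'g \<times> ('g \<Rightarrow> 'k)" where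
  "shift e a b j = (if e < j then a else if j < e then - b else 0)"

abbreviation attached :: "(('g \<times> ('g \<Rightarrow> 'k)) \<Rightarrow> 'k) \<Rightarrow> nat \<Rightarrow> nat \<Rightarrow> 'g \<times> ('g \<Rightarrow> 'k)" where
  "attached \<alpha> e \<equiv> shift e (pA \<alpha>) (pB \<alpha>)"

lemma attached_C: "attached \<alpha> e j \<in> C"
  by (simp add: shift_def pA_C pB_C C_neg C_0)

lemma dual_A_bracket:
  assumes "\<gamma> \<in> dual_space D" "a \<in> g_part D" "b \<in> g_part D"
  shows "\<gamma> (br a b) = double_form (pB \<gamma>) (br a b)"
proof -
  have ab: "a \<in> C" "b \<in> C" "br a b \<in> g_part D" using assms A_C A_bracket by blast+
  then show ?thesis
    using assms(1) A_isotropic[OF pA_A ab(3)] by (simp add: dual_rep F_add pA_C pB_C C_bracket)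
qed

lemma dual_B_bracket:
  assumes "\<gamma> \<in> dual_space D" "a \<in> gstar_part D" "b \<in> gstar_part D"
  shows "\<gamma> (br a b) = double_form (pA \<gamma>) (br a b)"
proof -
  have ab: "a \<in> C" "b \<in> C" "br a b \<in> gstar_part D" using assms B_C B_bracket by blast+
  then show ?thesis
    using assms(1) B_isotropic[OF pB_B ab(3)] by (simp add: dual_rep F_add pA_C pB_C C_bracket)
qed

lemma cobracket_neg_pB:
  assumes "\<alpha> \<in> dual_space D" "\<beta> \<in> dual_space D" "\<gamma> \<in> dual_space D"
  shows "\<delta> (- pB \<gamma>) \<alpha> \<beta> = \<gamma> (br (pA \<alpha>) (pA \<beta>))"
proof -
  have "double_form (pB \<gamma>) (br (pB \<alpha>) (pB \<beta>)) = 0" by (intro B_isotropic B_bracket pB_B)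
  then show ?thesis
    using assms by (simp add: cobracket_form F_neg pA_C pB_C C_neg C_bracket C_diff dual_A_bracket pA_A
        F_sym[of "pB \<gamma>"] F_diff)
qed

lemma cobracket_pA:
  assumes "\<alpha> \<in> dual_space D" "\<beta> \<in> dual_space D" "\<gamma> \<in> dual_space D"
  shows "\<delta> (pA \<gamma>) \<alpha> \<beta> = \<gamma> (br (pB \<alpha>) (pB \<beta>))"
proof -
  have "double_form (pA \<gamma>) (br (pA \<alpha>) (pA \<beta>)) = 0" by (intro A_isotropic A_bracket pA_A)
  then show ?thesis
    using assms by (simp add: cobracket_form pA_C pB_C C_neg C_bracket C_diff dual_B_bracket pB_B
        F_sym[of "pA \<gamma>"] F_diff)
qed

text \<open>
  The right hand side is the sum of the pairings of the bracket with the two components of \<open>\<beta>\<close>; by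
  invariance these are the two terms on the left.
\<close>

lemma mixed_bracket_identity:
  assumes "\<alpha> \<in> dual_space D" "\<beta> \<in> dual_space D" "\<gamma> \<in> dual_space D"
  shows "\<gamma> (br (pA \<alpha>) (pA \<beta>)) + \<alpha> (br (pB \<beta>) (pB \<gamma>)) = \<beta> (br (pB \<gamma>) (pA \<alpha>))"
proof -
  have "\<beta> (br (pB \<gamma>) (pA \<alpha>)) = double_form (pA \<beta>) (br (pB \<gamma>) (pA \<alpha>)) + double_form (pB \<beta>) (br (pB \<gamma>) (pA \<alpha>))"
    using assms by (simp add: dual_rep F_add pA_C pB_C C_bracket)
  also have "double_form (pA \<beta>) (br (pB \<gamma>) (pA \<alpha>)) = double_form (pB \<gamma>) (br (pA \<alpha>) (pA \<beta>))"
    using F_bracket[of "pA \<beta>" "pB \<gamma>" "pA \<alpha>"] F_bracket[of "pA \<alpha>" "pA \<beta>" "pB \<gamma>"]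
      F_sym[of "pB \<gamma>" "br (pA \<alpha>) (pA \<beta>)"] F_sym[of "pA \<alpha>" "br (pA \<beta>) (pB \<gamma>)"] by (simp add: pA_C pB_C C_bracket)
  also have "double_form (pB \<beta>) (br (pB \<gamma>) (pA \<alpha>)) = double_form (pA \<alpha>) (br (pB \<beta>) (pB \<gamma>))"
    using F_bracket[of "pB \<beta>" "pB \<gamma>" "pA \<alpha>"] F_sym[of "pA \<alpha>" "br (pB \<beta>) (pB \<gamma>)"] by (simp add: pA_C pB_C C_bracket)
  finally show ?thesis using assms by (simp add: dual_A_bracket dual_B_bracket pA_A pB_B)
qed

text \<open>
  One of the three cyclic terms of the Schouten square of a twisted bivector field, as a number
  that depends on three functionals on the factors \<open>e\<close>, \<open>f\<close>, \<open>h\<close>: the first summand comes from the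
  bracket of the twist with the direct product structure, the second one from the bracket of the
  twist with itself.
\<close>

definition twist_defect ::
  "(('g \<times> ('g \<Rightarrow> 'k)) \<Rightarrow> 'k) \<Rightarrow> nat \<Rightarrow> (('g \<times> ('g \<Rightarrow> 'k)) \<Rightarrow> 'k) \<Rightarrow> nat \<Rightarrow> (('g \<times> ('g \<Rightarrow> 'k)) \<Rightarrow> 'k) \<Rightarrow> nat \<Rightarrow> 'k" where
  "twist_defect \<alpha> e \<beta> f \<gamma> h =
     (if f = h then \<delta> (attached \<alpha> e f) \<beta> \<gamma> else 0) - \<gamma> (br (attached \<alpha> e h) (attached \<beta> f h))"

text \<open>
  The mixed term twists the direct product cobracket; the identity is the twist equation, evaluated
  on functionals each of which depends on a single factor. If exactly two of the factors agree, it
  says that the cobracket of the double restricts to plus or minus the cobrackets dual to the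
  brackets of the two halves; if all three differ, it is the invariance of the form.
\<close>

lemma twist_equation:
  assumes d: "\<alpha> \<in> dual_space D" "\<beta> \<in> dual_space D" "\<gamma> \<in> dual_space D"
  shows "twist_defect \<alpha> e \<beta> f \<gamma> h + twist_defect \<beta> f \<gamma> h \<alpha> e + twist_defect \<gamma> h \<alpha> e \<beta> f = 0"
proof -
  have D0: "\<delta> 0 \<alpha> \<beta> = 0" if "\<alpha> \<in> dual_space D" "\<beta> \<in> dual_space D" for \<alpha> \<beta>
    using that by (simp add: cobracket_form F_0 pA_C pB_C C_bracket C_diff C_0)
  note simps = twist_defect_def shift_def bracket_0_left bracket_0_right dual_0 D0 pA_C pB_C C_neg
    bracket_neg_left bracket_neg_right C_bracket dual_neg
  have two: "twist_defect \<alpha> e \<beta> f \<gamma> h + twist_defect \<beta> f \<gamma> h \<alpha> e + twist_defect \<gamma> h \<alpha> e \<beta> f = 0"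
    if "e = f" "f \<noteq> h" "\<alpha> \<in> dual_space D" "\<beta> \<in> dual_space D" "\<gamma> \<in> dual_space D" for \<alpha> \<beta> \<gamma> e f h
    using that cobracket_neg_pB[of \<alpha> \<beta> \<gamma>] cobracket_pA[of \<alpha> \<beta> \<gamma>]
    by (cases "f < h") (simp_all add: simps)
  have three: "twist_defect \<alpha> e \<beta> f \<gamma> h + twist_defect \<beta> f \<gamma> h \<alpha> e + twist_defect \<gamma> h \<alpha> e \<beta> f = 0"
    if "e < f" "e < h" "f \<noteq> h" "\<alpha> \<in> dual_space D" "\<beta> \<in> dual_space D" "\<gamma> \<in> dual_space D" for \<alpha> \<beta> \<gamma> e f h
  proof (cases "f < h")
    case True
    then show ?thesis using that mixed_bracket_identity[of \<alpha> \<beta> \<gamma>]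
      by (simp add: simps algebra_simps)
  next
    case False
    have "\<gamma> (br (pA \<alpha>) (pB \<beta>)) = - \<gamma> (br (pB \<beta>) (pA \<alpha>))" "\<alpha> (br (pB \<beta>) (pB \<gamma>)) = - \<alpha> (br (pB \<gamma>) (pB \<beta>))"
      "\<beta> (br (pA \<gamma>) (pA \<alpha>)) = - \<beta> (br (pA \<alpha>) (pA \<gamma>))"
      using bracket_anticomm[of "pB \<beta>" "pA \<alpha>"] bracket_anticomm[of "pB \<gamma>" "pB \<beta>"]
        bracket_anticomm[of "pA \<alpha>" "pA \<gamma>"] that by (simp_all add: dual_neg pA_C pB_C C_bracket)
    then show ?thesis using that False mixed_bracket_identity[of \<alpha> \<gamma> \<beta>]
      by (simp add: simps algebra_simps)
  qed
  \<comment> \<open>The sum is cyclic: rotate the equal pair, or the smallest factor, to the front.\<close>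
  consider "e = f" "f = h" | "e = f" "f \<noteq> h" | "f = h" "h \<noteq> e" | "h = e" "e \<noteq> f"
    | "e < f" "e < h" "f \<noteq> h" | "f < h" "f < e" "h \<noteq> e" | "h < e" "h < f" "e \<noteq> f"
    by linarith
  then show ?thesis
  proof cases
    case 1
    then show ?thesis using d by (simp add: simps C_0)
  next
    case 2
    then show ?thesis using two d by blast
  next
    case 3
    then show ?thesis using two[of f h e \<beta> \<gamma> \<alpha>] d by (simp add: add_ac)
  next
    case 4
    then show ?thesis using two[of h e f \<gamma> \<alpha> \<beta>] d by (simp add: add_ac)
  next
    case 5
    then show ?thesis using three d by blast
  next
    case 6
    then show ?thesis using three[of f h e \<beta> \<gamma> \<alpha>] d by (simp add: add_ac)
  next
    case 7
    then show ?thesis using three[of h e f \<gamma> \<alpha> \<beta>] d by (simp add: add_ac)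
  qed
qed

abbreviation PL :: "nat \<Rightarrow> ('k, nat \<Rightarrow> 'g \<times> ('g \<Rightarrow> 'k)) lie_alg" where "PL n \<equiv> power_lie D n"

lemma PL_C: "a \<in> lcarrier (PL n) \<longleftrightarrow> (\<forall>j\<in>{1..n}. a j \<in> C) \<and> (\<forall>j. j \<notin> {1..n} \<longrightarrow> a j = 0)"
  and PL_scale: "lscale (PL n) = (\<lambda>s a j. scl s (a j))"
  and PL_bracket: "j \<in> {1..n} \<Longrightarrow> lbracket (PL n) a b j = br (a j) (b j)"
  by (simp_all add: power_lie_def)

text \<open>
  The components along \<open>lagr_g\<close> and \<open>lagr_gstar\<close> of the element that has \<open>a + b\<close>, up to the sign
  that the form on the power carries at \<open>e\<close>, in position \<open>e\<close> and \<open>0\<close> elsewhere. Off the position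
  \<open>e\<close> they cancel.
\<close>

definition lagr_g_comp :: "nat \<Rightarrow> nat \<Rightarrow> 'g \<times> ('g \<Rightarrow> 'k) \<Rightarrow> 'g \<times> ('g \<Rightarrow> 'k) \<Rightarrow> nat \<Rightarrow> 'g \<times> ('g \<Rightarrow> 'k)" where
  "lagr_g_comp n e a b j = (if j \<notin> {1..n} then 0 else if j = e then (if odd e then a else - b) else shift e a b j)"

definition lagr_gstar_comp :: "nat \<Rightarrow> nat \<Rightarrow> 'g \<times> ('g \<Rightarrow> 'k) \<Rightarrow> 'g \<times> ('g \<Rightarrow> 'k) \<Rightarrow> nat \<Rightarrow> 'g \<times> ('g \<Rightarrow> 'k)" where
  "lagr_gstar_comp n e a b j = (if j \<notin> {1..n} then 0 else if j = e then (if odd e then b else - a) else - shift e a b j)"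

lemma lagr_g_comp_in:
  assumes "e \<in> {1..n}" "a \<in> g_part D" "b \<in> gstar_part D"
  shows "lagr_g_comp n e a b \<in> lagr_g D n"
proof -
  have "a \<in> C" "b \<in> C" using assms A_C B_C by blast+
  then have C: "lagr_g_comp n e a b \<in> lcarrier (PL n)"
    by (auto simp: PL_C lagr_g_comp_def shift_def C_neg C_0)
  have "lagr_g_comp n e a b i = lagr_g_comp n e a b (i + 1)" if "i \<in> {1..<n}" "odd i" for i
  proof -
    consider "i + 1 < e" | "i + 1 = e" | "i = e" | "e < i" by linarith
    then show ?thesis using that by cases (auto simp: lagr_g_comp_def shift_def)
  qed
  moreover have "lagr_g_comp n e a b n \<in> g_part D" if "odd n"
    using assms that by (auto simp: lagr_g_comp_def shift_def)
  ultimately show ?thesis using C unfolding lagr_g_def by blast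
qed

lemma lagr_gstar_comp_in:
  assumes "e \<in> {1..n}" "a \<in> g_part D" "b \<in> gstar_part D"
  shows "lagr_gstar_comp n e a b \<in> lagr_gstar D n"
proof -
  have "a \<in> C" "b \<in> C" using assms A_C B_C by blast+
  then have C: "lagr_gstar_comp n e a b \<in> lcarrier (PL n)"
    by (auto simp: PL_C lagr_gstar_comp_def shift_def C_neg C_0)
  have "lagr_gstar_comp n e a b i = lagr_gstar_comp n e a b (i + 1)" if "i \<in> {1..<n}" "even i" for i
  proof -
    consider "i + 1 < e" | "i + 1 = e" | "i = e" | "e < i" by linarith
    then show ?thesis using that by cases (auto simp: lagr_gstar_comp_def shift_def)
  qed
  moreover have "lagr_gstar_comp n e a b 1 \<in> gstar_part D"
    using assms by (auto simp: lagr_gstar_comp_def shift_def)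
  moreover have "lagr_gstar_comp n e a b n \<in> g_part D" if "even n"
    using assms that V.subspace_neg[OF A_subspace] by (auto simp: lagr_gstar_comp_def shift_def)
  ultimately show ?thesis using C unfolding lagr_gstar_def by blast
qed

lemma lagr_comp_sum:
  "e \<in> {1..n} \<Longrightarrow> lagr_g_comp n e a b j + lagr_gstar_comp n e a b j =
    (if j = e then (if odd e then a + b else - (a + b)) else 0)"
  by (auto simp: lagr_g_comp_def lagr_gstar_comp_def)

text \<open>
  An element of the power is the sum of its entries, placed one at a time, so complementarity of the
  two subalgebras follows from the decomposition of an element with a single entry.
\<close>

lemma manin_triple_power:
  fixes u v :: "nat \<Rightarrow> nat \<Rightarrow> 'g \<times> ('g \<Rightarrow> 'k)"
  assumes n: "n \<ge> 1"
    and bu: "is_basis (lscale (PL n)) (lagr_g D n) {1..N} u"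
    and bv: "is_basis (lscale (PL n)) (lagr_gstar D n) {1..N} v"
    and du: "dual_wrt (power_form n) {1..N} u v"
  shows "manin_triple (PL n) (power_form n) (lagr_g D n) (lagr_gstar D n) {1..N} u v"
proof -
  interpret P: lie_alg_on "PL n" using lie_algebra_power[OF lie] by unfold_locales
  have Fadd: "power_form n (a + b) c = power_form n a c + power_form n b c"
    if "a \<in> P.C" "b \<in> P.C" "c \<in> P.C" for a b c
    using that by (simp add: power_form_def PL_C F_add distrib_left sum.distrib)
  have Fscale: "power_form n (lscale (PL n) s a) b = s * power_form n a b"
    if "a \<in> P.C" "b \<in> P.C" for a b s
    using that by (simp add: power_form_def PL_C PL_scale F_scale sum_distrib_left mult_ac)
  have Fsym: "power_form n a b = power_form n b a" if "a \<in> P.C" "b \<in> P.C" for a b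
    using that by (auto simp: power_form_def PL_C F_sym intro!: sum.cong)
  have Finv: "power_form n (lbracket (PL n) a b) c + power_form n b (lbracket (PL n) a c) = 0"
    if "a \<in> P.C" "b \<in> P.C" "c \<in> P.C" for a b c
    using that F_inv
    by (simp add: power_form_def PL_C PL_bracket flip: sum.distrib distrib_left)
  have AC: "lagr_g D n \<subseteq> P.C" and BC: "lagr_gstar D n \<subseteq> P.C"
    unfolding lagr_g_def lagr_gstar_def by blast+
  have Asub: "P.V.subspace (lagr_g D n)"
    unfolding P.V.subspace_def lagr_g_def
    using P.C_0 P.C_add P.C_scale V.subspace_0[OF A_subspace] V.subspace_add[OF A_subspace] V.subspace_scale[OF A_subspace]
    by (auto simp: PL_scale)
  have Bsub: "P.V.subspace (lagr_gstar D n)"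
    unfolding P.V.subspace_def lagr_gstar_def
    using P.C_0 P.C_add P.C_scale V.subspace_0[OF A_subspace] V.subspace_add[OF A_subspace] V.subspace_scale[OF A_subspace]
      V.subspace_0[OF B_subspace] V.subspace_add[OF B_subspace] V.subspace_scale[OF B_subspace]
    by (auto simp: PL_scale)
  have Abr: "lbracket (PL n) a b \<in> lagr_g D n" if "a \<in> lagr_g D n" "b \<in> lagr_g D n" for a b
    using that n P.C_bracket A_bracket unfolding lagr_g_def by (auto simp: PL_bracket)
  have Bbr: "lbracket (PL n) a b \<in> lagr_gstar D n" if "a \<in> lagr_gstar D n" "b \<in> lagr_gstar D n" for a b
    using that n P.C_bracket A_bracket B_bracket unfolding lagr_gstar_def by (auto simp: PL_bracket)
  have Aiso: "power_form n a b = 0" if "a \<in> lagr_g D n" "b \<in> lagr_g D n" for a b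
  proof -
    have "power_form n a b = (if odd n then double_form (a n) (b n) else 0)"
      unfolding power_form_def
      by (rule alternating_sum_odd_pairs) (use that in \<open>auto simp: lagr_g_def\<close>)
    then show ?thesis using that A_isotropic unfolding lagr_g_def by auto
  qed
  have Biso: "power_form n a b = 0" if "a \<in> lagr_gstar D n" "b \<in> lagr_gstar D n" for a b
  proof -
    have "power_form n a b = double_form (a 1) (b 1) - (if even n then double_form (a n) (b n) else 0)"
      unfolding power_form_def
      by (rule alternating_sum_even_pairs) (use that n in \<open>auto simp: lagr_gstar_def\<close>)
    then show ?thesis using that A_isotropic B_isotropic unfolding lagr_gstar_def by auto
  qed
  have uA: "u k \<in> lagr_g D n" and vB: "v k \<in> lagr_gstar D n" if "k \<in> {1..N}" for k
    using bu bv that P.V.span_superset[of "u ` {1..N}"] P.V.span_superset[of "v ` {1..N}"]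
    unfolding is_basis_def by blast+
  have uv: "power_form n (u k) (v l) = (if k = l then 1 else 0)" if "k \<in> {1..N}" "l \<in> {1..N}" for k l
    using du that unfolding dual_wrt_def by blast
  have uC: "u k \<in> P.C" and vC: "v k \<in> P.C" if "k \<in> {1..N}" for k
    using uA vB AC BC that by blast+
  have exA: "a = (\<Sum>k = 1..N. lscale (PL n) (power_form n a (v k)) (u k))" if "a \<in> lagr_g D n" for a
  proof (rule P.V.expand_in_dual_basis[where S = P.C and \<phi> = "\<lambda>k a. power_form n a (v k)"])
    show "power_form n (a + b) (v k) = power_form n a (v k) + power_form n b (v k)"
      if "k \<in> {1..N}" "a \<in> P.C" "b \<in> P.C" for k a b
      using Fadd that vC by blast
    show "power_form n (lscale (PL n) s a) (v k) = s * power_form n a (v k)" if "k \<in> {1..N}" "a \<in> P.C" for k s a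
      using Fscale that vC by blast
    show "power_form n (u l) (v k) = (if k = l then 1 else 0)" if "k \<in> {1..N}" "l \<in> {1..N}" for k l
      using uv[OF that(2,1)] by simp
  qed (use that bu uC P.subspace_C in \<open>simp_all add: is_basis_def\<close>)
  have exB: "a = (\<Sum>k = 1..N. lscale (PL n) (power_form n (u k) a) (v k))" if "a \<in> lagr_gstar D n" for a
  proof (rule P.V.expand_in_dual_basis[where S = P.C and \<phi> = "\<lambda>k. power_form n (u k)"])
    show "power_form n (u k) (a + b) = power_form n (u k) a + power_form n (u k) b"
      if "k \<in> {1..N}" "a \<in> P.C" "b \<in> P.C" for k a b
      using Fadd[of a b "u k"] Fsym that uC P.C_add by metis
    show "power_form n (u k) (lscale (PL n) s a) = s * power_form n (u k) a" if "k \<in> {1..N}" "a \<in> P.C" for k s a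
      using Fscale[of a "u k" s] Fsym that uC P.C_scale by metis
  qed (use that bv vC uv P.subspace_C in \<open>simp_all add: is_basis_def\<close>)
  have dec: "\<exists>a\<in>lagr_g D n. \<exists>b\<in>lagr_gstar D n. c = a + b" if c: "c \<in> P.C" for c
  proof -
    \<comment> \<open>Decompose each entry in the double, with the sign that the form carries at its position.\<close>
    have "\<exists>a b. a \<in> g_part D \<and> b \<in> gstar_part D \<and> (if odd e then a + b else - (a + b)) = c e" if "e \<in> {1..n}" for e
    proof -
      have "c e \<in> C" using c that by (simp add: PL_C)
      then obtain a b where ab: "a \<in> g_part D" "b \<in> gstar_part D" "c e = a + b" using decompose by blast
      have "- (- a + - b) = c e" using ab(3) by (simp add: add.commute)
      then show ?thesis using ab V.subspace_neg[OF A_subspace] V.subspace_neg[OF B_subspace]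
        by (cases "odd e") metis+
    qed
    then obtain a b where ab: "\<And>e. e \<in> {1..n} \<Longrightarrow>
        a e \<in> g_part D \<and> b e \<in> gstar_part D \<and> (if odd e then a e + b e else - (a e + b e)) = c e" by metis
    let ?a = "\<Sum>e = 1..n. lagr_g_comp n e (a e) (b e)" and ?b = "\<Sum>e = 1..n. lagr_gstar_comp n e (a e) (b e)"
    have "?a \<in> lagr_g D n"
      using ab by (intro P.V.subspace_sum[OF Asub] lagr_g_comp_in) blast+
    moreover have "?b \<in> lagr_gstar D n"
      using ab by (intro P.V.subspace_sum[OF Bsub] lagr_gstar_comp_in) blast+
    moreover have "c = ?a + ?b"
    proof
      fix j
      have "(?a + ?b) j = (\<Sum>e = 1..n. lagr_g_comp n e (a e) (b e) j + lagr_gstar_comp n e (a e) (b e) j)"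
        by (simp add: sum_fun_apply sum.distrib)
      also have "\<dots> = (\<Sum>e = 1..n. if e = j then c j else 0)"
      proof (rule sum.cong[OF refl])
        fix e assume e: "e \<in> {1..n}"
        show "lagr_g_comp n e (a e) (b e) j + lagr_gstar_comp n e (a e) (b e) j = (if e = j then c j else 0)"
          using ab[OF e] unfolding lagr_comp_sum[OF e] by (cases "j = e") auto
      qed
      also have "\<dots> = c j" using c by (auto simp: PL_C sum.delta)
      finally show "c j = (?a + ?b) j" by (rule sym)
    qed
    ultimately show ?thesis by blast
  qed
  show ?thesis
    by (intro manin_triple.intro manin_triple_axioms.intro P.lie_alg_on_axioms)
      (use Fadd Fscale Fsym Finv AC BC Abr Bbr Aiso Biso Asub Bsub uA vB exA exB dec in
        \<open>simp_all only: finite_atLeastAtMost\<close>)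
qed

definition factor_functional :: "nat \<Rightarrow> nat \<Rightarrow> ('g \<times> ('g \<Rightarrow> 'k) \<Rightarrow> 'k) \<Rightarrow> (nat \<Rightarrow> 'g \<times> ('g \<Rightarrow> 'k)) \<Rightarrow> 'k" where
  "factor_functional n e \<alpha> = restrict0 (lcarrier (PL n)) (\<lambda>a. \<alpha> (a e))"

lemma factor_functional_in_dual:
  assumes "e \<in> {1..n}" "\<alpha> \<in> dual_space D"
  shows "factor_functional n e \<alpha> \<in> dual_space (PL n)"
proof -
  interpret P: lie_alg_on "PL n" using lie_algebra_power[OF lie] by unfold_locales
  show ?thesis
    unfolding factor_functional_def
    by (rule P.restrict0_in_dual) (use assms in \<open>simp_all add: PL_C PL_scale dual_add dual_scale\<close>)
qed

text \<open>
  The cobracket of the power, on functionals of single factors, is the direct product cobracket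
  twisted by the mixed term: the \<open>r\<close>-matrix of the power differs from the direct sum of the
  \<open>r\<close>-matrices of the factors by the mixed term and by invariant symmetric tensors, which come
  from the factors in even position.
\<close>

lemma cobracket_power:
  fixes u v :: "nat \<Rightarrow> nat \<Rightarrow> 'g \<times> ('g \<Rightarrow> 'k)"
  assumes P: "manin_triple (PL n) (power_form n) (lagr_g D n) (lagr_gstar D n) {1..N} u v"
    and e: "e \<in> {1..n}" and f: "f \<in> {1..n}"
    and \<alpha>: "\<alpha> \<in> dual_space D" and \<beta>: "\<beta> \<in> dual_space D" and a: "a \<in> lcarrier (PL n)"
  shows "coboundary (PL n) (tensor_sum {1..N} u v) a (factor_functional n e \<alpha>) (factor_functional n f \<beta>) =
    (if e = f then \<delta> (a e) \<alpha> \<beta> else 0) + \<alpha> (br (a e) (attached \<beta> f e)) - \<beta> (br (a f) (attached \<alpha> e f))"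
proof -
  interpret P: manin_triple "PL n" "power_form n" "lagr_g D n" "lagr_gstar D n" "{1..N}" u v by (rule P)
  let ?a = "\<lambda>e \<alpha>. lagr_g_comp n e (pA \<alpha>) (pB \<alpha>)" and ?b = "\<lambda>e \<alpha>. lagr_gstar_comp n e (pA \<alpha>) (pB \<alpha>)"
    and ?\<phi> = "factor_functional n"
  have comp: "power_form n (?a e \<alpha> + ?b e \<alpha>) c = ?\<phi> e \<alpha> c"
    if e: "e \<in> {1..n}" and \<alpha>: "\<alpha> \<in> dual_space D" and c: "c \<in> P.C" for e \<alpha> c
  proof -
    have z: "double_form 0 b = 0" if "b \<in> C" for b using that by (rule F_0)
    have "power_form n (?a e \<alpha> + ?b e \<alpha>) c =
        (\<Sum>j = 1..n. if j = e then \<alpha> (c e) else 0)"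
      unfolding power_form_def
    proof (intro sum.cong refl)
      fix j assume j: "j \<in> {1..n}"
      have cj: "c j \<in> C" using c j by (simp add: PL_C)
      show "(- 1) ^ (j + 1) * double_form ((?a e \<alpha> + ?b e \<alpha>) j) (c j) =
          (if j = e then \<alpha> (c e) else 0)"
      proof (cases "j = e")
        case True
        have "double_form (- (pA \<alpha> + pB \<alpha>)) (c e) = - \<alpha> (c e)" "double_form (pA \<alpha> + pB \<alpha>) (c e) = \<alpha> (c e)"
          using F_neg[of "pA \<alpha> + pB \<alpha>" "c e"] dual_rep[OF \<alpha>] cj True by (simp_all only: pA_C pB_C C_add)
        then show ?thesis using True e by (cases "odd e") (simp_all only: plus_fun_apply lagr_comp_sum, simp_all)
      qed (use e z[OF cj] in \<open>simp add: lagr_comp_sum\<close>)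
    qed
    also have "\<dots> = ?\<phi> e \<alpha> c" using e c by (simp add: factor_functional_def restrict0_def sum.delta)
    finally show ?thesis .
  qed
  have PA: "P.pA (?\<phi> e \<alpha>) = ?a e \<alpha>"
    and PB: "P.pB (?\<phi> e \<alpha>) = ?b e \<alpha>"
    if "e \<in> {1..n}" "\<alpha> \<in> dual_space D" for e \<alpha>
  proof -
    note in_A = lagr_g_comp_in[OF that(1) pA_A[of \<alpha>] pB_B[of \<alpha>]]
      and in_B = lagr_gstar_comp_in[OF that(1) pA_A[of \<alpha>] pB_B[of \<alpha>]]
    show "P.pA (?\<phi> e \<alpha>) = ?a e \<alpha>"
      by (rule P.pA_unique[OF in_A in_B]) (rule comp[OF that P.v_C, symmetric])
    show "P.pB (?\<phi> e \<alpha>) = ?b e \<alpha>"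
      by (rule P.pB_unique[OF in_A in_B]) (rule comp[OF that P.u_C, symmetric])
  qed
  have app: "?\<phi> e \<alpha> (lbracket (PL n) a b) = \<alpha> (br (a e) (b e))"
    if "e \<in> {1..n}" "b \<in> P.C" for e \<alpha> b
    using that a P.C_bracket by (simp add: factor_functional_def restrict0_def PL_bracket)
  have "P.\<delta> a (?\<phi> e \<alpha>) (?\<phi> f \<beta>) =
      ?\<phi> e \<alpha> (lbracket (PL n) a (P.pA (?\<phi> f \<beta>)))
      + ?\<phi> f \<beta> (lbracket (PL n) a (P.pB (?\<phi> e \<alpha>)))"
    by (rule P.cobracket_apply) (use a e f \<alpha> \<beta> in \<open>auto intro: factor_functional_in_dual\<close>)
  also have "\<dots> = \<alpha> (br (a e) (?a f \<beta> e)) + \<beta> (br (a f) (?b e \<alpha> f))"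
    using app[OF e P.pA_C, of \<alpha> "?\<phi> f \<beta>"] app[OF f P.pB_C, of \<beta> "?\<phi> e \<alpha>"]
    by (simp only: PA[OF f \<beta>] PB[OF e \<alpha>])
  also have "\<dots> = (if e = f then \<delta> (a e) \<alpha> \<beta> else 0) + \<alpha> (br (a e) (attached \<beta> f e)) - \<beta> (br (a f) (attached \<alpha> e f))"
  proof (cases "e = f")
    case False
    have "\<beta> (br (a f) (- attached \<alpha> e f)) = - \<beta> (br (a f) (attached \<alpha> e f))"
      using a f \<beta> by (simp add: bracket_neg_right dual_neg PL_C attached_C C_bracket)
    then show ?thesis using False e f by (simp add: lagr_g_comp_def lagr_gstar_comp_def)
  next
    case True
    have ae: "a e \<in> C" using a e by (simp add: PL_C)
    have z: "attached \<gamma> i i = 0" for \<gamma> i by (simp add: shift_def)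
    \<comment> \<open>In even position the two components are exchanged, with a sign; skew-symmetry undoes this.\<close>
    have skew: "\<delta> (a e) \<alpha> \<beta> = - \<delta> (a e) \<beta> \<alpha>"
      using lie_bialgebra_coboundary ae \<alpha> \<beta> unfolding lie_bialgebra_def skew_tensor_def by blast
    have "\<alpha> (br (a e) (- pB \<beta>)) = - \<alpha> (br (a e) (pB \<beta>))" "\<beta> (br (a e) (- pA \<alpha>)) = - \<beta> (br (a e) (pA \<alpha>))"
      using ae \<alpha> \<beta> by (simp_all add: bracket_neg_right dual_neg pA_C pB_C C_bracket)
    then show ?thesis
      using True e skew cobracket_apply[OF ae \<alpha> \<beta>] cobracket_apply[OF ae \<beta> \<alpha>] ae
      by (cases "odd e") (simp_all add: lagr_g_comp_def lagr_gstar_comp_def z bracket_0_right dual_0[OF \<alpha>] dual_0[OF \<beta>] algebra_simps)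
  qed
  finally show ?thesis .
qed

end

section \<open>Schouten brackets with a twisted bivector field\<close>

text \<open>
  Let \<open>P = P0 + T\<close>, where \<open>T\<close> is the image under an action of a constant skew tensor. At a given
  point, contracting \<open>T\<close> with the differential of the coordinate \<open>i\<close> gives a value of a vector field
  \<open>H i\<close> of the action, and the product rule gives \<open>\<partial>\<^sub>l T\<^sup>i\<^sup>j = \<partial>\<^sub>l (H i)\<^sup>j - \<partial>\<^sub>l (H j)\<^sup>i\<close>, with the element
  of the Lie algebra defining \<open>H i\<close> kept fixed. These two facts are all that is needed to reduce
  Schouten brackets of \<open>P\<close> to those of \<open>P0\<close> and to Lie brackets in the action.
\<close>

lemma schouten_vf_twist:
  assumes P: "\<And>i j. i \<in> mind M \<Longrightarrow> j \<in> mind M \<Longrightarrow> P c x i j = P0 c x i j + H i c x j"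
    and skew: "\<And>i j. i \<in> mind M \<Longrightarrow> j \<in> mind M \<Longrightarrow> H j c x i = - H i c x j"
    and dP: "\<And>l i j. l \<in> mind M \<Longrightarrow> i \<in> mind M \<Longrightarrow> j \<in> mind M \<Longrightarrow>
      pderiv_at l (\<lambda>y. P c y i j) x =
        pderiv_at l (\<lambda>y. P0 c y i j) x + pderiv_at l (\<lambda>y. H i c y j) x - pderiv_at l (\<lambda>y. H j c y i) x"
    and ij: "i \<in> mind M" "j \<in> mind M"
  shows "schouten_vf M X P c x i j =
    schouten_vf M X P0 c x i j + vf_bracket M X (H i) c x j - vf_bracket M X (H j) c x i"
  unfolding schouten_vf_def vf_bracket_def sum.distrib[symmetric] sum_subtractf[symmetric]
proof (rule sum.cong[OF refl], goal_cases)
  case l: (1 l)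
  have 1: "P c x l j = P0 c x l j - H j c x l" and 2: "P c x i l = P0 c x i l + H i c x l"
    using P l ij skew[of j l] by simp_all
  show ?case
    unfolding dP[OF l ij] 1 2 by (simp add: algebra_simps)
qed

lemma schouten_self_twist:
  assumes P: "\<And>i j. i \<in> mind M \<Longrightarrow> j \<in> mind M \<Longrightarrow> P c x i j = P0 c x i j + H i c x j"
    and skew0: "\<And>i j. i \<in> mind M \<Longrightarrow> j \<in> mind M \<Longrightarrow> P0 c x j i = - P0 c x i j"
    and dP: "\<And>l i j. l \<in> mind M \<Longrightarrow> i \<in> mind M \<Longrightarrow> j \<in> mind M \<Longrightarrow>
      pderiv_at l (\<lambda>y. P c y i j) x =
        pderiv_at l (\<lambda>y. P0 c y i j) x + pderiv_at l (\<lambda>y. H i c y j) x - pderiv_at l (\<lambda>y. H j c y i) x"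
    and ijk: "i \<in> mind M" "j \<in> mind M" "k \<in> mind M"
  shows "schouten_self M P c x i j k = schouten_self M P0 c x i j k
    + (schouten_vf M (H i) P0 c x j k + vf_bracket M (H i) (H j) c x k)
    + (schouten_vf M (H j) P0 c x k i + vf_bracket M (H j) (H k) c x i)
    + (schouten_vf M (H k) P0 c x i j + vf_bracket M (H k) (H i) c x j)"
  unfolding schouten_self_def schouten_vf_def vf_bracket_def sum.distrib[symmetric] sum_subtractf[symmetric]
proof (rule sum.cong[OF refl], goal_cases)
  case l: (1 l)
  have s: "P0 c x l i = - P0 c x i l" "P0 c x l j = - P0 c x j l" "P0 c x l k = - P0 c x k l"
    using skew0 l ijk by blast+
  show ?case
    unfolding P[OF ijk(1) l] P[OF ijk(2) l] P[OF ijk(3) l] dP[OF l ijk(2,3)] dP[OF l ijk(3,1)] dP[OF l ijk(1,2)] s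
    by (simp add: algebra_simps)
qed

lemma pderiv_at_sum_mult:
  fixes A B :: "'s \<Rightarrow> ('i \<Rightarrow> 'k::real_normed_field) \<Rightarrow> 'k"
  assumes "\<And>s. s \<in> S \<Longrightarrow> smooth_on I W (A s)" "\<And>s. s \<in> S \<Longrightarrow> smooth_on I W (B s)"
    and "l \<in> I" "z \<in> W"
  shows "pderiv_at l (\<lambda>y. \<Sum>s\<in>S. A s y * B s y) z =
    (\<Sum>s\<in>S. pderiv_at l (A s) z * B s z + A s z * pderiv_at l (B s) z)"
proof (rule pderiv_atI, rule DERIV_sum)
  fix s assume s: "s \<in> S"
  have "((\<lambda>t. A s (z(l := t)) * B s (z(l := t))) has_field_derivative
      pderiv_at l (A s) z * B s (z(l := z l)) + pderiv_at l (B s) z * A s (z(l := z l))) (at (z l))"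
    using assms s by (intro DERIV_mult smooth_on_has_pderiv[where I = I and W = W]) auto
  then show "((\<lambda>t. A s (z(l := t)) * B s (z(l := t))) has_field_derivative
      pderiv_at l (A s) z * B s z + A s z * pderiv_at l (B s) z) (at (z l))"
    by (simp add: mult.commute)
qed

lemma pderiv_at_lincomb:
  fixes f g h :: "('i \<Rightarrow> 'k::real_normed_field) \<Rightarrow> 'k"
  assumes W: "openin (coord_space I) W" and "smooth_on I W f" "smooth_on I W g"
    and "l \<in> I" "z \<in> W" and h: "\<And>y. y \<in> W \<Longrightarrow> h y = s * f y + g y"
  shows "pderiv_at l h z = s * pderiv_at l f z + pderiv_at l g z"
proof -
  have "pderiv_at l h z = pderiv_at l (\<lambda>y. s * f y + g y) z"
    by (rule pderiv_at_cong[OF W assms(5,4) h])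
  also have "\<dots> = s * pderiv_at l f z + pderiv_at l g z"
    by (rule pderiv_atI, rule DERIV_add, rule DERIV_cmult)
      (rule smooth_on_has_pderiv[OF assms(2,4,5)], rule smooth_on_has_pderiv[OF assms(3,4,5)])
  finally show ?thesis .
qed


section \<open>Families of Poisson spaces of the double\<close>

locale poisson_family = double_triple D "{1..m}" "\<lambda>i. (x i, 0)" "\<lambda>i. (0, \<xi> i)"
  for D :: "('k::real_normed_field, 'g::ab_group_add \<times> ('g \<Rightarrow> 'k)) lie_alg"
    and m :: nat and x :: "nat \<Rightarrow> 'g" and \<xi> :: "nat \<Rightarrow> 'g \<Rightarrow> 'k" +
  fixes n :: nat and Y :: "nat \<Rightarrow> ('k, 'p, 'i, 'c) manifold" and \<pi> :: "nat \<Rightarrow> ('k, 'i, 'c) bvf"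
    and \<sigma> :: "nat \<Rightarrow> 'g \<times> ('g \<Rightarrow> 'k) \<Rightarrow> ('k, 'i, 'c) vf"
  assumes space: "\<And>j. j \<in> {1..n} \<Longrightarrow> left_poisson_space D
    (coboundary D (tensor_sum {1..m} (\<lambda>i. (x i, 0)) (\<lambda>i. (0, \<xi> i)))) (Y j) (\<pi> j) (\<sigma> j)"

sublocale poisson_family \<subseteq> manifold_family n Y
  using space unfolding left_poisson_space_def by unfold_locales blast

context poisson_family
begin

abbreviation act :: "(nat \<Rightarrow> 'g \<times> ('g \<Rightarrow> 'k)) \<Rightarrow> ('k, nat \<times> 'i, nat \<Rightarrow> 'c) vf" where
  "act \<equiv> product_action n Y \<sigma>"

abbreviation mix :: "('k, nat \<times> 'i, nat \<Rightarrow> 'c) bvf" where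
  "mix \<equiv> mixed_product n m x \<xi> Y \<pi> (\<lambda>j. rho_of (\<sigma> j)) (\<lambda>j. lambda_of (\<sigma> j))"

abbreviation direct :: "('k, nat \<times> 'i, nat \<Rightarrow> 'c) bvf" where
  "direct \<equiv> (\<Sum>j = 1..n. lift_bvf Y j (\<pi> j))"

lemmas direct_apply = sum_lift_bvf_apply[where P = \<pi>]

lemma space_action: "j \<in> {1..n} \<Longrightarrow> left_action D (Y j) (\<sigma> j)"
  and space_poisson: "j \<in> {1..n} \<Longrightarrow> poisson_structure (Y j) (\<pi> j)"
  and space_compatible: "j \<in> {1..n} \<Longrightarrow> a \<in> C \<Longrightarrow>
    bvf_eq (Y j) (schouten_vf (Y j) (\<sigma> j a) (\<pi> j)) (act_tensor D (\<sigma> j) (\<delta> a))"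
  using space unfolding left_poisson_space_def by blast+

lemma space_vector_field: "j \<in> {1..n} \<Longrightarrow> a \<in> C \<Longrightarrow> vector_field (Y j) (\<sigma> j a)"
  using space_action unfolding left_action_def by blast

lemma space_bivector_field: "j \<in> {1..n} \<Longrightarrow> bivector_field (Y j) (\<pi> j)"
  using space_poisson unfolding poisson_structure_def by blast

lemma x_C: "s \<in> {1..m} \<Longrightarrow> (x s, 0) \<in> C" and \<xi>_C: "s \<in> {1..m} \<Longrightarrow> (0, \<xi> s) \<in> C"
  using u_C v_C by simp_all

lemma vector_field_rho_lambda:
  assumes e: "e \<in> {1..n}" and s: "s \<in> {1..m}"
  shows "vector_field (Y e) (rho_of (\<sigma> e) (\<xi> s))" and "vector_field (Y e) (lambda_of (\<sigma> e) (x s))"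
proof -
  have X: "vector_field (Y e) (\<sigma> e (0, \<xi> s))" using space_vector_field[OF e \<xi>_C[OF s]] .
  show "vector_field (Y e) (rho_of (\<sigma> e) (\<xi> s))"
    unfolding vector_field_def rho_of_def
  proof (intro conjI ballI)
    fix c i assume "c \<in> mcharts (Y e)" "i \<in> mind (Y e)"
    then show "smooth_on (mind (Y e)) (mimg (Y e) c) (\<lambda>y. (- \<sigma> e (0, \<xi> s)) c y i)"
      using X smooth_on_uminus[OF manifold_open_mimg[OF factor_manifold[OF e]], of c "\<lambda>y. \<sigma> e (0, \<xi> s) c y i"]
      unfolding vector_field_def by simp
  next
    show "vf_related (Y e) (Y e) id (- \<sigma> e (0, \<xi> s)) (- \<sigma> e (0, \<xi> s))"
      using X unfolding vector_field_def vf_related_def by (simp add: sum_negf)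
  qed
  show "vector_field (Y e) (lambda_of (\<sigma> e) (x s))"
    unfolding lambda_of_def using space_vector_field[OF e x_C[OF s]] .
qed

text \<open>
  The action enters all brackets at a point through these linear functionals on the double, which
  turn identities of tensor fields into identities in the double.
\<close>

definition theta :: "(nat \<Rightarrow> 'c) \<Rightarrow> (nat \<times> 'i \<Rightarrow> 'k) \<Rightarrow> nat \<times> 'i \<Rightarrow> 'g \<times> ('g \<Rightarrow> 'k) \<Rightarrow> 'k" where
  "theta c z a = restrict0 C (\<lambda>d. \<sigma> (fst a) d (c (fst a)) (fac (fst a) z) (snd a))"

definition dtheta :: "(nat \<Rightarrow> 'c) \<Rightarrow> (nat \<times> 'i \<Rightarrow> 'k) \<Rightarrow> nat \<times> 'i \<Rightarrow> 'i \<Rightarrow> 'g \<times> ('g \<Rightarrow> 'k) \<Rightarrow> 'k" where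
  "dtheta c z a l = restrict0 C (\<lambda>d. pderiv_at l (\<lambda>y. \<sigma> (fst a) d (c (fst a)) y (snd a)) (fac (fst a) z))"

lemma theta_apply: "d \<in> C \<Longrightarrow> theta c z (e, i) d = \<sigma> e d (c e) (fac e z) i"
  by (simp add: theta_def restrict0_def)

lemma dtheta_apply: "d \<in> C \<Longrightarrow> dtheta c z (e, i) l d = pderiv_at l (\<lambda>y. \<sigma> e d (c e) y i) (fac e z)"
  by (simp add: dtheta_def restrict0_def)

lemma action_linear:
  assumes "e \<in> {1..n}" "ch \<in> mcharts (Y e)" "y \<in> mimg (Y e) ch" "i \<in> mind (Y e)" "a \<in> C" "b \<in> C"
  shows "\<sigma> e (a + b) ch y i = \<sigma> e a ch y i + \<sigma> e b ch y i"
    and "\<sigma> e (scl s a) ch y i = s * \<sigma> e a ch y i"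
    and "vf_bracket (Y e) (\<sigma> e a) (\<sigma> e b) ch y i = - \<sigma> e (br a b) ch y i"
proof -
  note L = space_action[OF assms(1), unfolded left_action_def vf_eq_def]
  have "\<sigma> e (a + b) ch y i = (\<sigma> e a + \<sigma> e b) ch y i" using L assms by blast
  then show "\<sigma> e (a + b) ch y i = \<sigma> e a ch y i + \<sigma> e b ch y i" by simp
  show "\<sigma> e (scl s a) ch y i = s * \<sigma> e a ch y i" using L assms by blast
  have "\<sigma> e (br a b) ch y i = (- vf_bracket (Y e) (\<sigma> e a) (\<sigma> e b)) ch y i" using L assms by blast
  then show "vf_bracket (Y e) (\<sigma> e a) (\<sigma> e b) ch y i = - \<sigma> e (br a b) ch y i" by simp
qed

lemma theta_in_dual:
  assumes c: "c \<in> mcharts PM" and z: "z \<in> mimg PM c" and a: "a \<in> mind PM"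
  shows "theta c z a \<in> dual_space D"
proof -
  obtain e i where a: "a = (e, i)" "e \<in> {1..n}" "i \<in> mind (Y e)" using a by (auto simp: PM_simps)
  show ?thesis
    unfolding theta_def
    by (rule restrict0_in_dual)
      (simp_all only: a fst_conv snd_conv action_linear[OF a(2) chart_factor[OF c a(2)] fac_mimg[OF c z a(2)] a(3)])
qed

lemma action_smooth:
  assumes "e \<in> {1..n}" "ch \<in> mcharts (Y e)" "i \<in> mind (Y e)" "a \<in> C"
  shows "smooth_on (mind (Y e)) (mimg (Y e) ch) (\<lambda>y. \<sigma> e a ch y i)"
  using space_vector_field[OF assms(1,4)] assms(2,3) unfolding vector_field_def by blast

lemma dtheta_in_dual:
  assumes c: "c \<in> mcharts PM" and z: "z \<in> mimg PM c" and a: "a \<in> mind PM" and l: "l \<in> mind (Y (fst a))"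
  shows "dtheta c z a l \<in> dual_space D"
proof -
  obtain e i where a: "a = (e, i)" "e \<in> {1..n}" "i \<in> mind (Y e)" using a by (auto simp: PM_simps)
  have l: "l \<in> mind (Y e)" using l a by simp
  note ce = chart_factor[OF c a(2)] and fz = fac_mimg[OF c z a(2)]
  note W = manifold_open_mimg[OF factor_manifold[OF a(2)] ce]
  show ?thesis
    unfolding dtheta_def a fst_conv snd_conv
  proof (rule restrict0_in_dual)
    fix u v assume uv: "u \<in> C" "v \<in> C"
    have "pderiv_at l (\<lambda>y. \<sigma> e (u + v) (c e) y i) (fac e z) =
        1 * pderiv_at l (\<lambda>y. \<sigma> e u (c e) y i) (fac e z) + pderiv_at l (\<lambda>y. \<sigma> e v (c e) y i) (fac e z)"
      by (rule pderiv_at_lincomb[OF W action_smooth[OF a(2) ce a(3) uv(1)] action_smooth[OF a(2) ce a(3) uv(2)] l fz])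
        (simp add: action_linear[OF a(2) ce _ a(3) uv])
    then show "pderiv_at l (\<lambda>y. \<sigma> e (u + v) (c e) y i) (fac e z) =
        pderiv_at l (\<lambda>y. \<sigma> e u (c e) y i) (fac e z) + pderiv_at l (\<lambda>y. \<sigma> e v (c e) y i) (fac e z)" by simp
  next
    fix s u assume u: "u \<in> C"
    have z: "pderiv_at l (\<lambda>_. 0) (fac e z) = (0 :: 'k)" by (rule pderiv_atI) simp
    have "pderiv_at l (\<lambda>y. \<sigma> e (scl s u) (c e) y i) (fac e z) =
        s * pderiv_at l (\<lambda>y. \<sigma> e u (c e) y i) (fac e z) + pderiv_at l (\<lambda>_. 0) (fac e z)"
      by (rule pderiv_at_lincomb[OF W action_smooth[OF a(2) ce a(3) u] smooth_on_const[OF W] l fz])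
        (simp add: action_linear(2)[OF a(2) ce _ a(3) u u])
    then show "pderiv_at l (\<lambda>y. \<sigma> e (scl s u) (c e) y i) (fac e z) =
        s * pderiv_at l (\<lambda>y. \<sigma> e u (c e) y i) (fac e z)" using z by simp
  qed
qed

lemma act_apply:
  "e \<in> {1..n} \<Longrightarrow> d e \<in> C \<Longrightarrow> act d c z (e, i) = theta c z (e, i) (d e)"
  by (simp add: product_action_apply theta_apply)

lemma pderiv_act:
  assumes "e \<in> {1..n}" "d e \<in> C" "g \<in> {1..n}" "l \<in> mind (Y g)"
  shows "pderiv_at (g, l) (\<lambda>y. act d c y (e, i)) z = (if g = e then dtheta c z (e, i) l (d e) else 0)"
  unfolding product_action_apply[OF assms(1)]
  by (subst pderiv_at_factor) (use assms in \<open>auto simp: dtheta_apply\<close>)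

lemma sum_mind_PM_single:
  assumes "f \<in> {1..n}" "\<And>j l. j \<in> {1..n} \<Longrightarrow> l \<in> mind (Y j) \<Longrightarrow> j \<noteq> f \<Longrightarrow> h (j, l) = 0"
  shows "(\<Sum>a\<in>mind PM. h a) = (\<Sum>l\<in>mind (Y f). h (f, l))"
proof -
  have "(\<Sum>a\<in>mind PM. h a) = (\<Sum>j = 1..n. if j = f then (\<Sum>l\<in>mind (Y f). h (f, l)) else 0)"
    unfolding sum_mind_PM using assms(2) by (intro sum.cong refl) (auto intro: sum.neutral)
  then show ?thesis using assms(1) by (simp add: sum.delta)
qed

subsection \<open>Brackets on the direct product\<close>

text \<open>
  A coordinate of the factor \<open>f\<close> of a component of the action has derivatives in the coordinates of
  that factor only, so all brackets with the action and with the direct product structure reduce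
  to those of a single factor.
\<close>

lemma vf_bracket_act:
  assumes c: "c \<in> mcharts PM" and z: "z \<in> mimg PM c" and a: "a \<in> lcarrier (PL n)" and b: "b \<in> lcarrier (PL n)"
    and j: "(f, j) \<in> mind PM"
  shows "vf_bracket PM (act a) (act b) c z (f, j) = - theta c z (f, j) (br (a f) (b f))"
proof -
  have f: "f \<in> {1..n}" "j \<in> mind (Y f)" using j by (auto simp: PM_simps)
  have af: "a f \<in> C" and bf: "b f \<in> C" using a b f by (auto simp: PL_C)
  have "vf_bracket PM (act a) (act b) c z (f, j) = (\<Sum>l\<in>mind (Y f).
      act a c z (f, l) * pderiv_at (f, l) (\<lambda>y. act b c y (f, j)) z
      - act b c z (f, l) * pderiv_at (f, l) (\<lambda>y. act a c y (f, j)) z)"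
    unfolding vf_bracket_def
    by (rule sum_mind_PM_single[OF f(1)]) (simp add: pderiv_act[OF f(1)] af bf)
  also have "\<dots> = vf_bracket (Y f) (\<sigma> f (a f)) (\<sigma> f (b f)) (c f) (fac f z) j"
    unfolding vf_bracket_def
  proof (rule sum.cong[OF refl], goal_cases)
    case l: (1 l)
    note p = pderiv_act[OF f(1) _ f(1) l, where i = j and c = c and z = z]
    show ?case
      unfolding p[where d = a, OF af] p[where d = b, OF bf]
      by (simp add: product_action_apply[OF f(1)] dtheta_apply af bf)
  qed
  also have "\<dots> = - theta c z (f, j) (br (a f) (b f))"
    using action_linear(3)[OF f(1) chart_factor[OF c f(1)] fac_mimg[OF c z f(1)] f(2) af bf]
    by (simp add: theta_apply C_bracket af bf)
  finally show ?thesis .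
qed

lemma pderiv_direct:
  assumes "f \<in> {1..n}" "g \<in> {1..n}" "l \<in> mind (Y g)"
  shows "pderiv_at (g, l) (\<lambda>y. direct c y (f, j) (h, k)) z =
    (if f = h \<and> g = f then pderiv_at l (\<lambda>y. \<pi> f (c f) y j k) (fac f z) else 0)"
proof (cases "f = h")
  case True
  have "(\<lambda>y. direct c y (f, j) (h, k)) = (\<lambda>y. \<pi> f (c f) (fac f y) j k)"
    using True assms(1) by (simp add: direct_apply)
  then show ?thesis using True pderiv_at_factor[of l "\<lambda>j. mind (Y j)" g "\<lambda>y. \<pi> f (c f) y j k" f z] assms by simp
next
  case False
  have "(\<lambda>y. direct c y (f, j) (h, k)) = (\<lambda>y. 0)" using False assms(1) by (simp add: direct_apply)
  then show ?thesis using False by (simp add: pderiv_atI)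
qed

lemma schouten_vf_direct:
  assumes c: "c \<in> mcharts PM" and z: "z \<in> mimg PM c" and a: "a \<in> lcarrier (PL n)"
    and j: "(f, j) \<in> mind PM" and k: "(h, k) \<in> mind PM"
  shows "schouten_vf PM (act a) direct c z (f, j) (h, k) =
    (if f = h then \<delta> (a f) (theta c z (f, j)) (theta c z (h, k)) else 0)"
proof (cases "f = h")
  case True
  have f: "f \<in> {1..n}" "j \<in> mind (Y f)" "k \<in> mind (Y f)" using j k True by (auto simp: PM_simps)
  have af: "a f \<in> C" using a f by (auto simp: PL_C)
  have "schouten_vf PM (act a) direct c z (f, j) (f, k) = (\<Sum>l\<in>mind (Y f).
      act a c z (f, l) * pderiv_at (f, l) (\<lambda>y. direct c y (f, j) (f, k)) z
      - direct c z (f, l) (f, k) * pderiv_at (f, l) (\<lambda>y. act a c y (f, j)) z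
      - direct c z (f, j) (f, l) * pderiv_at (f, l) (\<lambda>y. act a c y (f, k)) z)"
    unfolding schouten_vf_def
    by (rule sum_mind_PM_single[OF f(1)])
      (simp add: pderiv_act[OF f(1)] pderiv_direct[OF f(1)] af)
  also have "\<dots> = schouten_vf (Y f) (\<sigma> f (a f)) (\<pi> f) (c f) (fac f z) j k"
    unfolding schouten_vf_def
  proof (rule sum.cong[OF refl], goal_cases)
    case l: (1 l)
    note p = pderiv_act[where d = a, OF f(1) af f(1) l, where c = c and z = z]
    show ?case
      unfolding p pderiv_direct[OF f(1) f(1) l] unfolding direct_apply[OF f(1)]
      by (simp add: product_action_apply[OF f(1)] dtheta_apply af)
  qed
  also have "\<dots> = act_tensor D (\<sigma> f) (\<delta> (a f)) (c f) (fac f z) j k"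
    using space_compatible[OF f(1) af] chart_factor[OF c f(1)] fac_mimg[OF c z f(1)] f
    unfolding bvf_eq_def by blast
  finally show ?thesis using True by (simp add: act_tensor_def theta_def)
next
  case False
  have f: "f \<in> {1..n}" and h: "h \<in> {1..n}" using j k by (auto simp: PM_simps)
  have af: "a f \<in> C" "a h \<in> C" using a f h by (auto simp: PL_C)
  have "schouten_vf PM (act a) direct c z (f, j) (h, k) = 0"
    unfolding schouten_vf_def
  proof (rule sum.neutral, rule ballI, goal_cases)
    case lm: (1 l)
    obtain g l' where l: "l = (g, l')" "g \<in> {1..n}" "l' \<in> mind (Y g)" using lm by (auto simp: PM_simps)
    show ?case using False
      unfolding l(1) pderiv_act[where d = a, OF f af(1) l(2,3)] pderiv_act[where d = a, OF h af(2) l(2,3)]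
        pderiv_direct[OF f l(2,3)]
      unfolding direct_apply[OF f] direct_apply[OF l(2)] by auto
  qed
  then show ?thesis using False by simp
qed

lemma schouten_self_direct:
  assumes c: "c \<in> mcharts PM" and z: "z \<in> mimg PM c"
    and a: "a \<in> mind PM" and b: "b \<in> mind PM" and d: "d \<in> mind PM"
  shows "schouten_self PM direct c z a b d = 0"
proof -
  obtain e i f j h k where a: "a = (e, i)" "e \<in> {1..n}" "i \<in> mind (Y e)"
    and b: "b = (f, j)" "f \<in> {1..n}" "j \<in> mind (Y f)" and d: "d = (h, k)" "h \<in> {1..n}" "k \<in> mind (Y h)"
    using a b d by (auto simp: PM_simps)
  show ?thesis
  proof (cases "e = f \<and> f = h")
    case True
    then have b': "b = (e, j)" and d': "d = (e, k)" using b d by simp_all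
    have "schouten_self PM direct c z a b d = (\<Sum>l\<in>mind (Y e).
        direct c z a (e, l) * pderiv_at (e, l) (\<lambda>y. direct c y b d) z
        + direct c z b (e, l) * pderiv_at (e, l) (\<lambda>y. direct c y d a) z
        + direct c z d (e, l) * pderiv_at (e, l) (\<lambda>y. direct c y a b) z)"
      unfolding schouten_self_def
      by (rule sum_mind_PM_single[OF a(2)]) (simp add: a(1) b' d' direct_apply[OF a(2)])
    also have "\<dots> = schouten_self (Y e) (\<pi> e) (c e) (fac e z) i j k"
      unfolding schouten_self_def a(1) b' d'
    proof (rule sum.cong[OF refl], goal_cases)
      case l: (1 l)
      show ?case
        unfolding pderiv_direct[OF a(2) a(2) l] unfolding direct_apply[OF a(2)] by simp
    qed
    also have "\<dots> = 0"
      using space_poisson[OF a(2)] chart_factor[OF c a(2)] fac_mimg[OF c z a(2)] a(3) b(3) d(3) True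
      unfolding poisson_structure_def by blast
    finally show ?thesis .
  next
    case False
    have vanish: "direct c z a l * pderiv_at l (\<lambda>y. direct c y b d) z = 0 \<and>
        direct c z b l * pderiv_at l (\<lambda>y. direct c y d a) z = 0 \<and>
        direct c z d l * pderiv_at l (\<lambda>y. direct c y a b) z = 0" if lm: "l \<in> mind PM" for l
    proof -
      obtain g l' where l: "l = (g, l')" "g \<in> {1..n}" "l' \<in> mind (Y g)" using lm by (auto simp: PM_simps)
      show ?thesis using False
        unfolding l(1) a(1) b(1) d(1) pderiv_direct[OF a(2) l(2,3)] pderiv_direct[OF b(2) l(2,3)] pderiv_direct[OF d(2) l(2,3)]
        unfolding direct_apply[OF a(2)] direct_apply[OF b(2)] direct_apply[OF d(2)] by auto
    qed
    show ?thesis unfolding schouten_self_def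
    proof (rule sum.neutral, rule ballI)
      fix l assume "l \<in> mind PM"
      from vanish[OF this] show "direct c z a l * pderiv_at l (\<lambda>y. direct c y b d) z
          + direct c z b l * pderiv_at l (\<lambda>y. direct c y d a) z
          + direct c z d l * pderiv_at l (\<lambda>y. direct c y a b) z = 0" by (elim conjE) (simp only: add_0)
    qed
  qed
qed

end

context poisson_family
begin

subsection \<open>The mixed product as a twist of the direct product\<close>

text \<open>
  The element of the power whose action is, at the given point, the contraction of the mixed term
  with the differential of the coordinate \<open>a\<close>. It vanishes outside \<open>{1..n}\<close> as elements of the
  power do.
\<close>

definition att :: "(nat \<Rightarrow> 'c) \<Rightarrow> (nat \<times> 'i \<Rightarrow> 'k) \<Rightarrow> nat \<times> 'i \<Rightarrow> nat \<Rightarrow> 'g \<times> ('g \<Rightarrow> 'k)" where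
  "att c z a j = (if j \<in> {1..n} then attached (theta c z a) (fst a) j else 0)"

lemma att_C: "att c z a j \<in> C"
  by (simp add: att_def attached_C C_0)

lemma att_PL: "att c z a \<in> lcarrier (PL n)"
  by (simp add: PL_C attached_C att_def)

lemma att_apply: "f \<in> {1..n} \<Longrightarrow> att c z (e, i) f = attached (theta c z (e, i)) e f"
  by (simp add: att_def)

lemma dual_pA:
  assumes \<theta>: "\<theta> \<in> dual_space D"
  shows "\<theta> (pA \<alpha>) = (\<Sum>s = 1..m. \<alpha> (0, \<xi> s) * \<theta> (x s, 0))"
proof -
  have "\<theta> (pA \<alpha>) = (\<Sum>s = 1..m. \<theta> (scl (\<alpha> (0, \<xi> s)) (x s, 0)))"
    unfolding pA_def by (rule dual_sum[OF \<theta>]) (intro C_scale x_C)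
  also have "\<dots> = (\<Sum>s = 1..m. \<alpha> (0, \<xi> s) * \<theta> (x s, 0))"
    by (intro sum.cong refl dual_scale[OF \<theta>] x_C)
  finally show ?thesis .
qed

lemma dual_pB:
  assumes \<theta>: "\<theta> \<in> dual_space D"
  shows "\<theta> (pB \<alpha>) = (\<Sum>s = 1..m. \<alpha> (x s, 0) * \<theta> (0, \<xi> s))"
proof -
  have "\<theta> (pB \<alpha>) = (\<Sum>s = 1..m. \<theta> (scl (\<alpha> (x s, 0)) (0, \<xi> s)))"
    unfolding pB_def by (rule dual_sum[OF \<theta>]) (intro C_scale \<xi>_C)
  also have "\<dots> = (\<Sum>s = 1..m. \<alpha> (x s, 0) * \<theta> (0, \<xi> s))"
    by (intro sum.cong refl dual_scale[OF \<theta>] \<xi>_C)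
  finally show ?thesis .
qed

lemma mix_apply:
  assumes "e \<in> {1..n}" "f \<in> {1..n}"
  shows "mix c y (e, i) (f, j) =
    (if e = f then \<pi> e (c e) (fac e y) i j
     else if e < f then (\<Sum>s = 1..m. \<sigma> e (0, \<xi> s) (c e) (fac e y) i * \<sigma> f (x s, 0) (c f) (fac f y) j)
     else - (\<Sum>s = 1..m. \<sigma> e (x s, 0) (c e) (fac e y) i * \<sigma> f (0, \<xi> s) (c f) (fac f y) j))"
  using assms by (simp add: mixed_product_apply rho_of_def lambda_of_def sum_negf)

lemma bivector_field_mix: "bivector_field PM mix"
  by (rule bivector_field_mixed_product) (simp_all add: space_bivector_field vector_field_rho_lambda)

lemma mix_value:
  assumes c: "c \<in> mcharts PM" and z: "z \<in> mimg PM c" and a: "a \<in> mind PM" and b: "b \<in> mind PM"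
  shows "mix c z a b = direct c z a b + act (att c z a) c z b"
proof -
  obtain e i f j where a': "a = (e, i)" "e \<in> {1..n}" and b': "b = (f, j)" "f \<in> {1..n}"
    using a b by (auto simp: PM_simps)
  have db: "theta c z (f, j) \<in> dual_space D" using theta_in_dual[OF c z b] b' by simp
  have A: "act (att c z a) c z b = theta c z (f, j) (attached (theta c z (e, i)) e f)"
    unfolding a'(1) b'(1) by (simp only: act_apply[OF b'(2) att_C] att_apply[OF b'(2)])
  have M: "mix c z a b = (if e = f then \<pi> e (c e) (fac e z) i j
      else if e < f then (\<Sum>s = 1..m. theta c z (e, i) (0, \<xi> s) * theta c z (f, j) (x s, 0))
      else - (\<Sum>s = 1..m. theta c z (e, i) (x s, 0) * theta c z (f, j) (0, \<xi> s)))"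
    unfolding a'(1) b'(1) mix_apply[OF a'(2) b'(2)] by (simp add: theta_apply x_C \<xi>_C)
  consider "e = f" | "e < f" | "f < e" by linarith
  then show ?thesis
  proof cases
    case 1
    then show ?thesis unfolding A M unfolding a'(1) b'(1)
      by (simp add: direct_apply[OF b'(2)] shift_def dual_0[OF db])
  next
    case 2
    then show ?thesis unfolding A M unfolding a'(1) b'(1)
      by (simp add: direct_apply[OF a'(2)] shift_def dual_pA[OF db])
  next
    case 3
    then show ?thesis unfolding A M unfolding a'(1) b'(1)
      by (simp add: direct_apply[OF a'(2)] shift_def dual_neg[OF db pB_C] dual_pB[OF db])
  qed
qed

lemma action_smooth_PM:
  assumes c: "c \<in> mcharts PM" and "e \<in> {1..n}" "i \<in> mind (Y e)" "d \<in> C"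
  shows "smooth_on (mind PM) (mimg PM c) (\<lambda>y. \<sigma> e d (c e) (fac e y) i)"
  by (rule smooth_on_fac[OF c assms(2) action_smooth[OF assms(2) chart_factor[OF c assms(2)] assms(3,4)]])

lemma pderiv_action:
  assumes "g \<in> {1..n}" "l \<in> mind (Y g)" "d \<in> C"
  shows "pderiv_at (g, l) (\<lambda>y. \<sigma> e d (c e) (fac e y) i) z = (if g = e then dtheta c z (e, i) l d else 0)"
  by (subst pderiv_at_factor) (use assms in \<open>auto simp: dtheta_apply\<close>)

lemma pderiv_sum_action:
  assumes c: "c \<in> mcharts PM" and z: "z \<in> mimg PM c" and g: "g \<in> {1..n}" "l \<in> mind (Y g)"
    and a: "e \<in> {1..n}" "i \<in> mind (Y e)" and b: "f \<in> {1..n}" "j \<in> mind (Y f)"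
    and uv: "\<And>s. s \<in> {1..m} \<Longrightarrow> u s \<in> C" "\<And>s. s \<in> {1..m} \<Longrightarrow> v s \<in> C"
  shows "pderiv_at (g, l) (\<lambda>y. \<Sum>s = 1..m. \<sigma> e (u s) (c e) (fac e y) i * \<sigma> f (v s) (c f) (fac f y) j) z =
    (\<Sum>s = 1..m. (if g = e then dtheta c z (e, i) l (u s) else 0) * theta c z (f, j) (v s))
    + (\<Sum>s = 1..m. theta c z (e, i) (u s) * (if g = f then dtheta c z (f, j) l (v s) else 0))"
proof -
  have "pderiv_at (g, l) (\<lambda>y. \<Sum>s = 1..m. \<sigma> e (u s) (c e) (fac e y) i * \<sigma> f (v s) (c f) (fac f y) j) z =
      (\<Sum>s = 1..m. pderiv_at (g, l) (\<lambda>y. \<sigma> e (u s) (c e) (fac e y) i) z * \<sigma> f (v s) (c f) (fac f z) j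
        + \<sigma> e (u s) (c e) (fac e z) i * pderiv_at (g, l) (\<lambda>y. \<sigma> f (v s) (c f) (fac f y) j) z)"
    by (rule pderiv_at_sum_mult[OF action_smooth_PM[OF c a uv(1)] action_smooth_PM[OF c b uv(2)] _ z])
      (use g in \<open>simp_all add: PM_simps\<close>)
  also have "\<dots> = (\<Sum>s = 1..m. (if g = e then dtheta c z (e, i) l (u s) else 0) * theta c z (f, j) (v s)
      + theta c z (e, i) (u s) * (if g = f then dtheta c z (f, j) l (v s) else 0))"
    by (rule sum.cong[OF refl]) (simp only: pderiv_action[OF g uv(1)] pderiv_action[OF g uv(2)] theta_apply[OF uv(1)] theta_apply[OF uv(2)])
  finally show ?thesis by (simp only: sum.distrib)
qed

text \<open>
  The two factors of each summand of the mixed term live on different factors of the product, and the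
  product rule gives one term for each of them: the derivative of one factor is contracted with the
  value of the other one, which is what freezing \<open>att\<close> at the point expresses.
\<close>

lemma mix_pderiv_less:
  assumes c: "c \<in> mcharts PM" and z: "z \<in> mimg PM c" and g: "g \<in> {1..n}" "l \<in> mind (Y g)"
    and a: "(e, i) \<in> mind PM" and b: "(f, j) \<in> mind PM" and less: "e < f"
  shows "pderiv_at (g, l) (\<lambda>y. mix c y (e, i) (f, j)) z =
    pderiv_at (g, l) (\<lambda>y. act (att c z (e, i)) c y (f, j)) z - pderiv_at (g, l) (\<lambda>y. act (att c z (f, j)) c y (e, i)) z"
proof -
  have a': "e \<in> {1..n}" "i \<in> mind (Y e)" and b': "f \<in> {1..n}" "j \<in> mind (Y f)"
    using a b by (auto simp: PM_simps)
  have da: "theta c z (e, i) \<in> dual_space D" "g = e \<Longrightarrow> dtheta c z (e, i) l \<in> dual_space D"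
    and db: "theta c z (f, j) \<in> dual_space D" "g = f \<Longrightarrow> dtheta c z (f, j) l \<in> dual_space D"
    using theta_in_dual[OF c z] dtheta_in_dual[OF c z] a b g(2) by simp_all
  have "(\<lambda>y. mix c y (e, i) (f, j)) =
      (\<lambda>y. \<Sum>s = 1..m. \<sigma> e (0, \<xi> s) (c e) (fac e y) i * \<sigma> f (x s, 0) (c f) (fac f y) j)"
    unfolding mix_apply[OF a'(1) b'(1)] using less by simp
  then have M: "pderiv_at (g, l) (\<lambda>y. mix c y (e, i) (f, j)) z =
      (\<Sum>s = 1..m. (if g = e then dtheta c z (e, i) l (0, \<xi> s) else 0) * theta c z (f, j) (x s, 0))
      + (\<Sum>s = 1..m. theta c z (e, i) (0, \<xi> s) * (if g = f then dtheta c z (f, j) l (x s, 0) else 0))"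
    by (simp only: pderiv_sum_action[OF c z g a' b' \<xi>_C x_C])
  have "attached (theta c z (e, i)) e f = pA (theta c z (e, i))" "attached (theta c z (f, j)) f e = - pB (theta c z (f, j))"
    using less by (simp_all add: shift_def)
  then show ?thesis
    unfolding M pderiv_act[OF b'(1) att_C g] pderiv_act[OF a'(1) att_C g] att_apply[OF a'(1)] att_apply[OF b'(1)]
    using less da(2) db(2)
    by (cases "g = e"; cases "g = f") (simp_all add: dual_neg pB_C dual_pA dual_pB mult.commute)
qed

lemma mix_pderiv:
  assumes c: "c \<in> mcharts PM" and z: "z \<in> mimg PM c" and l: "l \<in> mind PM" and a: "a \<in> mind PM" and b: "b \<in> mind PM"
  shows "pderiv_at l (\<lambda>y. mix c y a b) z = pderiv_at l (\<lambda>y. direct c y a b) z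
    + pderiv_at l (\<lambda>y. act (att c z a) c y b) z - pderiv_at l (\<lambda>y. act (att c z b) c y a) z"
proof -
  obtain e i f j g l' where a': "a = (e, i)" "e \<in> {1..n}" "i \<in> mind (Y e)"
    and b': "b = (f, j)" "f \<in> {1..n}" "j \<in> mind (Y f)" and l': "l = (g, l')" "g \<in> {1..n}" "l' \<in> mind (Y g)"
    using a b l by (auto simp: PM_simps)
  have P0: "pderiv_at l (\<lambda>y. direct c y a b) z = 0" if "e \<noteq> f"
    unfolding a'(1) b'(1) l'(1) pderiv_direct[OF a'(2) l'(2,3)] using that by simp
  consider "e = f" | "e < f" | "f < e" by linarith
  then show ?thesis
  proof cases
    case 1
    have "(\<lambda>y. mix c y a b) = (\<lambda>y. direct c y a b)"
      unfolding a'(1) b'(1) mix_apply[OF a'(2) b'(2)] direct_apply[OF a'(2)] using 1 by simp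
    moreover have "pderiv_at l (\<lambda>y. act (att c z a) c y b) z = 0" "pderiv_at l (\<lambda>y. act (att c z b) c y a) z = 0"
      using 1 dtheta_in_dual[OF c z a] dtheta_in_dual[OF c z b] l'(3)
      unfolding a'(1) b'(1) l'(1) pderiv_act[OF b'(2) att_C l'(2,3)] pderiv_act[OF a'(2) att_C l'(2,3)]
        att_apply[OF a'(2)] att_apply[OF b'(2)] by (auto simp: shift_def intro!: dual_0)
    ultimately show ?thesis by simp
  next
    case 2
    then show ?thesis using mix_pderiv_less[OF c z l'(2,3) a[unfolded a'(1)] b[unfolded b'(1)]] P0
      by (simp add: a'(1) b'(1) l'(1))
  next
    case 3
    have eq: "(\<lambda>y. mix c y a b) = (\<lambda>y. - mix c y b a)"
      unfolding a'(1) b'(1) mix_apply[OF a'(2) b'(2)] mix_apply[OF b'(2) a'(2)] using 3 by (simp add: mult.commute)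
    have S: "smooth_on (mind PM) (mimg PM c) (\<lambda>y. mix c y b a)"
      using bivector_field_mix c a b unfolding bivector_field_def by blast
    have "pderiv_at l (\<lambda>y. mix c y a b) z = - pderiv_at l (\<lambda>y. mix c y b a) z"
      unfolding eq by (rule pderiv_atI, rule DERIV_minus, rule smooth_on_has_pderiv[OF S l z])
    then show ?thesis using 3 mix_pderiv_less[OF c z l'(2,3) b[unfolded b'(1)] a[unfolded a'(1)]] P0
      by (simp add: a'(1) b'(1) l'(1))
  qed
qed

lemma direct_skew:
  assumes c: "c \<in> mcharts PM" and z: "z \<in> mimg PM c" and a: "a \<in> mind PM" and b: "b \<in> mind PM"
  shows "direct c z b a = - direct c z a b"
proof -
  obtain e i f j where a': "a = (e, i)" "e \<in> {1..n}" "i \<in> mind (Y e)" and b': "b = (f, j)" "f \<in> {1..n}" "j \<in> mind (Y f)"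
    using a b by (auto simp: PM_simps)
  have "\<pi> e (c e) (fac e z) j i = - \<pi> e (c e) (fac e z) i j" if "e = f"
    using space_bivector_field[OF a'(2)] chart_factor[OF c a'(2)] fac_mimg[OF c z a'(2)] a'(3) b'(3) that
    unfolding bivector_field_def by blast
  then show ?thesis unfolding a'(1) b'(1) direct_apply[OF a'(2)] direct_apply[OF b'(2)] by auto
qed

lemma att_skew:
  assumes c: "c \<in> mcharts PM" and z: "z \<in> mimg PM c" and a: "a \<in> mind PM" and b: "b \<in> mind PM"
  shows "act (att c z b) c z a = - act (att c z a) c z b"
proof -
  have "mix c z b a = - mix c z a b"
    using bivector_field_mix c z a b unfolding bivector_field_def by blast
  then show ?thesis
    using mix_value[OF c z a b] mix_value[OF c z b a] direct_skew[OF c z a b]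
    by (simp add: algebra_simps eq_neg_iff_add_eq_0)
qed

text \<open>
  The Schouten square of the direct product structure vanishes, and the remaining three cyclic terms
  of the Schouten square are the three terms of the twist equation for the functionals \<open>theta\<close>.
\<close>

proposition poisson_structure_mix: "poisson_structure PM mix"
  unfolding poisson_structure_def
proof (intro conjI ballI)
  show "bivector_field PM mix" by (rule bivector_field_mix)
  fix c z a b d assume c: "c \<in> mcharts PM" and z: "z \<in> mimg PM c"
    and a: "a \<in> mind PM" and b: "b \<in> mind PM" and d: "d \<in> mind PM"
  have summand: "schouten_vf PM (act (att c z p)) direct c z q r + vf_bracket PM (act (att c z p)) (act (att c z q)) c z r =
      twist_defect (theta c z p) (fst p) (theta c z q) (fst q) (theta c z r) (fst r)"
    if p: "p \<in> mind PM" and q: "q \<in> mind PM" and r: "r \<in> mind PM" for p q r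
  proof -
    obtain e i f j h k where p': "p = (e, i)" "e \<in> {1..n}" and q': "q = (f, j)" "f \<in> {1..n}" and r': "r = (h, k)" "h \<in> {1..n}"
      using p q r by (auto simp: PM_simps)
    have "schouten_vf PM (act (att c z p)) direct c z (f, j) (h, k) + vf_bracket PM (act (att c z p)) (act (att c z q)) c z (h, k) =
        (if f = h then \<delta> (att c z p f) (theta c z (f, j)) (theta c z (h, k)) else 0)
        - theta c z (h, k) (br (att c z p h) (att c z q h))"
      using schouten_vf_direct[OF c z att_PL[of c z p], of f j h k]
        vf_bracket_act[OF c z att_PL[of c z p] att_PL[of c z q], of h k] q r q' r' by simp
    then show ?thesis unfolding p'(1) q'(1) r'(1) twist_defect_def fst_conv
      by (simp only: att_apply[OF q'(2)] att_apply[OF r'(2)])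
  qed
  have "schouten_self PM mix c z a b d = schouten_self PM direct c z a b d
    + (schouten_vf PM (act (att c z a)) direct c z b d + vf_bracket PM (act (att c z a)) (act (att c z b)) c z d)
    + (schouten_vf PM (act (att c z b)) direct c z d a + vf_bracket PM (act (att c z b)) (act (att c z d)) c z a)
    + (schouten_vf PM (act (att c z d)) direct c z a b + vf_bracket PM (act (att c z d)) (act (att c z a)) c z b)"
    by (rule schouten_self_twist[where M = PM and P = mix and ?P0.0 = direct and c = c and x = z and H = "\<lambda>a. act (att c z a)",
          OF mix_value[OF c z] direct_skew[OF c z] mix_pderiv[OF c z] a b d])
  then show "schouten_self PM mix c z a b d = 0"
    unfolding schouten_self_direct[OF c z a b d] summand[OF a b d] summand[OF b d a] summand[OF d a b]
    using twist_equation[OF theta_in_dual[OF c z a] theta_in_dual[OF c z b] theta_in_dual[OF c z d], of "fst a" "fst b" "fst d"]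
    by simp
qed

lemma vf_eq_PMI:
  assumes "\<And>c z e i. c \<in> mcharts PM \<Longrightarrow> z \<in> mimg PM c \<Longrightarrow> e \<in> {1..n} \<Longrightarrow> i \<in> mind (Y e) \<Longrightarrow> V c z (e, i) = W c z (e, i)"
  shows "vf_eq PM V W"
  unfolding vf_eq_def
proof (intro ballI)
  fix c z a assume "c \<in> mcharts PM" "z \<in> mimg PM c" and "a \<in> mind PM"
  moreover from this obtain e i where "a = (e, i)" "e \<in> {1..n}" "i \<in> mind (Y e)" by (auto simp: PM_simps)
  ultimately show "V c z a = W c z a" using assms by blast
qed

proposition left_action_act: "left_action (PL n) PM act"
proof -
  interpret P: lie_alg_on "PL n" using lie_algebra_power[OF lie] by unfold_locales
  have C: "a e \<in> C" if "a \<in> P.C" "e \<in> {1..n}" for a e using that by (auto simp: PL_C)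
  show ?thesis
    unfolding left_action_def
  proof (intro conjI ballI allI)
    fix a assume a: "a \<in> P.C"
    then show "vector_field PM (act a)"
      by (intro vector_field_product_action space_vector_field C)
    fix b assume b: "b \<in> P.C"
    show "vf_eq PM (act (a + b)) (act a + act b)"
    proof (rule vf_eq_PMI)
      fix c z e i assume c: "c \<in> mcharts PM" and z: "z \<in> mimg PM c" and e: "e \<in> {1..n}" "i \<in> mind (Y e)"
      show "act (a + b) c z (e, i) = (act a + act b) c z (e, i)"
        using action_linear(1)[OF e(1) chart_factor[OF c e(1)] fac_mimg[OF c z e(1)] e(2) C[OF a e(1)] C[OF b e(1)]]
        by (simp add: product_action_apply[OF e(1)])
    qed
    show "vf_eq PM (act (lbracket (PL n) a b)) (- vf_bracket PM (act a) (act b))"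
    proof (rule vf_eq_PMI)
      fix c z e i assume c: "c \<in> mcharts PM" and z: "z \<in> mimg PM c" and e: "e \<in> {1..n}" "i \<in> mind (Y e)"
      have "act (lbracket (PL n) a b) c z (e, i) = theta c z (e, i) (br (a e) (b e))"
        using act_apply[OF e(1), of "lbracket (PL n) a b"] PL_bracket[OF e(1)] C_bracket[OF C[OF a e(1)] C[OF b e(1)]] by simp
      then show "act (lbracket (PL n) a b) c z (e, i) = (- vf_bracket PM (act a) (act b)) c z (e, i)"
        using vf_bracket_act[OF c z a b, of e i] e by (simp add: PM_simps(2))
    qed
  next
    fix s a assume a: "a \<in> P.C"
    show "vf_eq PM (act (lscale (PL n) s a)) (\<lambda>c x i. s * act a c x i)"
    proof (rule vf_eq_PMI)
      fix c z e i assume c: "c \<in> mcharts PM" and z: "z \<in> mimg PM c" and e: "e \<in> {1..n}" "i \<in> mind (Y e)"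
      show "act (lscale (PL n) s a) c z (e, i) = s * act a c z (e, i)"
        using action_linear(2)[OF e(1) chart_factor[OF c e(1)] fac_mimg[OF c z e(1)] e(2) C[OF a e(1)] C[OF a e(1)]]
        by (simp add: product_action_apply[OF e(1)] PL_scale)
    qed
  qed
qed

text \<open>
  The Schouten bracket of the action with the mixed product splits into the direct product cobracket
  and two Lie brackets with \<open>att\<close>, which together are the cobracket of the power.
\<close>

proposition compatible_mix:
  fixes u v :: "nat \<Rightarrow> nat \<Rightarrow> 'g \<times> ('g \<Rightarrow> 'k)"
  assumes triple: "manin_triple (PL n) (power_form n) (lagr_g D n) (lagr_gstar D n) {1..N} u v"
    and a: "a \<in> lcarrier (PL n)"
  shows "bvf_eq PM (schouten_vf PM (act a) mix) (act_tensor (PL n) act (coboundary (PL n) (tensor_sum {1..N} u v) a))"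
  unfolding bvf_eq_def
proof (intro ballI)
  fix c z p q assume c: "c \<in> mcharts PM" and z: "z \<in> mimg PM c" and p: "p \<in> mind PM" and q: "q \<in> mind PM"
  obtain e i f j where p': "p = (e, i)" "e \<in> {1..n}" and q': "q = (f, j)" "f \<in> {1..n}"
    using p q by (auto simp: PM_simps)
  have F: "restrict0 (lcarrier (PL n)) (\<lambda>a. act a c z (e, i)) = factor_functional n e (theta c z (e, i))"
    if "e \<in> {1..n}" for e i
    unfolding factor_functional_def restrict0_def using that by (auto simp: fun_eq_iff act_apply PL_C)
  have "schouten_vf PM (act a) mix c z p q = schouten_vf PM (act a) direct c z p q
      + vf_bracket PM (act a) (act (att c z p)) c z q - vf_bracket PM (act a) (act (att c z q)) c z p"
    by (rule schouten_vf_twist[where M = PM and P = mix and ?P0.0 = direct and c = c and x = z and H = "\<lambda>a. act (att c z a)",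
          OF mix_value[OF c z] att_skew[OF c z] mix_pderiv[OF c z] p q])
  also have "\<dots> = (if e = f then \<delta> (a e) (theta c z (e, i)) (theta c z (f, j)) else 0)
      - theta c z (f, j) (br (a f) (attached (theta c z (e, i)) e f))
      + theta c z (e, i) (br (a e) (attached (theta c z (f, j)) f e))"
    using schouten_vf_direct[OF c z a, of e i f j] vf_bracket_act[OF c z a att_PL[of c z p], of f j]
      vf_bracket_act[OF c z a att_PL[of c z q], of e i]
      p q unfolding p'(1) q'(1) att_apply[OF p'(2)] att_apply[OF q'(2)] by simp
  also have "\<dots> = coboundary (PL n) (tensor_sum {1..N} u v) a
      (factor_functional n e (theta c z (e, i))) (factor_functional n f (theta c z (f, j)))"
    using cobracket_power[OF triple p'(2) q'(2) _ _ a, of "theta c z (e, i)" "theta c z (f, j)"]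
      theta_in_dual[OF c z p] theta_in_dual[OF c z q] p'(1) q'(1) by simp
  also have "\<dots> = act_tensor (PL n) act (coboundary (PL n) (tensor_sum {1..N} u v) a) c z p q"
    unfolding act_tensor_def p'(1) q'(1) F[OF p'(2)] F[OF q'(2)] ..
  finally show "schouten_vf PM (act a) mix c z p q =
      act_tensor (PL n) act (coboundary (PL n) (tensor_sum {1..N} u v) a) c z p q" .
qed

end


section \<open>Projections to pairs of factors\<close>

context manifold_family
begin

lemma reads_factors_pair:
  assumes "1 \<le> j" "j < k" "k \<le> n"
  shows "reads_factors (pair_manifold (Y j) (Y k)) (\<lambda>y. (y j, y k))
    (case_sum (\<lambda>_. j) (\<lambda>_. k)) (case_sum id id) (\<lambda>d e. if e = j then fst d else snd d)"
  using assms unfolding reads_factors_def pair_manifold_def by auto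

lemma smooth_map_pair:
  assumes jk: "1 \<le> j" "j < k" "k \<le> n"
  shows "smooth_map PM (pair_manifold (Y j) (Y k)) (\<lambda>y. (y j, y k))"
  unfolding smooth_map_def
proof (intro conjI ballI)
  have j: "j \<in> {1..n}" and k: "k \<in> {1..n}" using jk by auto
  let ?N = "pair_manifold (Y j) (Y k)"
  have cont: "continuous_map (mtop PM) (mtop (Y e)) (\<lambda>y. y e)" if "e \<in> {1..n}" for e
    unfolding PM_simps using that by (rule continuous_map_product_coordinates)
  show "continuous_map (mtop PM) (mtop ?N) (\<lambda>y. (y j, y k))"
    using cont[OF j] cont[OF k] by (simp add: pair_manifold_def continuous_map_paired)
  fix c d s assume c: "c \<in> mcharts PM" and d: "d \<in> mcharts ?N" and s: "s \<in> mind ?N"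
  note rf = reads_factors_pair[OF jk, unfolded reads_factors_def]
  let ?e = "case_sum (\<lambda>_. j) (\<lambda>_. k) s" and ?i = "case_sum id id s"
  let ?d = "if ?e = j then fst d else snd d"
  have e: "?e \<in> {1..n}" and i: "?i \<in> mind (Y ?e)" and d': "?d \<in> mcharts (Y ?e)"
    and f: "\<And>q. mcoord ?N d (q j, q k) s = mcoord (Y ?e) ?d (q ?e) ?i"
    and dom: "\<And>q. (q j, q k) \<in> mdom ?N d \<Longrightarrow> q ?e \<in> mdom (Y ?e) ?d"
    using rf d s by blast+
  have dj: "openin (mtop (Y j)) (mdom (Y j) (fst d))" and dk: "openin (mtop (Y k)) (mdom (Y k) (snd d))"
    using d manifold_open_mdom[OF factor_manifold[OF j]] manifold_open_mdom[OF factor_manifold[OF k]]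
    by (auto simp: pair_manifold_def)
  have "openin (mtop PM) ({p \<in> mdom PM c. p j \<in> mdom (Y j) (fst d)} \<inter> {p \<in> mdom PM c. p k \<in> mdom (Y k) (snd d)})"
    by (intro openin_Int openin_continuous_map_preimage_gen[OF cont[OF j] openin_mdom_PM[OF c] dj]
        openin_continuous_map_preimage_gen[OF cont[OF k] openin_mdom_PM[OF c] dk])
  moreover have "{p \<in> mdom PM c. p j \<in> mdom (Y j) (fst d)} \<inter> {p \<in> mdom PM c. p k \<in> mdom (Y k) (snd d)} =
      local_dom PM ?N (\<lambda>y. (y j, y k)) c d"
    by (cases d) (auto simp: local_dom_def pair_manifold_def)
  ultimately have U: "openin (mtop PM) (local_dom PM ?N (\<lambda>y. (y j, y k)) c d)" by simp
  show "smooth_on (mind PM) (mcoord PM c ` local_dom PM ?N (\<lambda>y. (y j, y k)) c d) (local_rep PM ?N (\<lambda>y. (y j, y k)) c d s)"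
    by (rule smooth_on_local_rep_factor[where f = "\<lambda>y. (y j, y k)", OF c e d' i U _ _ f])
      (use dom in \<open>auto simp: local_dom_def\<close>)
qed

lemma bvf_related_pair:
  assumes jk: "1 \<le> j" "j < k" "k \<le> n"
    and P: "\<And>e. e \<in> {1..n} \<Longrightarrow> bvf_related (Y e) (Y e) id (P e) (P e)"
    and R: "\<And>e q. e \<in> {1..n} \<Longrightarrow> q \<in> {1..m} \<Longrightarrow> vf_related (Y e) (Y e) id (\<rho> e (\<xi> q)) (\<rho> e (\<xi> q))"
    and Q: "\<And>e q. e \<in> {1..n} \<Longrightarrow> q \<in> {1..m} \<Longrightarrow> vf_related (Y e) (Y e) id (\<kappa> e (x q)) (\<kappa> e (x q))"
  shows "bvf_related PM (pair_manifold (Y j) (Y k)) (\<lambda>y. (y j, y k)) (mixed_product n m x \<xi> Y P \<rho> \<kappa>)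
    (mixed_product2 m x \<xi> (Y j) (P j) (\<rho> j) (Y k) (P k) (\<kappa> k))"
  unfolding bvf_related_def
proof (intro ballI)
  let ?N = "pair_manifold (Y j) (Y k)" and ?f = "\<lambda>y. (y j, y k)"
  fix c d p s t assume c: "c \<in> mcharts PM" and d: "d \<in> mcharts ?N" and p: "p \<in> local_dom PM ?N ?f c d"
    and s: "s \<in> mind ?N" and t: "t \<in> mind ?N"
  obtain d1 d2 where d': "d = (d1, d2)" "d1 \<in> mcharts (Y j)" "d2 \<in> mcharts (Y k)"
    using d by (auto simp: pair_manifold_def)
  have p': "p j \<in> mdom (Y j) d1" "p k \<in> mdom (Y k) d2"
    using p by (auto simp: local_dom_def pair_manifold_def d')
  have "mcoord (Y j) d1 (p j) \<in> extensional (mind (Y j))" "mcoord (Y k) d2 (p k) \<in> extensional (mind (Y k))"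
    using manifold_mimg_extensional[OF factor_manifold d'(2)] manifold_mimg_extensional[OF factor_manifold d'(3)]
      p' jk by auto
  then have r: "(\<lambda>l\<in>mind (Y j). mcoord ?N d (p j, p k) (Inl l)) = mcoord (Y j) d1 (p j)"
    "(\<lambda>l\<in>mind (Y k). mcoord ?N d (p j, p k) (Inr l)) = mcoord (Y k) d2 (p k)"
    by (auto simp: pair_manifold_def d'(1) fun_eq_iff extensional_def)
  have push: "(\<Sum>a\<in>mind PM. \<Sum>b\<in>mind PM. jacobian PM ?N ?f c d p s a * jacobian PM ?N ?f c d p t b
      * mixed_product n m x \<xi> Y P \<rho> \<kappa> c (mcoord PM c p) a b) =
    mixed_product2 m x \<xi> (Y j) (P j) (\<rho> j) (Y k) (P k) (\<kappa> k) d (mcoord ?N d (p j, p k)) s t"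
    by (subst jacobian_sum_mixed_product[where P = P and \<rho> = \<rho> and \<kappa> = \<kappa> and \<xi> = \<xi> and x = x and m = m
          and y = "\<lambda>e. mcoord (Y e) (if e = j then d1 else d2) (p e)",
          OF reads_factors_pair[OF jk] c d p s t P R Q])
      (use jk in \<open>simp_all add: d'(1) mixed_product2_def lift_bvf_fst_def lift_bvf_snd_def lift_vf_fst_def
        lift_vf_snd_def wedge_def sum_fun_apply sum_negf r[unfolded d'(1)] mult.commute split: sum.split\<close>)
  then show "mixed_product2 m x \<xi> (Y j) (P j) (\<rho> j) (Y k) (P k) (\<kappa> k) d (mcoord ?N d (p j, p k)) s t =
    (\<Sum>a\<in>mind PM. \<Sum>b\<in>mind PM. jacobian PM ?N ?f c d p s a * jacobian PM ?N ?f c d p t b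
      * mixed_product n m x \<xi> Y P \<rho> \<kappa> c (mcoord PM c p) a b)" by (rule sym)
qed

end

section \<open>The mixed product as a Poisson space of the power of the double\<close>

theorem proposition5p7:
  fixes G :: "('k::real_normed_field, 'g::ab_group_add) lie_alg"
    and \<delta> :: "'g \<Rightarrow> ('k, 'g) tensor2"
    and D :: "('k, 'g \<times> ('g \<Rightarrow> 'k)) lie_alg"
    and n m N :: nat
    and x :: "nat \<Rightarrow> 'g" and \<xi> :: "nat \<Rightarrow> 'g \<Rightarrow> 'k"
    and u v :: "nat \<Rightarrow> nat \<Rightarrow> 'g \<times> ('g \<Rightarrow> 'k)"
    and Y :: "nat \<Rightarrow> ('k, 'p, 'i, 'c) manifold"
    and \<pi> :: "nat \<Rightarrow> ('k, 'i, 'c) bvf"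
    and \<sigma> :: "nat \<Rightarrow> 'g \<times> ('g \<Rightarrow> 'k) \<Rightarrow> ('k, 'i, 'c) vf"
  assumes "lie_bialgebra G \<delta>"
    and "is_double G \<delta> D"
    and "n \<ge> 2"
    and "is_basis (lscale G) (lcarrier G) {1..m} x"
    and "is_basis fscale (dual_space G) {1..m} \<xi>"
    and "dual_wrt (\<lambda>a \<alpha>. \<alpha> a) {1..m} x \<xi>"
    and "is_basis (lscale (power_lie D n)) (lagr_g D n) {1..N} u"
    and "is_basis (lscale (power_lie D n)) (lagr_gstar D n) {1..N} v"
    and "dual_wrt (power_form n) {1..N} u v"
    and "\<And>j. j \<in> {1..n} \<Longrightarrow>
           left_poisson_space D
             (coboundary D (tensor_sum {1..m} (\<lambda>i. (x i, 0)) (\<lambda>i. (0, \<xi> i))))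
             (Y j) (\<pi> j) (\<sigma> j)"
  shows "left_poisson_space (power_lie D n)
           (coboundary (power_lie D n) (tensor_sum {1..N} u v))
           (prod_manifold n Y)
           (mixed_product n m x \<xi> Y \<pi> (\<lambda>j. rho_of (\<sigma> j)) (\<lambda>j. lambda_of (\<sigma> j)))
           (product_action n Y \<sigma>) \<and>
         (\<forall>j k. 1 \<le> j \<and> j < k \<and> k \<le> n \<longrightarrow>
           smooth_map (prod_manifold n Y) (pair_manifold (Y j) (Y k)) (\<lambda>y. (y j, y k)) \<and>
           bvf_related (prod_manifold n Y) (pair_manifold (Y j) (Y k)) (\<lambda>y. (y j, y k))
             (mixed_product n m x \<xi> Y \<pi> (\<lambda>j. rho_of (\<sigma> j)) (\<lambda>j. lambda_of (\<sigma> j)))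
             (mixed_product2 m x \<xi> (Y j) (\<pi> j) (rho_of (\<sigma> j)) (Y k) (\<pi> k) (lambda_of (\<sigma> k))))"
proof -
  interpret manin_triple D double_form "g_part D" "gstar_part D" "{1..m}" "\<lambda>i. (x i, 0)" "\<lambda>i. (0, \<xi> i)"
    by (rule manin_triple_double[OF assms(1,2,4,5,6)])
  interpret poisson_family D m x \<xi> n Y \<pi> \<sigma>
    by unfold_locales (rule assms(10))
  have triple: "manin_triple (PL n) (power_form n) (lagr_g D n) (lagr_gstar D n) {1..N} u v"
    by (rule manin_triple_power) (use assms(3,7,8,9) in auto)
  have "left_poisson_space (PL n) (coboundary (PL n) (tensor_sum {1..N} u v)) PM mix act"
    unfolding left_poisson_space_def
    using manin_triple.lie_bialgebra_coboundary[OF triple] manifold_PM poisson_structure_mix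
      left_action_act compatible_mix[OF triple] by blast
  moreover have "smooth_map PM (pair_manifold (Y j) (Y k)) (\<lambda>y. (y j, y k)) \<and>
      bvf_related PM (pair_manifold (Y j) (Y k)) (\<lambda>y. (y j, y k)) mix
        (mixed_product2 m x \<xi> (Y j) (\<pi> j) (rho_of (\<sigma> j)) (Y k) (\<pi> k) (lambda_of (\<sigma> k)))"
    if jk: "1 \<le> j" "j < k" "k \<le> n" for j k
    using smooth_map_pair[OF jk]
      bvf_related_pair[OF jk, where P = \<pi> and \<rho> = "\<lambda>j. rho_of (\<sigma> j)" and \<kappa> = "\<lambda>j. lambda_of (\<sigma> j)" and m = m and x = x and \<xi> = \<xi>]
      space_bivector_field vector_field_rho_lambda
    unfolding bivector_field_def vector_field_def by blast
  ultimately show ?thesis by blast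
qed

end
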